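(* Let $\tilde{E}/\mathbb{C}(z)$ be a Picard-Vessiot extension for the matrix $A\in\mathrm{Mat}_n(\mathbb{C}(z))$. If the equation $\frac{\partial y}{\partial z}=Ay$ is equivalent to its conjugate $\frac{\partial y}{\partial z}=(\tau.A)y$, then $\tilde{E}/\mathbb{C}(z)$ descends to a Picard-Vessiot extension $E/\mathbb{R}(z)$; that is, there exists a Picard-Vessiot extension $E/\mathbb{R}(z)$ such that $E\otimes_{\mathbb{R}(z)}\mathbb{C}(z)$ and $\tilde E$ are isomorphic as differential rings over $\mathbb{C}(z)$.
   Context: $\mathbb{C}(z)$ and $\mathbb{R}(z)$ carry the derivation $\partial=d/dz$. $\tau$ denotes complex conjugation, the generator of $\mathrm{Gal}(\mathbb{C}/\mathbb{R})$; $\tau.A$ is obtained from $A$ by applying $\tau$ to the coefficients of the rational functions, i.e. $(\tau.A)(z)=\overline{A(\bar z)}$. Two equations $\frac{\partial y}{\partial z}=Ay$ and $\frac{\partial y}{\partial z}=By$ with $A,B\in\mathrm{Mat}_n(\mathbb{C}(z))$ are equivalent if there exists $C\in\mathrm{GL}_n(\mathbb{C}(z))$ with $C^{-1}AC-C^{-1}\frac{\partial C}{\partial z}=B$. Let $F$ be a differential field of characteristic zero with field of constants $K$. A Picard-Vessiot extension $E/F$ for $A\in\mathrm{Mat}_m(F)$ is a differential field $E$ over $F$ such that there is $W\in\mathrm{GL}_m(E)$ with $\partial(W)=AW$, $E=F(W_{ij})$, and the field of constants of $E$ is $K$. A Picard-Vessiot extension of $F$ is one for some $m$ and some matrix over $F$.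 The tensor product carries the derivation given by the Leibniz rule. *)

theory Defs
  imports
    Complex_Main
    "HOL-Computational_Algebra.Polynomial"
    "HOL-Computational_Algebra.Fraction_Field"
    "HOL-Algebra.QuotRing"
    "HOL-Algebra.Generated_Fields"
    "HOL-Algebra.Free_Abelian_Groups"
    "HOL-Algebra.Algebraic_Closure_Type"
    "Jordan_Normal_Form.Matrix"
begin

section \<open>Rational functions\<close>

text \<open>The field of rational functions over a field \<open>k\<close> is the type \<open>k poly fract\<close>.\<close>

text \<open>The derivation \<open>d/dz\<close>, by the quotient rule on any representation as a fraction.\<close>

definition rat_deriv :: "'a::idom poly fract \<Rightarrow> 'a poly fract" where
  "rat_deriv x = (THE y. \<exists>p q. q \<noteq> 0 \<and> x = Fract p q \<and>
     y = Fract (pderiv p * q - p * pderiv q) (q * q))"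

lemma rat_deriv_Fract:
  assumes "q \<noteq> 0"
  shows "rat_deriv (Fract p q) = Fract (pderiv p * q - p * pderiv q) (q * q)"
  unfolding rat_deriv_def
proof (rule the_equality)
  fix y
  assume "\<exists>p' q'. q' \<noteq> 0 \<and> Fract p q = Fract p' q' \<and>
     y = Fract (pderiv p' * q' - p' * pderiv q') (q' * q')"
  then obtain p' q' where nz: "q' \<noteq> 0" and f: "Fract p q = Fract p' q'"
    and y: "y = Fract (pderiv p' * q' - p' * pderiv q') (q' * q')" by blast
  have eq: "p * q' = p' * q" using f assms nz by (simp add: eq_fract)
  have "pderiv (p * q') = pderiv (p' * q)" by (simp add: eq)
  hence eq': "p * pderiv q' + q' * pderiv p = p' * pderiv q + q * pderiv p'"
    by (simp add: pderiv_mult)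
  have "(pderiv p' * q' - p' * pderiv q') * (q * q) - (pderiv p * q - p * pderiv q) * (q' * q')
      = (p * q' - p' * q) * (pderiv q * q' + q * pderiv q')
        - q * q' * ((p * pderiv q' + q' * pderiv p) - (p' * pderiv q + q * pderiv p'))"
    by (simp add: algebra_simps)
  also have "\<dots> = 0" by (simp add: eq eq')
  finally show "y = Fract (pderiv p * q - p * pderiv q) (q * q)"
    using nz assms by (simp add: y eq_fract)
qed (use assms in blast)

text \<open>Application of \<open>h\<close> to the coefficients; meaningful for injective ring homomorphisms \<open>h\<close>.\<close>

definition rat_map :: "('a::idom \<Rightarrow> 'b::idom) \<Rightarrow> 'a poly fract \<Rightarrow> 'b poly fract" where
  "rat_map h x = (THE y. \<exists>p q. q \<noteq> 0 \<and> x = Fract p q \<and>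
     y = Fract (map_poly h p) (map_poly h q))"

lemma map_poly_mult_hom:
  fixes h :: "'a::comm_semiring_0 \<Rightarrow> 'b::comm_semiring_0"
  assumes "h 0 = 0" "\<And>x y. h (x + y) = h x + h y" "\<And>x y. h (x * y) = h x * h y"
  shows "map_poly h (p * q) = map_poly h p * map_poly h q"
proof (rule poly_eqI)
  fix n
  have s: "h (sum f A) = (\<Sum>i\<in>A. h (f i))" if "finite A" for f and A :: "nat set"
    using that by induction (auto simp: assms)
  show "coeff (map_poly h (p * q)) n = coeff (map_poly h p * map_poly h q) n"
    by (simp add: coeff_map_poly assms coeff_mult s)
qed

lemma rat_map_Fract:
  fixes h :: "'a::idom \<Rightarrow> 'b::idom"
  assumes "h 0 = 0" "\<And>x y. h (x + y) = h x + h y" "\<And>x y. h (x * y) = h x * h y"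
    and "\<And>x. h x = 0 \<Longrightarrow> x = 0" and "q \<noteq> 0"
  shows "rat_map h (Fract p q) = Fract (map_poly h p) (map_poly h q)"
  unfolding rat_map_def
proof (rule the_equality)
  have nz: "map_poly h q \<noteq> 0" if "q \<noteq> 0" for q
    using that assms(1,4) by (metis coeff_0 coeff_map_poly poly_eqI)
  fix y
  assume "\<exists>p' q'. q' \<noteq> 0 \<and> Fract p q = Fract p' q' \<and> y = Fract (map_poly h p') (map_poly h q')"
  then obtain p' q' where q': "q' \<noteq> 0" and f: "Fract p q = Fract p' q'"
    and y: "y = Fract (map_poly h p') (map_poly h q')" by blast
  have "p * q' = p' * q" using f assms(5) q' by (simp add: eq_fract)
  hence "map_poly h p * map_poly h q' = map_poly h p' * map_poly h q"
    by (metis map_poly_mult_hom[of h, OF assms(1-3)])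
  thus "y = Fract (map_poly h p) (map_poly h q)"
    using nz[OF q'] nz[OF assms(5)] by (simp add: y eq_fract)
qed (use assms in blast)

definition rat_cnj :: "complex poly fract \<Rightarrow> complex poly fract" where
  "rat_cnj = rat_map cnj"

definition rat_of_real :: "real poly fract \<Rightarrow> complex poly fract" where
  "rat_of_real = rat_map complex_of_real"

text \<open>Equivalence of \<open>y' = A y\<close> and \<open>y' = B y\<close>; \<open>C'\<close> is the inverse of \<open>C\<close>.\<close>

definition equivalent_equations ::
    "nat \<Rightarrow> 'a::field poly fract mat \<Rightarrow> 'a poly fract mat \<Rightarrow> bool" where
  "equivalent_equations n A B \<longleftrightarrow>
     A \<in> carrier_mat n n \<and> B \<in> carrier_mat n n \<and>
     (\<exists>C \<in> carrier_mat n n. \<exists>C' \<in> carrier_mat n n.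
        inverts_mat C C' \<and> inverts_mat C' C \<and>
        C' * A * C - C' * map_mat rat_deriv C = B)"


section \<open>Differential rings and fields\<close>

record 'a diff_ring = "'a ring" +
  deriv :: "'a \<Rightarrow> 'a"

locale diff_cring = cring R for R :: "'a diff_ring" (structure) +
  assumes deriv_closed: "x \<in> carrier R \<Longrightarrow> deriv R x \<in> carrier R"
    and deriv_add: "\<lbrakk> x \<in> carrier R; y \<in> carrier R \<rbrakk> \<Longrightarrow>
      deriv R (x \<oplus> y) = deriv R x \<oplus> deriv R y"
    and deriv_mult: "\<lbrakk> x \<in> carrier R; y \<in> carrier R \<rbrakk> \<Longrightarrow>
      deriv R (x \<otimes> y) = deriv R x \<otimes> y \<oplus> x \<otimes> deriv R y"

locale diff_field = diff_cring R + field R for R :: "'a diff_ring" (structure)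

locale diff_field_char_0 = diff_field R for R :: "'a diff_ring" (structure) +
  assumes char_0: "n > 0 \<Longrightarrow> add_pow R (n::nat) \<one> \<noteq> \<zero>"

definition constants :: "'a diff_ring \<Rightarrow> 'a set" where
  "constants R = {x \<in> carrier R. deriv R x = \<zero>\<^bsub>R\<^esub>}"

definition diff_ring_hom :: "'a diff_ring \<Rightarrow> 'b diff_ring \<Rightarrow> ('a \<Rightarrow> 'b) set" where
  "diff_ring_hom R S =
     {h \<in> Ring.ring_hom R S. \<forall>x \<in> carrier R. h (deriv R x) = deriv S (h x)}"

text \<open>\<open>R\<close> and \<open>S\<close> are regarded as algebras over \<open>F\<close> through \<open>f\<close> and \<open>g\<close>.\<close>

definition diff_isomorphic_over ::
    "'f diff_ring \<Rightarrow> 'a diff_ring \<Rightarrow> ('f \<Rightarrow> 'a) \<Rightarrow> 'b diff_ring \<Rightarrow> ('f \<Rightarrow> 'b) \<Rightarrow> bool" where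
  "diff_isomorphic_over F R f S g \<longleftrightarrow>
     (\<exists>h \<in> ring_iso R S. h \<in> diff_ring_hom R S \<and> (\<forall>x \<in> carrier F. h (f x) = g x))"

definition rat_diff_field :: "'a::field poly fract diff_ring" where
  "rat_diff_field =
     \<lparr> carrier = UNIV, monoid.mult = (*), monoid.one = 1,
       ring.zero = 0, ring.add = (+), deriv = rat_deriv \<rparr>"


lemma diff_field_char_0_rat:
  "diff_field_char_0 (rat_diff_field :: 'a::field_char_0 poly fract diff_ring)"
proof -
  let ?R = "rat_diff_field :: 'a poly fract diff_ring"
  have R: "carrier ?R = UNIV" "monoid.mult ?R = (*)" "monoid.one ?R = 1"
    "ring.zero ?R = 0" "ring.add ?R = (+)" "deriv ?R = rat_deriv"
    by (simp_all add: rat_diff_field_def)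
  have add: "rat_deriv (x + y) = rat_deriv x + rat_deriv y" for x y :: "'a poly fract"
    by (cases x; cases y)
      (simp add: rat_deriv_Fract eq_fract pderiv_mult pderiv_add algebra_simps)
  have mul: "rat_deriv (x * y) = rat_deriv x * y + x * rat_deriv y" for x y :: "'a poly fract"
    by (cases x; cases y)
      (simp add: rat_deriv_Fract eq_fract pderiv_mult algebra_simps)
  have cr: "cring ?R"
  proof (intro cringI abelian_groupI comm_monoidI)
    show "\<exists>y\<in>carrier ?R. y \<oplus>\<^bsub>?R\<^esub> x = \<zero>\<^bsub>?R\<^esub>" for x
      by (auto simp: R intro: exI[of _ "- x"])
  qed (auto simp: R algebra_simps)
  interpret cring ?R by (rule cr)
  have U: "x \<in> Units ?R" if "x \<noteq> 0" for x
    using that unfolding Units_def R by (auto intro!: exI[of _ "inverse x"])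
  have pw: "add_pow ?R n (monoid.one ?R) = of_nat n" for n :: nat
    by (induction n) (simp_all add: R add.commute)
  have n0: "of_nat n = (0 :: 'a poly fract) \<longleftrightarrow> n = 0" for n
  proof -
    have "of_nat n = Fract (of_nat n :: 'a poly) 1"
      by (induction n) (auto simp: Zero_fract_def One_fract_def)
    thus ?thesis by (simp add: Zero_fract_def eq_fract)
  qed
  have "Units ?R = carrier ?R - {\<zero>\<^bsub>?R\<^esub>}"
  proof (intro equalityI subsetI)
    show "x \<in> carrier ?R - {\<zero>\<^bsub>?R\<^esub>}" if "x \<in> Units ?R" for x
      using that unfolding Units_def R by auto
    show "x \<in> Units ?R" if "x \<in> carrier ?R - {\<zero>\<^bsub>?R\<^esub>}" for x
      using that by (intro U) (simp add: R)
  qed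
  hence fld: "field ?R" by (rule cring_fieldI)
  have dc: "diff_cring ?R"
    by (intro diff_cring.intro cr diff_cring_axioms.intro) (auto simp: R add mul)
  show ?thesis
    by (intro diff_field_char_0.intro diff_field.intro dc fld diff_field_char_0_axioms.intro)
      (unfold pw, simp only: n0 R neq0_conv not_False_eq_True)
qed


section \<open>Picard-Vessiot extensions\<close>

definition mat_prod :: "('a, 'b) ring_scheme \<Rightarrow> nat \<Rightarrow> 'a mat \<Rightarrow> 'a mat \<Rightarrow> 'a mat" where
  "mat_prod R m M N =
     mat m m (\<lambda>(i, j). finsum R (\<lambda>k. M $$ (i, k) \<otimes>\<^bsub>R\<^esub> N $$ (k, j)) {..<m})"

definition mat_one :: "('a, 'b) ring_scheme \<Rightarrow> nat \<Rightarrow> 'a mat" where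
  "mat_one R m = mat m m (\<lambda>(i, j). if i = j then \<one>\<^bsub>R\<^esub> else \<zero>\<^bsub>R\<^esub>)"

definition mats_over :: "('a, 'b) ring_scheme \<Rightarrow> nat \<Rightarrow> 'a mat set" where
  "mats_over R m = {M \<in> carrier_mat m m. elements_mat M \<subseteq> carrier R}"

definition GL_over :: "('a, 'b) ring_scheme \<Rightarrow> nat \<Rightarrow> 'a mat set" where
  "GL_over R m = {M \<in> mats_over R m. \<exists>N \<in> mats_over R m.
     mat_prod R m M N = mat_one R m \<and> mat_prod R m N M = mat_one R m}"

text \<open>The extension \<open>E/F\<close> is given by the embedding \<open>\<iota>\<close> of \<open>F\<close> into \<open>E\<close>.\<close>

definition picard_vessiot_for ::
    "'f diff_ring \<Rightarrow> 'e diff_ring \<Rightarrow> ('f \<Rightarrow> 'e) \<Rightarrow> nat \<Rightarrow> 'f mat \<Rightarrow> bool" where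
  "picard_vessiot_for F E \<iota> m A \<longleftrightarrow>
     diff_field_char_0 F \<and> diff_field E \<and> \<iota> \<in> diff_ring_hom F E \<and>
     A \<in> mats_over F m \<and>
     (\<exists>W \<in> GL_over E m.
        map_mat (deriv E) W = mat_prod E m (map_mat \<iota> A) W \<and>
        carrier E = generate_field E (\<iota> ` carrier F \<union> elements_mat W)) \<and>
     constants E = \<iota> ` constants F"

definition picard_vessiot :: "'f diff_ring \<Rightarrow> 'e diff_ring \<Rightarrow> ('f \<Rightarrow> 'e) \<Rightarrow> bool" where
  "picard_vessiot F E \<iota> \<longleftrightarrow> (\<exists>m A. picard_vessiot_for F E \<iota> m A)"


section \<open>Tensor products of differential algebras\<close>

text \<open>
  For \<open>F\<close>-algebras \<open>A\<close> and \<open>B\<close> with structure maps \<open>f\<close> and \<open>g\<close>, the tensor product over \<open>F\<close> is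
  the free abelian group on \<open>A \<times> B\<close>, made into a ring by \<open>(a, b) (a', b') = (a a', b b')\<close>,
  modulo the ideal generated by the biadditivity and \<open>F\<close>-balancedness relations.
\<close>

definition free_ring_on_pairs ::
    "'a diff_ring \<Rightarrow> 'b diff_ring \<Rightarrow> ('a \<times> 'b \<Rightarrow>\<^sub>0 int) ring" where
  "free_ring_on_pairs A B =
     \<lparr> carrier = carrier (free_Abelian_group (carrier A \<times> carrier B)),
       monoid.mult = (\<lambda>x y. frag_extend (\<lambda>(a, b). frag_extend (\<lambda>(a', b').
                frag_of (a \<otimes>\<^bsub>A\<^esub> a', b \<otimes>\<^bsub>B\<^esub> b')) y) x),
       monoid.one = frag_of (\<one>\<^bsub>A\<^esub>, \<one>\<^bsub>B\<^esub>), ring.zero = 0, ring.add = (+) \<rparr>"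

definition tensor_relations ::
    "'f diff_ring \<Rightarrow> 'a diff_ring \<Rightarrow> ('f \<Rightarrow> 'a) \<Rightarrow> 'b diff_ring \<Rightarrow> ('f \<Rightarrow> 'b) \<Rightarrow>
     ('a \<times> 'b \<Rightarrow>\<^sub>0 int) set" where
  "tensor_relations F A f B g =
     {frag_of (a \<oplus>\<^bsub>A\<^esub> a', b) - frag_of (a, b) - frag_of (a', b) | a a' b.
        a \<in> carrier A \<and> a' \<in> carrier A \<and> b \<in> carrier B} \<union>
     {frag_of (a, b \<oplus>\<^bsub>B\<^esub> b') - frag_of (a, b) - frag_of (a, b') | a b b'.
        a \<in> carrier A \<and> b \<in> carrier B \<and> b' \<in> carrier B} \<union>
     {frag_of (f c \<otimes>\<^bsub>A\<^esub> a, b) - frag_of (a, g c \<otimes>\<^bsub>B\<^esub> b) | a b c.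
        a \<in> carrier A \<and> b \<in> carrier B \<and> c \<in> carrier F}"

definition tensor_ideal ::
    "'f diff_ring \<Rightarrow> 'a diff_ring \<Rightarrow> ('f \<Rightarrow> 'a) \<Rightarrow> 'b diff_ring \<Rightarrow> ('f \<Rightarrow> 'b) \<Rightarrow>
     ('a \<times> 'b \<Rightarrow>\<^sub>0 int) set" where
  "tensor_ideal F A f B g = Idl\<^bsub>free_ring_on_pairs A B\<^esub> (tensor_relations F A f B g)"

definition pure_tensor ::
    "'f diff_ring \<Rightarrow> 'a diff_ring \<Rightarrow> ('f \<Rightarrow> 'a) \<Rightarrow> 'b diff_ring \<Rightarrow> ('f \<Rightarrow> 'b) \<Rightarrow>
     'a \<Rightarrow> 'b \<Rightarrow> ('a \<times> 'b \<Rightarrow>\<^sub>0 int) set" where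
  "pure_tensor F A f B g a b =
     tensor_ideal F A f B g +>\<^bsub>free_ring_on_pairs A B\<^esub> frag_of (a, b)"

text \<open>
  The Leibniz rule \<open>\<partial>(a \<otimes> b) = \<partial>a \<otimes> b + a \<otimes> \<partial>b\<close> on representatives. The union below is over
  representatives of the same coset, all of which yield the same coset
  (cf. the definition of \<^const>\<open>rcoset_mult\<close>).
\<close>

definition leibniz ::
    "'a diff_ring \<Rightarrow> 'b diff_ring \<Rightarrow> ('a \<times> 'b \<Rightarrow>\<^sub>0 int) \<Rightarrow> ('a \<times> 'b \<Rightarrow>\<^sub>0 int)" where
  "leibniz A B = frag_extend (\<lambda>(a, b). frag_of (deriv A a, b) + frag_of (a, deriv B b))"

definition diff_tensor ::
    "'f diff_ring \<Rightarrow> 'a diff_ring \<Rightarrow> ('f \<Rightarrow> 'a) \<Rightarrow> 'b diff_ring \<Rightarrow> ('f \<Rightarrow> 'b) \<Rightarrow>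
     ('a \<times> 'b \<Rightarrow>\<^sub>0 int) set diff_ring" where
  "diff_tensor F A f B g =
     (let P = free_ring_on_pairs A B; I = tensor_ideal F A f B g; Q = P Quot I
      in \<lparr> carrier = carrier Q, monoid.mult = monoid.mult Q, monoid.one = monoid.one Q,
           ring.zero = ring.zero Q, ring.add = ring.add Q,
           deriv = (\<lambda>c. \<Union>x\<in>c. I +>\<^bsub>P\<^esub> leibniz A B x) \<rparr>)"

text \<open>The tensor product of differential algebras is a differential ring.\<close>

context
  fixes A :: "'a diff_ring" and B :: "'b diff_ring"
  assumes A: "diff_cring A" and B: "diff_cring B"
begin

interpretation A: diff_cring A by (rule A)
interpretation B: diff_cring B by (rule B)

private abbreviation (input) "P \<equiv> free_ring_on_pairs A B"

private lemma P_simps: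
  "carrier P = {c. Poly_Mapping.keys c \<subseteq> carrier A \<times> carrier B}"
  "monoid.one P = frag_of (\<one>\<^bsub>A\<^esub>, \<one>\<^bsub>B\<^esub>)" "ring.zero P = 0" "ring.add P = (+)"
  by (auto simp: free_ring_on_pairs_def)

private lemma P_mult_of: "frag_of (a, b) \<otimes>\<^bsub>P\<^esub> frag_of (a', b') = frag_of (a \<otimes>\<^bsub>A\<^esub> a', b \<otimes>\<^bsub>B\<^esub> b')"
  by (simp add: free_ring_on_pairs_def)

private lemma P_mult_left:
  "(x - y) \<otimes>\<^bsub>P\<^esub> z = x \<otimes>\<^bsub>P\<^esub> z - y \<otimes>\<^bsub>P\<^esub> z"  "(x + y) \<otimes>\<^bsub>P\<^esub> z = x \<otimes>\<^bsub>P\<^esub> z + y \<otimes>\<^bsub>P\<^esub> z" "0 \<otimes>\<^bsub>P\<^esub> z = 0"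
  by (simp_all add: free_ring_on_pairs_def frag_extend_diff frag_extend_add)

private lemma fe_fun: "frag_extend (\<lambda>p. f p - g p) x = frag_extend f x - frag_extend g x"
  "frag_extend (\<lambda>p. f p + g p) x = frag_extend f x + frag_extend g x"
proof -
  have *: "frag_extend (\<lambda>p. f p + g p) x = frag_extend f x + frag_extend g x" for f g
    by (simp add: frag_extend_def frag_cmul_distrib2 sum.distrib)
  have "frag_extend (\<lambda>p. f p - g p) x + frag_extend g x = frag_extend f x"
    by (simp add: *[symmetric])
  thus "frag_extend (\<lambda>p. f p - g p) x = frag_extend f x - frag_extend g x"
    by (metis add_diff_cancel_right')
  show "frag_extend (\<lambda>p. f p + g p) x = frag_extend f x + frag_extend g x" by (rule *)
qed

private lemma P_mult_right:
  "z \<otimes>\<^bsub>P\<^esub> (x - y) = z \<otimes>\<^bsub>P\<^esub> x - z \<otimes>\<^bsub>P\<^esub> y"  "z \<otimes>\<^bsub>P\<^esub> (x + y) = z \<otimes>\<^bsub>P\<^esub> x + z \<otimes>\<^bsub>P\<^esub> y" "z \<otimes>\<^bsub>P\<^esub> 0 = 0"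
  by (simp_all add: free_ring_on_pairs_def frag_extend_diff frag_extend_add split_def fe_fun frag_extend_eq_0)

private lemma P_diff_closed: "x \<in> carrier P \<Longrightarrow> y \<in> carrier P \<Longrightarrow> x - y \<in> carrier P"
  using keys_diff[of x y] by (auto simp: P_simps)

private lemma P_add_closed: "x \<in> carrier P \<Longrightarrow> y \<in> carrier P \<Longrightarrow> x + y \<in> carrier P"
  using keys_add[of x y] by (auto simp: P_simps)

private lemma P_of_closed: "a \<in> carrier A \<Longrightarrow> b \<in> carrier B \<Longrightarrow> frag_of (a, b) \<in> carrier P"
  by (auto simp: P_simps)

private lemma P_induct [consumes 1, case_names zero of_ diff]:
  assumes "x \<in> carrier P" "Q 0"
    "\<And>a b. a \<in> carrier A \<Longrightarrow> b \<in> carrier B \<Longrightarrow> Q (frag_of (a, b))"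
    "\<And>x y. Q x \<Longrightarrow> Q y \<Longrightarrow> Q (x - y)"
  shows "Q x"
proof -
  have "Poly_Mapping.keys x \<subseteq> carrier A \<times> carrier B" using assms(1) by (simp add: P_simps)
  thus ?thesis by (induction x rule: frag_induction) (use assms(2-) in auto)
qed

private lemma P_mult_closed:
  assumes "x \<in> carrier P" "y \<in> carrier P" shows "x \<otimes>\<^bsub>P\<^esub> y \<in> carrier P"
  using assms(1)
proof (induction x rule: P_induct)
  case (of_ a b)
  show ?case using assms(2)
    by (induction y rule: P_induct)
      (use of_ in \<open>auto simp: P_mult_right P_mult_of P_simps(1) intro: P_diff_closed P_of_closed[unfolded P_simps] dest: subsetD[OF keys_diff]\<close>)
qed (auto simp: P_mult_left P_simps(1) dest: subsetD[OF keys_diff])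

private lemma P_comm:
  assumes "x \<in> carrier P" "y \<in> carrier P" shows "x \<otimes>\<^bsub>P\<^esub> y = y \<otimes>\<^bsub>P\<^esub> x"
  using assms(1)
proof (induction x rule: P_induct)
  case (of_ a b)
  show ?case using assms(2)
    by (induction y rule: P_induct)
      (use of_ in \<open>auto simp: P_mult_right P_mult_left P_mult_of A.m_comm B.m_comm\<close>)
qed (auto simp: P_mult_left P_mult_right)

private lemma P_assoc:
  assumes "x \<in> carrier P" "y \<in> carrier P" "z \<in> carrier P"
  shows "x \<otimes>\<^bsub>P\<^esub> y \<otimes>\<^bsub>P\<^esub> z = x \<otimes>\<^bsub>P\<^esub> (y \<otimes>\<^bsub>P\<^esub> z)"
  using assms(1)
proof (induction x rule: P_induct)
  case (of_ a b)
  note 1 = of_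
  show ?case using assms(2)
  proof (induction y rule: P_induct)
    case (of_ a' b')
    show ?case using assms(3)
      by (induction z rule: P_induct)
        (use of_ 1 in \<open>auto simp: P_mult_right P_mult_left P_mult_of A.m_assoc B.m_assoc\<close>)
  qed (auto simp: P_mult_left P_mult_right)
qed (auto simp: P_mult_left P_mult_right)

private lemma P_one: "x \<in> carrier P \<Longrightarrow> \<one>\<^bsub>P\<^esub> \<otimes>\<^bsub>P\<^esub> x = x"
  by (induction x rule: P_induct) (auto simp: P_simps(2) P_mult_right P_mult_of)

lemma cring_free_ring_on_pairs: "cring P"
proof (intro cringI abelian_groupI comm_monoidI)
  show "\<exists>y\<in>carrier P. y \<oplus>\<^bsub>P\<^esub> x = \<zero>\<^bsub>P\<^esub>" if "x \<in> carrier P" for x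
    using that by (intro bexI[of _ "- x"]) (auto simp: P_simps)
qed (use P_add_closed in \<open>auto simp: P_mult_closed P_assoc P_one P_mult_left P_simps(2-)
      algebra_simps intro: P_comm P_of_closed\<close>, (simp_all add: P_simps P_one[unfolded P_simps])?)

interpretation P: cring P by (rule cring_free_ring_on_pairs)

private abbreviation (input) "\<delta> \<equiv> leibniz A B"

private lemma d_simps: "\<delta> (x - y) = \<delta> x - \<delta> y" "\<delta> (x + y) = \<delta> x + \<delta> y" "\<delta> 0 = 0"
  "\<delta> (frag_of (a, b)) = frag_of (deriv A a, b) + frag_of (a, deriv B b)"
  by (simp_all add: leibniz_def frag_extend_diff frag_extend_add)

private lemma d_closed: "x \<in> carrier P \<Longrightarrow> \<delta> x \<in> carrier P"
  by (induction x rule: P_induct)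
    (auto simp: d_simps intro!: P_diff_closed P_add_closed P_of_closed A.deriv_closed B.deriv_closed P.zero_closed[unfolded P_simps(3)])

context
  fixes F :: "'f diff_ring" and f g
  assumes F: "diff_cring F" and f: "f \<in> diff_ring_hom F A" and g: "g \<in> diff_ring_hom F B"
begin

interpretation F: diff_cring F by (rule F)

private lemma fg: "c \<in> carrier F \<Longrightarrow> f c \<in> carrier A" "c \<in> carrier F \<Longrightarrow> g c \<in> carrier B"
   "c \<in> carrier F \<Longrightarrow> f (deriv F c) = deriv A (f c)" "c \<in> carrier F \<Longrightarrow> g (deriv F c) = deriv B (g c)"
  using f g by (auto simp: diff_ring_hom_def dest: ring_hom_closed)

private abbreviation (input) "T \<equiv> tensor_relations F A f B g"
private abbreviation (input) "I \<equiv> tensor_ideal F A f B g"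

private lemma T_carrier: "T \<subseteq> carrier P"
  unfolding tensor_relations_def
  by (auto intro!: P_diff_closed P_of_closed fg A.m_closed B.m_closed)

lemma ideal_tensor_ideal: "ideal I P"
  unfolding tensor_ideal_def by (rule P.genideal_ideal[OF T_carrier])

interpretation I: ideal I P by (rule ideal_tensor_ideal)

private lemma T_I: "x \<in> T \<Longrightarrow> x \<in> I"
  unfolding tensor_ideal_def using P.genideal_self[OF T_carrier] by blast

private lemma I_closed: "x \<in> I \<Longrightarrow> y \<in> I \<Longrightarrow> x + y \<in> I" "x \<in> I \<Longrightarrow> y \<in> I \<Longrightarrow> x - y \<in> I" "0 \<in> I"
proof -
  show *: "x \<in> I \<Longrightarrow> y \<in> I \<Longrightarrow> x + y \<in> I" for x y using I.a_closed by (simp add: P_simps)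
  show "0 \<in> I" using I.zero_closed by (simp add: P_simps)
  fix x y assume xy: "x \<in> I" "y \<in> I"
  have "\<ominus>\<^bsub>P\<^esub> y = - y"
  proof (rule P.minus_equality)
    show "- y \<oplus>\<^bsub>P\<^esub> y = \<zero>\<^bsub>P\<^esub>" by (simp add: P_simps)
  qed (use I.Icarr[OF xy(2)] in \<open>auto simp: P_simps\<close>)
  hence "- y \<in> I" using I.a_inv_closed[OF xy(2)] by simp
  from *[OF xy(1) this] show "x - y \<in> I" by simp
qed

private lemma rel1: "a \<in> carrier A \<Longrightarrow> a' \<in> carrier A \<Longrightarrow> b \<in> carrier B \<Longrightarrow> frag_of (a \<oplus>\<^bsub>A\<^esub> a', b) - frag_of (a, b) - frag_of (a', b) \<in> I"
  by (rule T_I) (unfold tensor_relations_def, blast)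
private lemma rel2: "a \<in> carrier A \<Longrightarrow> b \<in> carrier B \<Longrightarrow> b' \<in> carrier B \<Longrightarrow> frag_of (a, b \<oplus>\<^bsub>B\<^esub> b') - frag_of (a, b) - frag_of (a, b') \<in> I"
  by (rule T_I) (unfold tensor_relations_def, blast)
private lemma rel3: "a \<in> carrier A \<Longrightarrow> b \<in> carrier B \<Longrightarrow> c \<in> carrier F \<Longrightarrow> frag_of (f c \<otimes>\<^bsub>A\<^esub> a, b) - frag_of (a, g c \<otimes>\<^bsub>B\<^esub> b) \<in> I"
  by (rule T_I) (unfold tensor_relations_def, blast)

private lemma d_T: assumes "x \<in> T" shows "\<delta> x \<in> I"
  using assms unfolding tensor_relations_def
proof (elim UnE CollectE exE conjE)
  fix a a' b assume x: "x = frag_of (a \<oplus>\<^bsub>A\<^esub> a', b) - frag_of (a, b) - frag_of (a', b)"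
    and c: "a \<in> carrier A" "a' \<in> carrier A" "b \<in> carrier B"
  have "(frag_of (deriv A a \<oplus>\<^bsub>A\<^esub> deriv A a', b) - frag_of (deriv A a, b) - frag_of (deriv A a', b))
     + (frag_of (a \<oplus>\<^bsub>A\<^esub> a', deriv B b) - frag_of (a, deriv B b) - frag_of (a', deriv B b)) \<in> I"
    using c by (intro I_closed rel1 A.deriv_closed B.deriv_closed)
  thus ?thesis by (simp add: x d_simps A.deriv_add c algebra_simps)
next
  fix a b b' assume x: "x = frag_of (a, b \<oplus>\<^bsub>B\<^esub> b') - frag_of (a, b) - frag_of (a, b')"
    and c: "a \<in> carrier A" "b \<in> carrier B" "b' \<in> carrier B"
  have "(frag_of (a, deriv B b \<oplus>\<^bsub>B\<^esub> deriv B b') - frag_of (a, deriv B b) - frag_of (a, deriv B b'))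
     + (frag_of (deriv A a, b \<oplus>\<^bsub>B\<^esub> b') - frag_of (deriv A a, b) - frag_of (deriv A a, b')) \<in> I"
    using c by (intro I_closed rel2 A.deriv_closed B.deriv_closed)
  thus ?thesis by (simp add: x d_simps B.deriv_add c algebra_simps)
next
  fix a b c assume x: "x = frag_of (f c \<otimes>\<^bsub>A\<^esub> a, b) - frag_of (a, g c \<otimes>\<^bsub>B\<^esub> b)"
    and c: "a \<in> carrier A" "b \<in> carrier B" "c \<in> carrier F"
  have "(frag_of (deriv A (f c) \<otimes>\<^bsub>A\<^esub> a \<oplus>\<^bsub>A\<^esub> f c \<otimes>\<^bsub>A\<^esub> deriv A a, b)
          - frag_of (deriv A (f c) \<otimes>\<^bsub>A\<^esub> a, b) - frag_of (f c \<otimes>\<^bsub>A\<^esub> deriv A a, b))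
     - (frag_of (a, deriv B (g c) \<otimes>\<^bsub>B\<^esub> b \<oplus>\<^bsub>B\<^esub> g c \<otimes>\<^bsub>B\<^esub> deriv B b)
          - frag_of (a, deriv B (g c) \<otimes>\<^bsub>B\<^esub> b) - frag_of (a, g c \<otimes>\<^bsub>B\<^esub> deriv B b))
     + (frag_of (f (deriv F c) \<otimes>\<^bsub>A\<^esub> a, b) - frag_of (a, g (deriv F c) \<otimes>\<^bsub>B\<^esub> b))
     + (frag_of (f c \<otimes>\<^bsub>A\<^esub> deriv A a, b) - frag_of (deriv A a, g c \<otimes>\<^bsub>B\<^esub> b))
     + (frag_of (f c \<otimes>\<^bsub>A\<^esub> a, deriv B b) - frag_of (a, g c \<otimes>\<^bsub>B\<^esub> deriv B b)) \<in> I"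
    using c by (intro I_closed rel1 rel2 rel3 A.deriv_closed B.deriv_closed A.m_closed B.m_closed fg F.deriv_closed)
  thus ?thesis by (simp add: x d_simps A.deriv_mult B.deriv_mult fg c algebra_simps)
qed

private lemma d_mult:
  assumes "x \<in> carrier P" "y \<in> carrier P"
  shows "\<delta> (x \<otimes>\<^bsub>P\<^esub> y) - (\<delta> x \<otimes>\<^bsub>P\<^esub> y + x \<otimes>\<^bsub>P\<^esub> \<delta> y) \<in> I" (is "?D x y \<in> I")
  using assms(1)
proof (induction x rule: P_induct)
  case zero show ?case by (simp add: d_simps P_mult_left I_closed)
next
  case (diff u v)
  have "?D (u - v) y = ?D u y - ?D v y" by (simp add: d_simps P_mult_left algebra_simps)
  thus ?case using I_closed(2)[OF diff] by simp
next
  case (of_ a b)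
  note ab = of_
  show ?case using assms(2)
  proof (induction y rule: P_induct)
    case zero show ?case by (simp add: d_simps P_mult_right I_closed)
  next
    case (diff u v)
    have "?D (frag_of (a, b)) (u - v) = ?D (frag_of (a, b)) u - ?D (frag_of (a, b)) v"
      by (simp add: d_simps P_mult_right algebra_simps)
    thus ?case using I_closed(2)[OF diff] by simp
  next
    case (of_ a' b')
    have "(frag_of (deriv A a \<otimes>\<^bsub>A\<^esub> a' \<oplus>\<^bsub>A\<^esub> a \<otimes>\<^bsub>A\<^esub> deriv A a', b \<otimes>\<^bsub>B\<^esub> b')
        - frag_of (deriv A a \<otimes>\<^bsub>A\<^esub> a', b \<otimes>\<^bsub>B\<^esub> b') - frag_of (a \<otimes>\<^bsub>A\<^esub> deriv A a', b \<otimes>\<^bsub>B\<^esub> b'))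
      + (frag_of (a \<otimes>\<^bsub>A\<^esub> a', deriv B b \<otimes>\<^bsub>B\<^esub> b' \<oplus>\<^bsub>B\<^esub> b \<otimes>\<^bsub>B\<^esub> deriv B b')
        - frag_of (a \<otimes>\<^bsub>A\<^esub> a', deriv B b \<otimes>\<^bsub>B\<^esub> b') - frag_of (a \<otimes>\<^bsub>A\<^esub> a', b \<otimes>\<^bsub>B\<^esub> deriv B b')) \<in> I"
      using ab of_ by (intro I_closed rel1 rel2 A.m_closed B.m_closed A.a_closed B.a_closed A.deriv_closed B.deriv_closed)
    thus ?case using ab of_
      by (simp add: d_simps P_mult_left P_mult_right P_mult_of A.deriv_mult B.deriv_mult algebra_simps)
  qed
qed

lemma leibniz_tensor_ideal: assumes "x \<in> I" shows "\<delta> x \<in> I"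
proof -
  have m: "\<delta> (u \<otimes>\<^bsub>P\<^esub> v) \<in> I" if "u \<in> I" "\<delta> u \<in> I" "v \<in> carrier P" for u v
  proof -
    have "\<delta> u \<otimes>\<^bsub>P\<^esub> v + u \<otimes>\<^bsub>P\<^esub> \<delta> v \<in> I"
      using that by (intro I_closed I.I_r_closed d_closed)
    from I_closed(1)[OF d_mult[OF I.Icarr[OF that(1)] that(3)] this] show ?thesis
      by (simp only: diff_add_cancel)
  qed
  have "ideal {x \<in> I. \<delta> x \<in> I} P" (is "ideal ?J P")
  proof (rule idealI[OF P.ring_axioms])
    show "subgroup ?J (add_monoid P)"
    proof (rule P.add.subgroupI)
      show "?J \<subseteq> carrier P" using I.Icarr by blast
      have "0 \<in> ?J" using I_closed(3) by (simp only: mem_Collect_eq d_simps(3) simp_thms)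
      thus "?J \<noteq> {}" by blast
    next
      fix u assume u: "u \<in> ?J"
      have "\<ominus>\<^bsub>P\<^esub> u = 0 - u"
      proof (rule P.minus_equality)
        show "0 - u \<oplus>\<^bsub>P\<^esub> u = \<zero>\<^bsub>P\<^esub>" by (simp add: P_simps(3,4))
        show "u \<in> carrier P" using u I.Icarr by blast
        thus "0 - u \<in> carrier P" by (simp add: P_simps(1))
      qed
      moreover have "0 - u \<in> ?J"
        using u I_closed(2)[OF I_closed(3), of u] I_closed(2)[OF I_closed(3), of "\<delta> u"]
        unfolding mem_Collect_eq d_simps by blast
      ultimately show "\<ominus>\<^bsub>P\<^esub> u \<in> ?J" by (simp only:)
    next
      fix u v assume "u \<in> ?J" "v \<in> ?J"
      thus "u \<oplus>\<^bsub>P\<^esub> v \<in> ?J" unfolding P_simps(4) mem_Collect_eq d_simps using I_closed(1) by blast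
    qed
  next
    fix u v assume u: "u \<in> ?J" and v: "v \<in> carrier P"
    show *: "u \<otimes>\<^bsub>P\<^esub> v \<in> ?J" using m[of u v] u v I.I_r_closed[of u v] by blast
    thus "v \<otimes>\<^bsub>P\<^esub> u \<in> ?J" using P_comm[OF v I.Icarr[of u]] u by (simp only: mem_Collect_eq)
  qed
  moreover have "T \<subseteq> ?J" using T_I d_T by auto
  ultimately have "I \<subseteq> ?J" unfolding tensor_ideal_def by (rule P.genideal_minimal)
  thus ?thesis using assms by blast
qed

private abbreviation (input) "D \<equiv> diff_tensor F A f B g"

private lemma coset_eqI: 
  assumes "x \<in> carrier P" "y \<in> carrier P" "x - y \<in> I"
  shows "I +>\<^bsub>P\<^esub> x = I +>\<^bsub>P\<^esub> y"
proof -
  have "x = (x - y) + y" by simp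
  hence "x \<in> I +>\<^bsub>P\<^esub> y"
    unfolding a_r_coset_def' P_simps(4) using assms(3) by blast
  from I.a_repr_independence'[OF this assms(2)] show ?thesis by (rule sym)
qed

lemma deriv_diff_tensor:
  assumes "x \<in> carrier P"
  shows "deriv D (I +>\<^bsub>P\<^esub> x) = I +>\<^bsub>P\<^esub> \<delta> x"
proof -
  have "I +>\<^bsub>P\<^esub> \<delta> y = I +>\<^bsub>P\<^esub> \<delta> x" if "y \<in> I +>\<^bsub>P\<^esub> x" for y
  proof -
    from that have "\<exists>i\<in>I. y = i + x" unfolding a_r_coset_def' P_simps by blast
    then obtain i where i: "i \<in> I" "y = i + x" ..
    show ?thesis
    proof (rule coset_eqI)
      show "\<delta> x \<in> carrier P" by (rule d_closed[OF assms])
      show "\<delta> y \<in> carrier P" unfolding i(2) by (intro d_closed P_add_closed I.Icarr i(1) assms)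
      have "\<delta> y - \<delta> x = \<delta> i" by (simp add: i(2) d_simps)
      thus "\<delta> y - \<delta> x \<in> I" using leibniz_tensor_ideal[OF i(1)] by simp
    qed
  qed
  moreover have "x \<in> I +>\<^bsub>P\<^esub> x" by (rule I.a_rcos_self[OF assms])
  ultimately have "(\<Union>y\<in>I +>\<^bsub>P\<^esub> x. I +>\<^bsub>P\<^esub> \<delta> y) = I +>\<^bsub>P\<^esub> \<delta> x"
    by (metis (no_types, lifting) SUP_eq_const empty_iff)
  moreover have "deriv D = (\<lambda>c. \<Union>x\<in>c. I +>\<^bsub>P\<^esub> \<delta> x)"
    unfolding diff_tensor_def Let_def by (rule diff_ring.select_convs)
  ultimately show ?thesis by (simp only:)
qed

lemma diff_cring_diff_tensor: "diff_cring D"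
proof -
  have Q: "cring (P Quot I)" by (rule I.quotient_is_cring[OF cring_free_ring_on_pairs])
  interpret Q: cring "P Quot I" by (rule Q)
  have sel: "carrier D = carrier (P Quot I)" "monoid.mult D = monoid.mult (P Quot I)"
    "monoid.one D = monoid.one (P Quot I)" "ring.zero D = ring.zero (P Quot I)"
    "ring.add D = ring.add (P Quot I)"
    by (simp_all add: diff_tensor_def Let_def)
  have "cring D"
  proof (intro cringI abelian_groupI comm_monoidI, unfold sel)
    show "\<exists>y\<in>carrier (P Quot I). y \<oplus>\<^bsub>P Quot I\<^esub> x = \<zero>\<^bsub>P Quot I\<^esub>" if "x \<in> carrier (P Quot I)" for x
      using Q.l_neg[OF that] Q.a_inv_closed[OF that] by blast
  qed (simp_all add: Q.a_ac Q.m_ac Q.l_distr Q.r_distr)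
  then interpret D: cring D .
  have c: "\<exists>x\<in>carrier P. c = I +>\<^bsub>P\<^esub> x" if "c \<in> carrier D" for c
    using that by (auto simp: sel FactRing_def A_RCOSETS_def' a_r_coset_def')
  have cc: "I +>\<^bsub>P\<^esub> x \<in> carrier D" if "x \<in> carrier P" for x
    using that by (auto simp: sel FactRing_def A_RCOSETS_def' a_r_coset_def')
  have pl: "(I +>\<^bsub>P\<^esub> x) \<oplus>\<^bsub>D\<^esub> (I +>\<^bsub>P\<^esub> y) = I +>\<^bsub>P\<^esub> (x + y)" if "x \<in> carrier P" "y \<in> carrier P" for x y
    using I.a_rcos_sum[OF that] by (simp add: sel FactRing_def P_simps)
  have ti: "(I +>\<^bsub>P\<^esub> x) \<otimes>\<^bsub>D\<^esub> (I +>\<^bsub>P\<^esub> y) = I +>\<^bsub>P\<^esub> (x \<otimes>\<^bsub>P\<^esub> y)" if "x \<in> carrier P" "y \<in> carrier P" for x y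
    using I.rcoset_mult_add[OF that] by (simp add: sel FactRing_def)
  show ?thesis
  proof unfold_locales
    fix c' assume "c' \<in> carrier D"
    then obtain x where "x \<in> carrier P" "c' = I +>\<^bsub>P\<^esub> x" using c by blast
    thus "deriv D c' \<in> carrier D" by (simp add: deriv_diff_tensor cc d_closed)
  next
    fix c1 c2 assume "c1 \<in> carrier D" "c2 \<in> carrier D"
    then obtain x y where x: "x \<in> carrier P" "c1 = I +>\<^bsub>P\<^esub> x" and y: "y \<in> carrier P" "c2 = I +>\<^bsub>P\<^esub> y" using c by meson
    show "deriv D (c1 \<oplus>\<^bsub>D\<^esub> c2) = deriv D c1 \<oplus>\<^bsub>D\<^esub> deriv D c2"
      unfolding x(2) y(2) pl[OF x(1) y(1)] deriv_diff_tensor[OF x(1)] deriv_diff_tensor[OF y(1)]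
        deriv_diff_tensor[OF P_add_closed[OF x(1) y(1)]] d_simps
      by (intro pl[symmetric] d_closed x(1) y(1))
    show "deriv D (c1 \<otimes>\<^bsub>D\<^esub> c2) = deriv D c1 \<otimes>\<^bsub>D\<^esub> c2 \<oplus>\<^bsub>D\<^esub> c1 \<otimes>\<^bsub>D\<^esub> deriv D c2"
    proof -
      note cl = P_add_closed P_mult_closed d_closed x(1) y(1)
      have "deriv D (c1 \<otimes>\<^bsub>D\<^esub> c2) = I +>\<^bsub>P\<^esub> \<delta> (x \<otimes>\<^bsub>P\<^esub> y)"
        unfolding x(2) y(2) ti[OF x(1) y(1)] by (intro deriv_diff_tensor cl)
      also have "\<dots> = I +>\<^bsub>P\<^esub> (\<delta> x \<otimes>\<^bsub>P\<^esub> y + x \<otimes>\<^bsub>P\<^esub> \<delta> y)"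
        by (intro coset_eqI d_mult cl)
      also have "\<dots> = deriv D c1 \<otimes>\<^bsub>D\<^esub> c2 \<oplus>\<^bsub>D\<^esub> c1 \<otimes>\<^bsub>D\<^esub> deriv D c2"
        unfolding x(2) y(2) deriv_diff_tensor[OF x(1)] deriv_diff_tensor[OF y(1)]
          ti[OF d_closed[OF x(1)] y(1)] ti[OF x(1) d_closed[OF y(1)]]
        by (intro pl[symmetric] cl)
      finally show ?thesis .
    qed
  qed
qed
end
end

end

theory Submission
  imports
    Defs
    "HOL-Computational_Algebra.Formal_Laurent_Series"
    "HOL-Computational_Algebra.Fundamental_Theorem_Algebra"
    "HOL-Analysis.Continuum_Not_Denumerable"
    "HOL-Library.Countable"
begin

text \<open>
  A Picard-Vessiot extension of \<open>\<complex>(z)\<close> descends to \<open>\<real>(z)\<close> as soon as complex conjugation extends from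
  \<open>\<complex>(z)\<close> to a differential automorphism of order \<open>2\<close>: the fixed field is then the real form. Uniqueness of
  Picard-Vessiot extensions yields some semilinear automorphism if \<open>y' = A y\<close> is equivalent to its
  conjugate, but it need not have order \<open>2\<close>. The idea is to expand everything in Laurent series at a real
  point. On Laurent series, conjugation of all coefficients is an involution that commutes with the
  derivation, and it restricts to complex conjugation on \<open>\<complex>(z)\<close> because the point is real. If \<open>W\<close> is a
  fundamental matrix with entries in Laurent series and \<open>C\<close> is the equivalence between \<open>A\<close> and \<open>\<tau>.A\<close>, then
  \<open>C\<close> times the conjugate of \<open>W\<close> solves \<open>y' = A y\<close> as well, hence it is \<open>W\<close> times a matrix of complex
  constants. So the field generated by \<open>W\<close> is stable under the involution (\<open>equivalent_imp_cnj_stable\<close>).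

  It remains to embed the given abstract extension into Laurent series at a real point
  (\<open>exists_laurent_embedding\<close>). Let \<open>F\<close> be the countable differential field generated by \<open>z\<close> and the
  entries of a fundamental matrix, and let \<open>B\<close> be its complex span, whose field of fractions is the whole
  extension. A homomorphism of complex algebras \<open>\<phi>\<close> from \<open>B\<close> to \<open>\<complex>\<close> gives the Taylor expansion
  \<open>x \<mapsto> \<Sum> \<phi>(\<partial>\<^sup>k x) t\<^sup>k / k!\<close>. Since \<open>B\<close> has countable dimension over the uncountable field \<open>\<complex>\<close>, such a \<open>\<phi>\<close> exists,
  and \<open>\<phi>(z)\<close> can be made real (\<open>uncountably_many_inverses_mod\<close>, \<open>complex_point\<close>). The Taylor expansion is
  injective because \<open>F\<close> is a field and the constants of the extension are the complex numbers: a shortest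
  combination \<open>f + \<dots>\<close> of elements of \<open>F\<close> in the kernel can be divided by \<open>f\<close> and differentiated, which
  makes it shorter (\<open>taylor_eq_0_imp\<close>).

  For the fixed field \<open>E\<close>, write a fundamental matrix as \<open>U + \<i> V\<close> and \<open>A = A\<^sub>1 + \<i> A\<^sub>2\<close>. The real matrix
  with blocks \<open>U, -V, V, U\<close> is a fundamental matrix of the real system with blocks \<open>A\<^sub>1, -A\<^sub>2, A\<^sub>2, A\<^sub>1\<close>, and
  its entries generate \<open>E\<close> (\<open>picard_vessiot_E\<close>). Finally \<open>a \<otimes> b \<mapsto> a b\<close> is an isomorphism from \<open>E \<otimes> \<complex>(z)\<close>
  onto the extension, since \<open>1\<close> and \<open>\<i>\<close> form a basis on both sides (\<open>tensor_E_iso\<close>).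
\<close>

section \<open>Rational functions over the real and the complex numbers\<close>

context field_hom
begin

lemma rat_map_Fract_hom: "q \<noteq> 0 \<Longrightarrow> rat_map hom (Fract p q) = Fract (map_poly hom p) (map_poly hom q)"
  by (rule rat_map_Fract) (simp_all add: hom_distribs)

lemma map_poly_mult: "map_poly hom (p * q) = map_poly hom p * map_poly hom q"
  by (rule map_poly_mult_hom) (simp_all add: hom_distribs)

lemma map_poly_add: "map_poly hom (p + q) = map_poly hom p + map_poly hom q"
  by (rule poly_eqI) (simp add: coeff_map_poly hom_distribs)

lemma map_poly_diff: "map_poly hom (p - q) = map_poly hom p - map_poly hom q"
  by (rule poly_eqI) (simp add: coeff_map_poly hom_distribs)

lemma map_poly_pderiv: "map_poly hom (pderiv p) = pderiv (map_poly hom p)"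
  by (rule poly_eqI) (simp add: coeff_map_poly coeff_pderiv hom_distribs)

lemma map_poly_nonzero: "p \<noteq> 0 \<Longrightarrow> map_poly hom p \<noteq> 0"
  by (metis coeff_0 coeff_map_poly hom_0_iff hom_zero poly_eqI)

lemma field_hom_rat_map: "field_hom (rat_map hom)"
proof
  show "rat_map hom 0 = 0" "rat_map hom 1 = 1"
    by (simp_all add: Zero_fract_def One_fract_def rat_map_Fract_hom)
  show "rat_map hom (x + y) = rat_map hom x + rat_map hom y" for x y
    by (cases x; cases y)
      (simp add: rat_map_Fract_hom map_poly_mult map_poly_add map_poly_nonzero)
  show "rat_map hom (x * y) = rat_map hom x * rat_map hom y" for x y
    by (cases x; cases y) (simp add: rat_map_Fract_hom map_poly_mult map_poly_nonzero)
qed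

lemma rat_map_rat_deriv: "rat_map hom (rat_deriv x) = rat_deriv (rat_map hom x)"
  by (cases x) (simp add: rat_map_Fract_hom rat_deriv_Fract map_poly_mult map_poly_diff
      map_poly_pderiv map_poly_nonzero)

end

interpretation cnj_hom: field_hom cnj
  by unfold_locales auto

interpretation rat_cnj_hom: field_hom rat_cnj
  unfolding rat_cnj_def by (rule cnj_hom.field_hom_rat_map)

interpretation rat_of_real_hom: field_hom rat_of_real
  unfolding rat_of_real_def by (rule of_real_hom.field_hom_rat_map)

definition rat_const :: "'a::field \<Rightarrow> 'a poly fract" where
  "rat_const a = to_fract [:a:]"

definition rat_var :: "'a::field poly fract" where
  "rat_var = to_fract [:0, 1:]"

interpretation rat_const_hom: field_hom rat_const
  by unfold_locales (simp_all add: rat_const_def flip: one_pCons to_fract_add to_fract_mult)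

lemma rat_cnj_rat_of_real [simp]: "rat_cnj (rat_of_real x) = rat_of_real x"
  by (cases x) (simp add: rat_cnj_def rat_of_real_def of_real_hom.rat_map_Fract_hom
      cnj_hom.rat_map_Fract_hom of_real_hom.map_poly_nonzero map_poly_map_poly o_def)

lemma rat_cnj_rat_const [simp]: "rat_cnj (rat_const a) = rat_const (cnj a)"
  by (simp add: rat_cnj_def rat_const_def to_fract_def cnj_hom.rat_map_Fract_hom map_poly_pCons)

lemma rat_cnj_rat_var [simp]: "rat_cnj rat_var = rat_var"
  by (simp add: rat_cnj_def rat_var_def to_fract_def cnj_hom.rat_map_Fract_hom map_poly_pCons)

lemma rat_deriv_of_real: "rat_of_real (rat_deriv x) = rat_deriv (rat_of_real x)"
  unfolding rat_of_real_def by (rule of_real_hom.rat_map_rat_deriv)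

lemma rat_deriv_const [simp]: "rat_deriv (rat_const a) = 0"
  by (simp add: rat_const_def to_fract_def rat_deriv_Fract pderiv_pCons Zero_fract_def)

lemma rat_deriv_var [simp]: "rat_deriv rat_var = 1"
  by (simp add: rat_var_def to_fract_def rat_deriv_Fract pderiv_pCons One_fract_def flip: one_pCons)

lemma to_fract_pCons: "to_fract (pCons a p) = rat_const a + rat_var * to_fract p"
  by (simp add: rat_const_def rat_var_def flip: to_fract_add to_fract_mult)

text \<open>
  A reduced fraction \<open>p / q\<close> with derivative \<open>0\<close> satisfies \<open>p' q = p q'\<close>, so \<open>q\<close> divides \<open>q'\<close>, which has
  smaller degree. Hence \<open>q' = 0\<close>, and then \<open>p' = 0\<close>.
\<close>

lemma rat_deriv_eq_0_imp_const:
  fixes x :: "'a::{field_char_0, field_gcd} poly fract"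
  assumes "rat_deriv x = 0"
  shows "x \<in> range rat_const"
proof -
  define p q where "p = fst (quot_of_fract x)" and "q = snd (quot_of_fract x)"
  have x: "x = Fract p q" and q: "q \<noteq> 0" and cop: "coprime p q"
    using Fract_quot_of_fract[of x] snd_quot_of_fract_nonzero[of x] coprime_quot_of_fract[of x]
    by (simp_all add: p_def q_def)
  have eq: "pderiv p * q = p * pderiv q"
    using assms q by (simp add: x rat_deriv_Fract Zero_fract_def eq_fract)
  hence "q dvd p * pderiv q" by (metis dvd_triv_right)
  hence "q dvd pderiv q" using cop by (simp add: coprime_commute coprime_dvd_mult_right_iff)
  hence q': "pderiv q = 0"
    using dvd_imp_degree_le[of q "pderiv q"] degree_pderiv[of q] pderiv_eq_0_iff[of q] by fastforce
  with eq q have p': "pderiv p = 0" by simp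
  from p' q' obtain a b where ab: "p = [:a:]" "q = [:b:]"
    by (auto simp: pderiv_eq_0_iff elim!: degree_eq_zeroE)
  have "x = rat_const (a / b)"
    using q by (simp add: x ab rat_const_def to_fract_def eq_fract)
  thus ?thesis by blast
qed

lemma real_poly_parts:
  fixes p :: "complex poly"
  obtains u v :: "real poly"
  where "p = map_poly complex_of_real u + smult \<i> (map_poly complex_of_real v)"
proof
  show "p = map_poly complex_of_real (map_poly Re p) + smult \<i> (map_poly complex_of_real (map_poly Im p))"
    by (rule poly_eqI) (simp add: coeff_map_poly complex_eq_iff)
qed

text \<open>
  Multiplying numerator and denominator by the conjugate of the denominator makes the denominator
  real, and the numerator can then be split coefficientwise.
\<close>

lemma rat_real_imaginary_parts:
  obtains u v where "x = rat_of_real u + rat_const \<i> * rat_of_real v"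
proof (cases x)
  case (Fract p q)
  have q: "map_poly cnj q \<noteq> 0" using Fract by (simp add: cnj_hom.map_poly_nonzero)
  obtain u v where uv: "p * map_poly cnj q = map_poly complex_of_real u + smult \<i> (map_poly complex_of_real v)"
    by (rule real_poly_parts)
  obtain r s where rs: "q * map_poly cnj q = map_poly complex_of_real r + smult \<i> (map_poly complex_of_real s)"
    by (rule real_poly_parts)
  have "map_poly cnj (q * map_poly cnj q) = q * map_poly cnj q"
    by (simp add: cnj_hom.map_poly_mult map_poly_map_poly o_def map_poly_idI mult.commute)
  hence "coeff (q * map_poly cnj q) n = cnj (coeff (q * map_poly cnj q) n)" for n
    by (metis coeff_map_poly complex_cnj_zero)
  hence "s = 0"
    unfolding rs by (intro poly_eqI) (simp add: coeff_map_poly complex_eq_iff)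
  with rs have r: "q * map_poly cnj q = map_poly complex_of_real r" by simp
  have r0: "r \<noteq> 0" using r q Fract by auto
  have "x = Fract (p * map_poly cnj q) (q * map_poly cnj q)"
    using Fract q by (simp add: eq_fract)
  also have "\<dots> = rat_of_real (Fract u r) + rat_const \<i> * rat_of_real (Fract v r)"
    unfolding uv r using r0
    by (simp add: rat_of_real_def of_real_hom.rat_map_Fract_hom rat_const_def to_fract_def
        eq_fract of_real_hom.map_poly_nonzero algebra_simps)
  finally show thesis by (rule that)
qed

section \<open>Conjugation of formal Laurent series\<close>

definition cnj_fls :: "complex fls \<Rightarrow> complex fls" where
  "cnj_fls f = Abs_fls (\<lambda>n. cnj (fls_nth f n))"

lemma cnj_fls_nth [simp]: "fls_nth (cnj_fls f) n = cnj (fls_nth f n)"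
proof -
  obtain N where "\<forall>n<N. fls_nth f n = 0" by (elim fls_nth_vanishes_belowE)
  hence "\<forall>n<N. cnj (fls_nth f n) = 0" by auto
  thus ?thesis using nth_Abs_fls_lower_bound unfolding cnj_fls_def by simp
qed

lemma cnj_fls_cnj_fls [simp]: "cnj_fls (cnj_fls f) = f"
  by (rule fls_eqI) simp

lemma fls_subdegree_cnj_fls [simp]: "fls_subdegree (cnj_fls f) = fls_subdegree f"
proof (cases "f = 0")
  case True
  hence "cnj_fls f = 0" by (intro fls_eqI) simp
  with True show ?thesis by simp
qed (auto intro!: fls_subdegree_eqI)

interpretation cnj_fls_hom: field_hom cnj_fls
proof
  show "cnj_fls (f * g) = cnj_fls f * cnj_fls g" for f g
    by (rule fls_eqI) (simp add: fls_times_nth(2))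
qed (auto intro!: fls_eqI)

lemma cnj_fls_const [simp]: "cnj_fls (fls_const a) = fls_const (cnj a)"
  by (rule fls_eqI) simp

lemma cnj_fls_X [simp]: "cnj_fls fls_X = fls_X"
  by (rule fls_eqI) simp

lemma cnj_fls_deriv: "cnj_fls (fls_deriv f) = fls_deriv (cnj_fls f)"
  by (rule fls_eqI) simp

lemma fls_deriv_eq_0_imp_const:
  fixes f :: "'a::{field_char_0} fls"
  assumes "fls_deriv f = 0"
  shows "f = fls_const (fls_nth f 0)"
proof (rule fls_eqI)
  fix n
  have "fls_nth (fls_deriv f) (n - 1) = 0" by (simp only: assms fls_zero_nth)
  thus "fls_nth f n = fls_nth (fls_const (fls_nth f 0)) n" by auto
qed

section \<open>Maximal ideals and countably generated complex algebras\<close>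

lemma (in ideal) a_minus_closed: "x \<in> I \<Longrightarrow> y \<in> I \<Longrightarrow> x \<ominus> y \<in> I"
  by (simp add: a_minus_def)

lemma (in cring) exists_maximalideal:
  assumes "ideal J R" "\<one> \<notin> J"
  obtains M where "maximalideal M R" "J \<subseteq> M"
proof -
  define A where "A = {I. ideal I R \<and> \<one> \<notin> I \<and> J \<subseteq> I}"
  have "\<exists>M\<in>A. \<forall>V\<in>A. M \<subseteq> V \<longrightarrow> V = M"
  proof (rule subset_Zorn_nonempty)
    show "A \<noteq> {}" using assms by (auto simp: A_def)
    fix C assume C: "C \<noteq> {}" "subset.chain A C"
    have id: "ideal I R" if "I \<in> C" for I using C that by (auto simp: A_def subset.chain_def)
    have "ideal (\<Union>C) R"
    proof (rule idealI[OF ring_axioms])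
      show "subgroup (\<Union>C) (add_monoid R)"
      proof (rule add.subgroupI)
        show "\<Union>C \<subseteq> carrier R"
          by (intro Union_least subsetI) (rule ideal.Icarr[OF id])
        obtain I where I: "I \<in> C" using C(1) by blast
        have "\<zero> \<in> I" by (rule additive_subgroup.zero_closed[OF ideal.axioms(1)[OF id[OF I]]])
        thus "\<Union>C \<noteq> {}" using I by blast
      next
        fix a assume "a \<in> \<Union>C"
        then obtain I where I: "I \<in> C" "a \<in> I" by blast
        have "\<ominus> a \<in> I" by (rule additive_subgroup.a_inv_closed[OF ideal.axioms(1)[OF id[OF I(1)]] I(2)])
        thus "\<ominus> a \<in> \<Union>C" using I(1) by blast
      next
        fix a b assume "a \<in> \<Union>C" "b \<in> \<Union>C"
        then obtain I J where IJ: "I \<in> C" "J \<in> C" "a \<in> I" "b \<in> J" by blast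
        with C(2) have "I \<subseteq> J \<or> J \<subseteq> I" by (auto simp: subset_chain_def)
        then obtain K where K: "K \<in> C" "a \<in> K" "b \<in> K" using IJ by blast
        have "a \<oplus> b \<in> K"
          by (rule additive_subgroup.a_closed[OF ideal.axioms(1)[OF id[OF K(1)]] K(2,3)])
        thus "a \<oplus> b \<in> \<Union>C" using K(1) by blast
      qed
    next
      fix a x assume "a \<in> \<Union>C" and x: "x \<in> carrier R"
      then obtain I where I: "I \<in> C" "a \<in> I" by blast
      show "x \<otimes> a \<in> \<Union>C" "a \<otimes> x \<in> \<Union>C"
        using ideal.I_l_closed[OF id[OF I(1)] I(2) x] ideal.I_r_closed[OF id[OF I(1)] I(2) x] I(1)
        by blast+
    qed
    thus "\<Union>C \<in> A" using C by (auto simp: A_def subset.chain_def)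
  qed
  then obtain M where M: "M \<in> A" "\<And>V. V \<in> A \<Longrightarrow> M \<subseteq> V \<Longrightarrow> V = M" by blast
  interpret M: ideal M R using M(1) by (simp add: A_def)
  have "maximalideal M R"
  proof (rule maximalidealI)
    show "ideal M R" by (rule M.ideal_axioms)
    show "carrier R \<noteq> M" using M(1) by (auto simp: A_def)
    fix V assume V: "ideal V R" "M \<subseteq> V" "V \<subseteq> carrier R"
    show "V = M \<or> V = carrier R"
    proof (cases "\<one> \<in> V")
      case True
      with V(1) show ?thesis using ideal.one_imp_carrier by blast
    next
      case False
      hence "V \<in> A" using V M(1) by (auto simp: A_def)
      with M(2) V(2) show ?thesis by blast
    qed
  qed
  thus thesis using that M(1) by (auto simp: A_def)
qed

text \<open>The defining property of a residue field, stated without forming the quotient.\<close>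

lemma (in cring) maximalideal_inverse_mod:
  assumes "maximalideal M R" "x \<in> carrier R" "x \<notin> M"
  obtains y where "y \<in> carrier R" "x \<otimes> y \<ominus> \<one> \<in> M"
proof -
  interpret M: maximalideal M R by (rule assms(1))
  define V where "V = {m \<oplus> x \<otimes> y | m y. m \<in> M \<and> y \<in> carrier R}"
  have "ideal V R"
  proof (rule idealI[OF ring_axioms])
    show "subgroup V (add_monoid R)"
    proof (rule add.subgroupI)
      show "V \<subseteq> carrier R" using assms(2) by (auto simp: V_def)
      have "\<zero> \<oplus> x \<otimes> \<zero> \<in> V" unfolding V_def using M.zero_closed by blast
      thus "V \<noteq> {}" by blast
    next
      fix a assume "a \<in> V"
      then obtain m y where my: "a = m \<oplus> x \<otimes> y" "m \<in> M" "y \<in> carrier R" by (auto simp: V_def)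
      hence "\<ominus> a = \<ominus> m \<oplus> x \<otimes> (\<ominus> y)" using assms(2) M.Icarr by (simp add: r_minus minus_add)
      thus "\<ominus> a \<in> V" using my by (auto simp: V_def)
    next
      fix a b assume "a \<in> V" "b \<in> V"
      then obtain m y m' y' where my: "a = m \<oplus> x \<otimes> y" "m \<in> M" "y \<in> carrier R"
        "b = m' \<oplus> x \<otimes> y'" "m' \<in> M" "y' \<in> carrier R" by (auto simp: V_def)
      hence "a \<oplus> b = (m \<oplus> m') \<oplus> x \<otimes> (y \<oplus> y')"
        using assms(2) M.Icarr by (simp add: r_distr a_ac)
      thus "a \<oplus> b \<in> V" using my by (auto simp: V_def)
    qed
  next
    fix a r assume "a \<in> V" and r: "r \<in> carrier R"
    then obtain m y where my: "a = m \<oplus> x \<otimes> y" "m \<in> M" "y \<in> carrier R" by (auto simp: V_def)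
    hence "r \<otimes> a = r \<otimes> m \<oplus> x \<otimes> (r \<otimes> y)" using r assms(2) M.Icarr by (simp add: r_distr m_ac)
    thus *: "r \<otimes> a \<in> V" using my r by (auto simp: V_def intro!: M.I_l_closed)
    have "a \<in> carrier R" using my assms(2) M.Icarr by simp
    thus "a \<otimes> r \<in> V" using * r by (simp add: m_comm)
  qed
  moreover have "M \<subseteq> V"
  proof
    fix m assume "m \<in> M"
    moreover from this have "m = m \<oplus> x \<otimes> \<zero>" using assms(2) M.Icarr by simp
    ultimately show "m \<in> V" unfolding V_def by blast
  qed
  moreover have "x \<in> V"
  proof -
    have "x = \<zero> \<oplus> x \<otimes> \<one>" using assms(2) by simp
    thus ?thesis unfolding V_def using M.zero_closed by blast
  qed
  ultimately have "V = carrier R"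
    using M.I_maximal[of V] assms(3) ideal.Icarr[of V R] by blast
  hence "\<one> \<in> V" by simp
  then obtain m y where my: "\<one> = m \<oplus> x \<otimes> y" "m \<in> M" "y \<in> carrier R" by (auto simp: V_def)
  have "x \<otimes> y \<ominus> (m \<oplus> x \<otimes> y) = \<ominus> m"
    using my(2,3) assms(2) M.Icarr[OF my(2)] by algebra
  hence "x \<otimes> y \<ominus> \<one> = \<ominus> m" by (simp only: my(1))
  thus thesis using that my by simp
qed

lemma (in ideal) finsum_mem:
  "finite J \<Longrightarrow> (\<And>j. j \<in> J \<Longrightarrow> g j \<in> I) \<Longrightarrow> finsum R g J \<in> I"
proof (induction J rule: finite_induct)
  case (insert j J)
  hence "finsum R g (insert j J) = g j \<oplus> finsum R g J"
    using Icarr by (intro finsum_insert) auto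
  thus ?case using insert by auto
qed auto

text \<open>
  Elimination of one coordinate at a time.
\<close>

lemma linear_dependence:
  fixes v :: "'j \<Rightarrow> nat \<Rightarrow> 'k::field"
  assumes "finite J" "card J > N"
  shows "\<exists>\<mu>. (\<exists>j\<in>J. \<mu> j \<noteq> 0) \<and> (\<forall>i<N. (\<Sum>j\<in>J. \<mu> j * v j i) = 0)"
  using assms
proof (induction N arbitrary: J v)
  case 0
  hence "\<exists>j. j \<in> J" by (metis card.empty ex_in_conv less_irrefl)
  thus ?case by (intro exI[of _ "\<lambda>_. 1"]) auto
next
  case (Suc N)
  show ?case
  proof (cases "\<forall>j\<in>J. v j N = 0")
    case True
    from Suc.IH[of J v] Suc.prems obtain \<mu> where
      \<mu>: "\<exists>j\<in>J. \<mu> j \<noteq> 0" "\<And>i. i < N \<Longrightarrow> (\<Sum>j\<in>J. \<mu> j * v j i) = 0" by auto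
    thus ?thesis using True by (intro exI[of _ \<mu>]) (auto simp: less_Suc_eq)
  next
    case False
    then obtain k where k: "k \<in> J" "v k N \<noteq> 0" by blast
    define K where "K = J - {k}"
    define w where "w = (\<lambda>j i. v j i - v j N / v k N * v k i)"
    have K: "finite K" "card K > N" "J = insert k K" "k \<notin> K"
      using Suc.prems k by (auto simp: K_def)
    from Suc.IH[of K w] K obtain \<mu> where
      \<mu>: "\<exists>j\<in>K. \<mu> j \<noteq> 0" "\<And>i. i < N \<Longrightarrow> (\<Sum>j\<in>K. \<mu> j * w j i) = 0" by auto
    define \<nu> where "\<nu> = \<mu>(k := - (\<Sum>j\<in>K. \<mu> j * (v j N / v k N)))"
    have 1: "(\<Sum>j\<in>J. \<nu> j * v j i) = (\<Sum>j\<in>K. \<mu> j * w j i)" for i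
    proof -
      have "(\<Sum>j\<in>J. \<nu> j * v j i) = \<nu> k * v k i + (\<Sum>j\<in>K. \<nu> j * v j i)" using K by simp
      also have "(\<Sum>j\<in>K. \<nu> j * v j i) = (\<Sum>j\<in>K. \<mu> j * v j i)"
        using K by (intro sum.cong) (auto simp: \<nu>_def)
      also have "\<nu> k * v k i = (\<Sum>j\<in>K. - (\<mu> j * (v j N / v k N) * v k i))"
        by (simp add: \<nu>_def sum_distrib_right sum_negf)
      finally show ?thesis by (simp add: w_def algebra_simps flip: sum.distrib)
    qed
    have "w j N = 0" for j using k by (simp add: w_def)
    hence "(\<Sum>j\<in>J. \<nu> j * v j i) = 0" if "i < Suc N" for i
      using \<mu>(2)[of i] that unfolding 1 by (auto simp: less_Suc_eq)
    moreover have "\<exists>j\<in>J. \<nu> j \<noteq> 0" using \<mu>(1) K by (auto simp: \<nu>_def)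
    ultimately show ?thesis by blast
  qed
qed

locale complex_algebra = cring R for R (structure) +
  fixes c :: "complex \<Rightarrow> 'a"
  assumes c_closed [simp, intro]: "c a \<in> carrier R"
    and c_add: "c (a + b) = c a \<oplus> c b"
    and c_mult: "c (a * b) = c a \<otimes> c b"
    and c_one: "c 1 = \<one>"
begin

lemma c_zero: "c 0 = \<zero>"
proof -
  have "c 0 \<oplus> c 0 = c 0" by (simp flip: c_add)
  thus ?thesis by (metis c_closed add.l_cancel_one')
qed

lemma c_minus: "c (- a) = \<ominus> c a"
proof -
  have "c (- a) \<oplus> c a = \<zero>" by (simp add: c_zero flip: c_add)
  thus ?thesis by (metis c_closed minus_equality)
qed

text \<open>Substitution of \<open>y\<close> for the variable, by Horner's scheme.\<close>

definition eval_at :: "'a \<Rightarrow> complex poly \<Rightarrow> 'a" where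
  "eval_at y p = fold_coeffs (\<lambda>a v. c a \<oplus> y \<otimes> v) p \<zero>"

context
  fixes y assumes y: "y \<in> carrier R"
begin

lemma eval_at_0 [simp]: "eval_at y 0 = \<zero>"
  by (simp add: eval_at_def)

lemma eval_at_pCons: "eval_at y (pCons a p) = c a \<oplus> y \<otimes> eval_at y p"
proof (cases "p = 0 \<and> a = 0")
  case True
  thus ?thesis using y by (simp add: eval_at_def c_zero)
next
  case False
  thus ?thesis
    by (auto simp: eval_at_def fold_coeffs_pCons_coeff_not_0_eq fold_coeffs_pCons_not_0_0_eq)
qed

lemma eval_at_closed [simp, intro]: "eval_at y p \<in> carrier R"
  by (induction p) (use y in \<open>simp_all add: eval_at_pCons\<close>)

lemma eval_at_add: "eval_at y (p + q) = eval_at y p \<oplus> eval_at y q"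
  by (induction p q rule: poly_induct2)
    (use y in \<open>simp_all add: eval_at_pCons c_add r_distr a_ac\<close>)

lemma eval_at_smult: "eval_at y (smult a p) = c a \<otimes> eval_at y p"
  by (induction p) (use y in \<open>simp_all add: eval_at_pCons c_mult r_distr m_ac\<close>)

lemma eval_at_mult: "eval_at y (p * q) = eval_at y p \<otimes> eval_at y q"
  by (induction p)
    (use y in \<open>simp_all add: eval_at_pCons eval_at_add eval_at_smult c_zero l_distr m_assoc\<close>)

lemma eval_at_sum: "finite J \<Longrightarrow> eval_at y (\<Sum>j\<in>J. g j) = (\<Oplus>j\<in>J. eval_at y (g j))"
  by (induction J rule: finite_induct) (simp_all add: eval_at_add)

lemma eval_at_linear: "eval_at y [:- a, 1:] = y \<ominus> c a"
  using y by (simp add: eval_at_pCons c_minus c_one a_minus_def a_comm)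

text \<open>
  Over the complex numbers a polynomial is a product of linear factors, and a prime ideal that contains a
  product contains one of the factors.
\<close>

lemma eval_at_mem_primeideal:
  assumes "primeideal P R" "p \<noteq> 0" "eval_at y p \<in> P"
  shows "\<exists>a. y \<ominus> c a \<in> P"
  using assms(2,3)
proof (induction "degree p" arbitrary: p)
  interpret P: primeideal P R by (rule assms(1))
  case 0
  then obtain k where k: "p = [:k:]" "k \<noteq> 0" by (auto elim: degree_eq_zeroE)
  have "c k \<in> P" using 0 y by (simp add: k eval_at_pCons)
  hence "c k \<otimes> c (inverse k) \<in> P" by (intro P.I_r_closed) auto
  hence "\<one> \<in> P" using k by (simp add: c_one flip: c_mult)
  hence False using P.one_imp_carrier P.I_notcarr by blast
  thus ?case ..
next
  interpret P: primeideal P R by (rule assms(1))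
  case (Suc n)
  hence "\<not> constant (poly p)" by (simp add: constant_degree)
  then obtain a where "poly p a = 0" using fundamental_theorem_of_algebra by blast
  then obtain q where q: "p = [:- a, 1:] * q" by (auto simp: poly_eq_0_iff_dvd)
  have "q \<noteq> 0" using Suc.prems q by auto
  hence n: "n = degree q" using Suc(2) degree_mult_eq[of "[:- a, 1:]" q] by (simp add: q del: mult_pCons_left)
  have "(y \<ominus> c a) \<otimes> eval_at y q \<in> P"
    using Suc.prems by (simp only: q eval_at_mult eval_at_linear)
  hence "y \<ominus> c a \<in> P \<or> eval_at y q \<in> P"
    using y by (intro P.I_prime) auto
  thus ?case using Suc(1)[OF n \<open>q \<noteq> 0\<close>] by blast
qed

end
end

text \<open>
  The dimension over \<open>\<complex>\<close> is countable, whereas \<open>\<complex>\<close> itself is uncountable. This replaces the finiteness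
  assumption in Hilbert's Nullstellensatz.
\<close>

locale countably_spanned_algebra = complex_algebra +
  fixes f :: "nat \<Rightarrow> 'a"
  assumes f_closed [simp, intro]: "f i \<in> carrier R"
    and spanned: "x \<in> carrier R \<Longrightarrow> \<exists>N l. x = (\<Oplus>i\<in>{..<N}. c (l i) \<otimes> f i)"
begin

lemma dependent_combination:
  assumes "finite J" "card J > N"
    and b: "\<And>j. j \<in> J \<Longrightarrow> b j = (\<Oplus>i\<in>{..<N}. c (l j i) \<otimes> f i)"
  obtains \<mu> where "\<exists>j\<in>J. \<mu> j \<noteq> 0" "(\<Oplus>j\<in>J. c (\<mu> j) \<otimes> b j) = \<zero>"
proof -
  from linear_dependence[OF assms(1,2), of l] obtain \<mu> where
    \<mu>: "\<exists>j\<in>J. \<mu> j \<noteq> 0" "\<And>i. i < N \<Longrightarrow> (\<Sum>j\<in>J. \<mu> j * l j i) = 0" by auto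
  have main: "(\<Oplus>j\<in>J. c (\<mu> j) \<otimes> (\<Oplus>i\<in>{..<N}. c (l j i) \<otimes> f i))
     = (\<Oplus>i\<in>{..<N}. c (\<Sum>j\<in>J. \<mu> j * l j i) \<otimes> f i)"
    using assms(1)
  proof (induction J rule: finite_induct)
    case empty
    have "(\<Oplus>i\<in>{..<N}. c 0 \<otimes> f i) = (\<Oplus>i\<in>{..<N}. \<zero>)"
      by (intro finsum_cong') (auto simp: c_zero)
    thus ?case by simp
  next
    case (insert k J)
    have "(\<Oplus>j\<in>insert k J. c (\<mu> j) \<otimes> (\<Oplus>i\<in>{..<N}. c (l j i) \<otimes> f i))
        = c (\<mu> k) \<otimes> (\<Oplus>i\<in>{..<N}. c (l k i) \<otimes> f i)
          \<oplus> (\<Oplus>i\<in>{..<N}. c (\<Sum>j\<in>J. \<mu> j * l j i) \<otimes> f i)"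
      using insert by (subst finsum_insert) auto
    also have "c (\<mu> k) \<otimes> (\<Oplus>i\<in>{..<N}. c (l k i) \<otimes> f i) = (\<Oplus>i\<in>{..<N}. c (\<mu> k * l k i) \<otimes> f i)"
      by (subst finsum_rdistr) (auto simp: c_mult m_assoc intro!: finsum_cong')
    also have "(\<Oplus>i\<in>{..<N}. c (\<mu> k * l k i) \<otimes> f i) \<oplus> (\<Oplus>i\<in>{..<N}. c (\<Sum>j\<in>J. \<mu> j * l j i) \<otimes> f i)
        = (\<Oplus>i\<in>{..<N}. c (\<mu> k * l k i) \<otimes> f i \<oplus> c (\<Sum>j\<in>J. \<mu> j * l j i) \<otimes> f i)"
      by (rule finsum_addf[symmetric]) auto
    also have "\<dots> = (\<Oplus>i\<in>{..<N}. c (\<Sum>j\<in>insert k J. \<mu> j * l j i) \<otimes> f i)"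
      using insert by (intro finsum_cong') (auto simp: c_add l_distr)
    finally show ?case .
  qed
  have "(\<Oplus>i\<in>{..<N}. c (\<Sum>j\<in>J. \<mu> j * l j i) \<otimes> f i) = (\<Oplus>i\<in>{..<N}. \<zero>)"
    by (intro finsum_cong') (auto simp: \<mu>(2) c_zero)
  hence "(\<Oplus>j\<in>J. c (\<mu> j) \<otimes> (\<Oplus>i\<in>{..<N}. c (l j i) \<otimes> f i)) = \<zero>" using main by simp
  moreover have "(\<Oplus>j\<in>J. c (\<mu> j) \<otimes> b j) = (\<Oplus>j\<in>J. c (\<mu> j) \<otimes> (\<Oplus>i\<in>{..<N}. c (l j i) \<otimes> f i))"
    by (intro finsum_cong') (auto simp: b)
  ultimately show thesis using \<mu>(1) that by simp
qed

text \<open>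
  Work modulo \<open>P\<close>. The inverses of \<open>y - a\<close> for \<open>a \<in> A\<close> lie in spans of finite subfamilies of \<open>f\<close>; since
  there are only countably many initial segments of \<open>f\<close>, one of these spans, of dimension at most \<open>n\<close>,
  contains uncountably many of them. So \<open>n + 1\<close> distinct ones satisfy a linear relation
  \<open>\<Sum> \<mu> j / (y - j) = 0\<close>. Clearing denominators shows that \<open>y\<close> is a root of a nonzero polynomial over \<open>\<complex>\<close>,
  and hence equal to one of the roots of this polynomial in \<open>\<complex>\<close>.
\<close>

lemma uncountably_many_inverses_mod:
  assumes P: "primeideal P R" and y: "y \<in> carrier R" and A: "uncountable A"
    and inv: "\<And>a. a \<in> A \<Longrightarrow> \<exists>b\<in>carrier R. (y \<ominus> c a) \<otimes> b \<ominus> \<one> \<in> P"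
  shows "\<exists>a. y \<ominus> c a \<in> P"
proof -
  interpret P: primeideal P R by (rule P)
  obtain b where b: "b a \<in> carrier R" "(y \<ominus> c a) \<otimes> b a \<ominus> \<one> \<in> P" if "a \<in> A" for a
    using inv by metis
  have "\<forall>a\<in>A. \<exists>Nl. b a = (\<Oplus>i\<in>{..<fst Nl}. c (snd Nl i) \<otimes> f i)"
  proof
    fix a assume "a \<in> A"
    from spanned[OF b(1)[OF this]] obtain N l where
      "b a = (\<Oplus>i\<in>{..<N}. c (l i) \<otimes> f i)" by blast
    thus "\<exists>Nl. b a = (\<Oplus>i\<in>{..<fst Nl}. c (snd Nl i) \<otimes> f i)"
      by (intro exI[of _ "(N, l)"]) simp
  qed
  from bchoice[OF this] obtain Nl where
    "\<forall>a\<in>A. b a = (\<Oplus>i\<in>{..<fst (Nl a)}. c (snd (Nl a) i) \<otimes> f i)" by blast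
  moreover define N l where "N = (\<lambda>a. fst (Nl a))" and "l = (\<lambda>a. snd (Nl a))"
  ultimately have Nl: "b a = (\<Oplus>i\<in>{..<N a}. c (l a i) \<otimes> f i)" if "a \<in> A" for a
    using that by simp
  have "A = (\<Union>n. {a \<in> A. N a = n})" by auto
  hence "\<exists>n. uncountable {a \<in> A. N a = n}"
    using A countable_UN[of UNIV "\<lambda>n. {a \<in> A. N a = n}"] by fastforce
  then obtain n where "uncountable {a \<in> A. N a = n}" ..
  hence "infinite {a \<in> A. N a = n}" using countable_finite by blast
  then obtain J where J: "finite J" "card J = Suc n" "J \<subseteq> {a \<in> A. N a = n}"
    by (meson infinite_arbitrarily_large)
  have JA: "j \<in> A" if "j \<in> J" for j using J that by auto
  note bJ = b(1)[OF JA]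
  have "card J > n" using J by simp
  with J(1) obtain \<mu> where \<mu>: "\<exists>j\<in>J. \<mu> j \<noteq> 0" "(\<Oplus>j\<in>J. c (\<mu> j) \<otimes> b j) = \<zero>"
    by (rule dependent_combination[of J n b l]) (use J(3) Nl in auto)
  define \<pi> where "\<pi> = (\<Prod>j\<in>J. [:- j, 1:])"
  define q where "q = (\<lambda>j. \<Prod>i\<in>J - {j}. [:- i, 1:])"
  define p where "p = (\<Sum>j\<in>J. smult (\<mu> j) (q j))"
  have q: "\<pi> = [:- j, 1:] * q j" if "j \<in> J" for j
    unfolding \<pi>_def q_def using J(1) that by (simp add: prod.remove)
  \<comment> \<open>\<open>q j\<close> is \<open>\<pi> / (X - j)\<close>, so multiplication by \<open>\<pi>(y)\<close> takes the inverse \<open>b j\<close> to \<open>q j\<close> at \<open>y\<close>, up to an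
    error \<open>e j\<close> in \<open>P\<close>.\<close>
  define e where "e = (\<lambda>j. eval_at y (smult (\<mu> j) (q j)) \<ominus> eval_at y \<pi> \<otimes> (c (\<mu> j) \<otimes> b j))"
  note cl = eval_at_closed[OF y]
  have e: "e j \<in> P" if j: "j \<in> J" for j
  proof -
    have "e j = (\<ominus> (c (\<mu> j) \<otimes> eval_at y (q j))) \<otimes> ((y \<ominus> c j) \<otimes> b j \<ominus> \<one>)"
      unfolding e_def q[OF j] eval_at_mult[OF y] eval_at_smult[OF y] eval_at_linear[OF y]
      using y cl[of "q j"] bJ[OF j] c_closed[of j] c_closed[of "\<mu> j"] by algebra
    thus ?thesis using b(2)[OF JA[OF j]] cl by (auto intro: P.I_l_closed)
  qed
  have "eval_at y p = (\<Oplus>j\<in>J. eval_at y (smult (\<mu> j) (q j)))"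
    unfolding p_def by (rule eval_at_sum[OF y J(1)])
  also have "\<dots> = (\<Oplus>j\<in>J. e j \<oplus> eval_at y \<pi> \<otimes> (c (\<mu> j) \<otimes> b j))"
  proof (intro finsum_cong' refl)
    fix j assume j: "j \<in> J"
    show "eval_at y (smult (\<mu> j) (q j)) = e j \<oplus> eval_at y \<pi> \<otimes> (c (\<mu> j) \<otimes> b j)"
      unfolding e_def using cl[of \<pi>] cl[of "smult (\<mu> j) (q j)"] bJ[OF j] c_closed[of "\<mu> j"] by algebra
  qed (use P.Icarr[OF e] bJ cl in auto)
  also have "\<dots> = (\<Oplus>j\<in>J. e j) \<oplus> (\<Oplus>j\<in>J. eval_at y \<pi> \<otimes> (c (\<mu> j) \<otimes> b j))"
    using P.Icarr[OF e] bJ cl by (intro finsum_addf) auto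
  also have "(\<Oplus>j\<in>J. eval_at y \<pi> \<otimes> (c (\<mu> j) \<otimes> b j)) = \<zero>"
    using bJ cl J(1) by (subst finsum_rdistr[symmetric]) (auto simp: \<mu>(2))
  finally have "eval_at y p \<in> P"
    using P.finsum_mem[OF J(1) e] P.Icarr by auto
  moreover have "p \<noteq> 0"
  proof
    assume "p = 0"
    \<comment> \<open>At the point \<open>k\<close> only the summand for \<open>k\<close> itself survives.\<close>
    obtain k where k: "k \<in> J" "\<mu> k \<noteq> 0" using \<mu>(1) by blast
    have "poly p k = (\<Sum>j\<in>J. \<mu> j * poly (q j) k)" by (simp add: p_def poly_sum)
    also have "\<dots> = (\<Sum>j\<in>{k}. \<mu> j * poly (q j) k)"
      using J(1) k by (intro sum.mono_neutral_right) (auto simp: q_def poly_prod)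
    also have "\<dots> \<noteq> 0" using J(1) k by (auto simp: q_def poly_prod)
    finally show False using \<open>p = 0\<close> by simp
  qed
  ultimately show ?thesis by (intro eval_at_mem_primeideal[OF y P])
qed

end

section \<open>Taylor expansion at a complex point of a differential field\<close>

text \<open>
  Expressions in the operations of a differential field. There are countably many of them, so that the
  differential subfield generated by a sequence is visibly countable.
\<close>

datatype diff_term = Gen nat | Zero | One | Add diff_term diff_term | Mult diff_term diff_term
  | Neg diff_term | Inv diff_term | Deriv diff_term

instance diff_term :: countable
  by countable_datatype

text \<open>
  A differential field whose constants are the complex numbers, with a sequence \<open>G\<close> of elements. Here
  \<open>G 0\<close> stands for the variable \<open>z\<close>; the other members are later the entries of a fundamental matrix.
\<close>

locale diff_field_over_complex = diff_field R + complex_algebra R c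
  for R :: "'a diff_ring" (structure) and c :: "complex \<Rightarrow> 'a" +
  fixes G :: "nat \<Rightarrow> 'a"
  assumes deriv_c: "deriv R (c a) = \<zero>"
    and constant_imp: "x \<in> carrier R \<Longrightarrow> deriv R x = \<zero> \<Longrightarrow> x \<in> range c"
    and G_closed [simp, intro]: "G i \<in> carrier R"
    and deriv_G_0: "deriv R (G 0) = \<one>"
begin

lemma deriv_zero [simp]: "deriv R \<zero> = \<zero>"
  using deriv_c[of 0] by (simp add: c_zero)

lemma deriv_scale: "x \<in> carrier R \<Longrightarrow> deriv R (c a \<otimes> x) = c a \<otimes> deriv R x"
  by (simp add: deriv_mult deriv_c deriv_closed)

fun diff_eval :: "diff_term \<Rightarrow> 'a" where
  "diff_eval (Gen i) = G i"
| "diff_eval Zero = \<zero>"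
| "diff_eval One = \<one>"
| "diff_eval (Add s t) = diff_eval s \<oplus> diff_eval t"
| "diff_eval (Mult s t) = diff_eval s \<otimes> diff_eval t"
| "diff_eval (Neg t) = \<ominus> diff_eval t"
| "diff_eval (Inv t) = (if diff_eval t = \<zero> then \<zero> else inv (diff_eval t))"
| "diff_eval (Deriv t) = deriv R (diff_eval t)"

text \<open>The differential subfield generated by the sequence \<open>G\<close> over the prime field.\<close>

definition gens :: "'a set" where
  "gens = range diff_eval"

lemma countable_gens: "countable gens"
  by (simp add: gens_def)

lemma diff_eval_closed: "diff_eval t \<in> carrier R"
  by (induction t) (auto intro: deriv_closed simp: field_Units)

lemma gens_closed: "x \<in> gens \<Longrightarrow> x \<in> carrier R"
  by (auto simp: gens_def diff_eval_closed)

lemma gens_intros: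
  "G i \<in> gens" "\<zero> \<in> gens" "\<one> \<in> gens"
  "x \<in> gens \<Longrightarrow> y \<in> gens \<Longrightarrow> x \<oplus> y \<in> gens"
  "x \<in> gens \<Longrightarrow> y \<in> gens \<Longrightarrow> x \<otimes> y \<in> gens"
  "x \<in> gens \<Longrightarrow> \<ominus> x \<in> gens"
  "x \<in> gens \<Longrightarrow> x \<noteq> \<zero> \<Longrightarrow> inv x \<in> gens"
  "x \<in> gens \<Longrightarrow> deriv R x \<in> gens"
proof -
  have I: "diff_eval t = x \<Longrightarrow> x \<in> gens" for t x by (auto simp: gens_def)
  show "G i \<in> gens" by (rule I[of "Gen i"]) simp
  show "\<zero> \<in> gens" by (rule I[of Zero]) simp
  show "\<one> \<in> gens" by (rule I[of One]) simp
  show "x \<in> gens \<Longrightarrow> y \<in> gens \<Longrightarrow> x \<oplus> y \<in> gens"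
    unfolding gens_def by (auto intro: range_eqI[of _ _ "Add s t" for s t])
  show "x \<in> gens \<Longrightarrow> y \<in> gens \<Longrightarrow> x \<otimes> y \<in> gens"
    unfolding gens_def by (auto intro: range_eqI[of _ _ "Mult s t" for s t])
  show "x \<in> gens \<Longrightarrow> \<ominus> x \<in> gens"
    unfolding gens_def by (auto intro: range_eqI[of _ _ "Neg t" for t])
  show "x \<in> gens \<Longrightarrow> x \<noteq> \<zero> \<Longrightarrow> inv x \<in> gens"
    unfolding gens_def by (auto intro: range_eqI[of _ _ "Inv t" for t])
  show "x \<in> gens \<Longrightarrow> deriv R x \<in> gens"
    unfolding gens_def by (auto intro: range_eqI[of _ _ "Deriv t" for t])
qed

text \<open>
  Complex linear combinations of \<open>n\<close> elements of \<open>gens\<close>. The number of terms is recorded because the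
  injectivity of the Taylor expansion is proved by induction on it.
\<close>

inductive combination :: "nat \<Rightarrow> 'a \<Rightarrow> bool" where
  zero: "combination 0 \<zero>"
| add: "combination n x \<Longrightarrow> f \<in> gens \<Longrightarrow> combination (Suc n) (c a \<otimes> f \<oplus> x)"

lemma combination_closed: "combination n x \<Longrightarrow> x \<in> carrier R"
  by (induction rule: combination.induct) (auto simp: gens_closed)

lemma combination_add: "combination m x \<Longrightarrow> combination n y \<Longrightarrow> combination (m + n) (x \<oplus> y)"
proof (induction rule: combination.induct)
  case zero
  thus ?case by (simp add: combination_closed)
next
  case (add n' x f a)
  hence "(c a \<otimes> f \<oplus> x) \<oplus> y = c a \<otimes> f \<oplus> (x \<oplus> y)"
    by (simp add: a_assoc combination_closed gens_closed)
  thus ?case using combination.add[OF add.IH[OF add.prems] add.hyps(2), of a] by simp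
qed

lemma combination_scale: "combination n x \<Longrightarrow> f \<in> gens \<Longrightarrow> combination n (c b \<otimes> f \<otimes> x)"
proof (induction rule: combination.induct)
  case zero
  thus ?case using combination.zero by (simp add: gens_closed)
next
  case (add n x g a)
  have "c b \<otimes> f \<otimes> (c a \<otimes> g \<oplus> x) = c (b * a) \<otimes> (f \<otimes> g) \<oplus> c b \<otimes> f \<otimes> x"
    unfolding c_mult
    using gens_closed[OF add.prems] gens_closed[OF add.hyps(2)] combination_closed[OF add.hyps(1)]
      c_closed[of a] c_closed[of b] by algebra
  thus ?case
    using combination.add[OF add.IH[OF add.prems] gens_intros(5)[OF add.prems add.hyps(2)], of "b * a"]
    by simp
qed

lemma combination_deriv: "combination n x \<Longrightarrow> combination n (deriv R x)"
proof (induction rule: combination.induct)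
  case (add n x f a)
  hence "deriv R (c a \<otimes> f \<oplus> x) = c a \<otimes> deriv R f \<oplus> deriv R x"
    by (simp add: deriv_add deriv_scale combination_closed gens_closed)
  thus ?case using combination.add[OF add.IH gens_intros(8)[OF add.hyps(2)], of a] by simp
qed (use combination.zero in simp)

definition span :: "'a set" where
  "span = {x. \<exists>n. combination n x}"

lemma span_closed: "x \<in> span \<Longrightarrow> x \<in> carrier R"
  by (auto simp: span_def combination_closed)

lemma span_add: "x \<in> span \<Longrightarrow> y \<in> span \<Longrightarrow> x \<oplus> y \<in> span"
  by (auto simp: span_def intro: combination_add)

lemma span_scale: "x \<in> span \<Longrightarrow> f \<in> gens \<Longrightarrow> c b \<otimes> f \<otimes> x \<in> span"
  by (auto simp: span_def intro: combination_scale)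

lemma span_deriv: "x \<in> span \<Longrightarrow> deriv R x \<in> span"
  by (auto simp: span_def intro: combination_deriv)

lemma span_mult: "x \<in> span \<Longrightarrow> y \<in> span \<Longrightarrow> x \<otimes> y \<in> span"
proof -
  assume y: "y \<in> span"
  have "x \<otimes> y \<in> span" if "combination n x" for n
    using that
  proof (induction rule: combination.induct)
    case zero
    have "combination 0 (\<zero> \<otimes> y)" using y combination.zero by (simp add: span_closed)
    thus ?case by (auto simp: span_def)
  next
    case (add n x f a)
    hence "(c a \<otimes> f \<oplus> x) \<otimes> y = c a \<otimes> f \<otimes> y \<oplus> x \<otimes> y"
      using y by (simp add: l_distr gens_closed combination_closed span_closed)
    thus ?case using add y by (simp add: span_add span_scale)
  qed
  thus "x \<in> span \<Longrightarrow> x \<otimes> y \<in> span" by (auto simp: span_def)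
qed

lemma scaled_in_span: "f \<in> gens \<Longrightarrow> c a \<otimes> f \<in> span"
proof -
  assume f: "f \<in> gens"
  have "combination (Suc 0) (c a \<otimes> f \<oplus> \<zero>)" using f by (intro combination.intros)
  thus ?thesis using f by (auto simp: span_def gens_closed)
qed

lemma gens_in_span: "f \<in> gens \<Longrightarrow> f \<in> span"
  using scaled_in_span[of f 1] by (simp add: c_one gens_closed)

lemma c_in_span [simp, intro]: "c a \<in> span"
  using scaled_in_span[of \<one> a] gens_intros(3) by simp

lemma span_minus: "x \<in> span \<Longrightarrow> \<ominus> x \<in> span"
proof -
  assume x: "x \<in> span"
  have "\<ominus> x = c (- 1) \<otimes> x" using x by (simp add: c_minus c_one l_minus span_closed)
  thus ?thesis using x by (simp add: span_mult)
qed

lemma span_one: "\<one> \<in> span" and span_zero: "\<zero> \<in> span"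
  by (auto intro: gens_in_span gens_intros)

lemma subcring_span: "subcring span R"
proof (rule subcringI)
  show "subring span R"
    by (rule subringI) (auto simp: span_closed span_one span_minus span_mult span_add)
qed (auto simp: span_closed m_comm)

text \<open>
  The ring \<open>span\<close> with its own carrier, in order to speak about its ideals.
\<close>

definition S :: "'a diff_ring" where "S = R\<lparr>carrier := span\<rparr>"

lemma S_sel [simp]: "carrier S = span" "monoid.mult S = monoid.mult R" "monoid.one S = \<one>"
  "ring.add S = ring.add R" "ring.zero S = \<zero>"
  by (simp_all add: S_def)

lemma cring_S: "cring S"
  using subcring_span subcring_iff[of span] span_closed by (auto simp: S_def)

sublocale S: cring S by (rule cring_S)

lemma S_minus: "x \<in> span \<Longrightarrow> y \<in> span \<Longrightarrow> x \<ominus>\<^bsub>S\<^esub> y = x \<ominus> y"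
proof -
  assume x: "x \<in> span" and y: "y \<in> span"
  have "\<ominus>\<^bsub>S\<^esub> y = \<ominus> y"
    by (rule S.minus_equality) (use y in \<open>auto simp: span_minus span_closed l_neg\<close>)
  thus ?thesis by (simp add: a_minus_def)
qed

lemma S_spanned: "combination n x \<Longrightarrow>
  \<exists>N l. x = (\<Oplus>\<^bsub>S\<^esub>i\<in>{..<N}. c (l i) \<otimes> from_nat_into gens i)"
proof (induction rule: combination.induct)
  case zero
  have "\<zero> = (\<Oplus>\<^bsub>S\<^esub>i\<in>{..<0}. c (0::complex) \<otimes> from_nat_into gens i)" by simp
  thus ?case by (intro exI[of _ "0::nat"] exI[of _ "\<lambda>_. 0"]) simp
next
  case (add n x f a)
  let ?g = "from_nat_into gens"
  have g: "c b \<otimes> ?g i \<in> span" for b i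
    using from_nat_into[of gens i] gens_intros(3) by (intro scaled_in_span) auto
  obtain N l where x: "x = (\<Oplus>\<^bsub>S\<^esub>i\<in>{..<N}. c (l i) \<otimes> ?g i)" using add.IH by blast
  obtain k where k: "?g k = f" using from_nat_into_surj[OF countable_gens add.hyps(2)] ..
  define M where "M = max N (Suc k)"
  define l' where "l' = (\<lambda>i. if i < N then l i else 0)"
  define e where "e = (\<lambda>i. if i = k then a else 0)"
  have gk: "?g i \<in> carrier R" for i
    using from_nat_into[of gens i] gens_intros(3) by (auto intro: gens_closed)
  have "x = (\<Oplus>\<^bsub>S\<^esub>i\<in>{..<M}. c (l' i) \<otimes> ?g i)"
    unfolding x
    by (rule S.add.finprod_mono_neutral_cong_left)
       (use g gk in \<open>auto simp: l'_def M_def c_zero\<close>)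
  moreover have "c a \<otimes> f = (\<Oplus>\<^bsub>S\<^esub>i\<in>{..<M}. c (e i) \<otimes> ?g i)"
  proof -
    have "(\<Oplus>\<^bsub>S\<^esub>i\<in>{..<M}. c (e i) \<otimes> ?g i) = (\<Oplus>\<^bsub>S\<^esub>i\<in>{..<M}. if k = i then c a \<otimes> ?g i else \<zero>\<^bsub>S\<^esub>)"
      using g gk by (intro S.finsum_cong') (auto simp: e_def c_zero span_zero)
    also have "\<dots> = c a \<otimes> ?g k"
      using g by (intro S.add.finprod_singleton) (auto simp: M_def)
    finally show ?thesis by (simp add: k)
  qed
  ultimately have "c a \<otimes> f \<oplus> x = (\<Oplus>\<^bsub>S\<^esub>i\<in>{..<M}. c (e i) \<otimes> ?g i) \<oplus>\<^bsub>S\<^esub> (\<Oplus>\<^bsub>S\<^esub>i\<in>{..<M}. c (l' i) \<otimes> ?g i)"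
    by simp
  also have "\<dots> = (\<Oplus>\<^bsub>S\<^esub>i\<in>{..<M}. c (e i) \<otimes> ?g i \<oplus>\<^bsub>S\<^esub> c (l' i) \<otimes> ?g i)"
    by (rule S.finsum_addf[symmetric]) (use g in auto)
  also have "\<dots> = (\<Oplus>\<^bsub>S\<^esub>i\<in>{..<M}. c (e i + l' i) \<otimes> ?g i)"
    by (intro S.finsum_cong') (use g gk in \<open>auto simp: c_add l_distr intro: span_add\<close>)
  finally show ?case by (intro exI[of _ M] exI[of _ "\<lambda>i. e i + l' i"])
qed

sublocale S: countably_spanned_algebra S c "from_nat_into gens"
proof
  show "from_nat_into gens i \<in> carrier S" for i
    using from_nat_into[of gens i] gens_intros(3) by (auto intro: gens_in_span)
  show "\<exists>N l. x = (\<Oplus>\<^bsub>S\<^esub>i\<in>{..<N}. c (l i) \<otimes>\<^bsub>S\<^esub> from_nat_into gens i)" if "x \<in> carrier S" for x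
    using that S_spanned by (auto simp: span_def)
qed (simp_all add: c_add c_mult c_one)

text \<open>
  A homomorphism of complex algebras \<open>\<phi>\<close> from \<open>span\<close> to \<open>\<complex>\<close> that sends \<open>z = G 0\<close> to a real number. Since \<open>span\<close>
  has countable dimension and \<open>z\<close> is not constant, \<open>z - a\<close> is invertible for only countably many \<open>a\<close>,
  so for some real \<open>r\<close> the element \<open>z - r\<close> lies in a maximal ideal. The residue field again has countable
  dimension over \<open>\<complex>\<close>, and is therefore \<open>\<complex>\<close> itself.
\<close>

lemma complex_point:
  obtains r :: real and \<phi> :: "'a \<Rightarrow> complex" where
    "\<And>x y. x \<in> span \<Longrightarrow> y \<in> span \<Longrightarrow> \<phi> (x \<oplus> y) = \<phi> x + \<phi> y"
    "\<And>x y. x \<in> span \<Longrightarrow> y \<in> span \<Longrightarrow> \<phi> (x \<otimes> y) = \<phi> x * \<phi> y"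
    "\<And>a. \<phi> (c a) = a" "\<phi> (G 0) = of_real r"
proof -
  let ?z = "G 0"
  have z: "?z \<in> span" by (intro gens_in_span gens_intros)
  have P0: "primeideal {\<zero>} S"
  proof (rule primeidealI)
    show "ideal {\<zero>} S" using S.zeroideal by simp
    show "carrier S \<noteq> {\<zero>}" using span_one one_not_zero by auto
    show "a \<in> {\<zero>} \<or> b \<in> {\<zero>}" if "a \<in> carrier S" "b \<in> carrier S" "a \<otimes>\<^bsub>S\<^esub> b \<in> {\<zero>}" for a b
      using that integral[of a b] span_closed by auto
  qed (rule cring_S)
  have "\<exists>r::real. \<forall>b\<in>span. (?z \<ominus>\<^bsub>S\<^esub> c (of_real r)) \<otimes> b \<ominus>\<^bsub>S\<^esub> \<one> \<noteq> \<zero>"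
  proof (rule ccontr)
    assume *: "\<not> ?thesis"
    have "uncountable (range complex_of_real)"
    proof
      assume "countable (range complex_of_real)"
      hence "countable (UNIV :: real set)"
        using countable_image_inj_on[of complex_of_real UNIV] by (simp add: inj_on_def)
      thus False using uncountable_UNIV_real by blast
    qed
    from S.uncountably_many_inverses_mod[OF P0 _ this, of ?z] * z
    obtain a where "?z \<ominus>\<^bsub>S\<^esub> c a = \<zero>" by auto
    hence "?z \<ominus> c a = \<zero>" using z by (simp add: S_minus)
    hence "?z = c a" by (simp add: r_right_minus_eq)
    hence "\<one> = \<zero>" using deriv_G_0 deriv_c by metis
    thus False using one_not_zero by blast
  qed
  then obtain r :: real where r: "\<And>b. b \<in> span \<Longrightarrow> (?z \<ominus>\<^bsub>S\<^esub> c (of_real r)) \<otimes> b \<ominus>\<^bsub>S\<^esub> \<one> \<noteq> \<zero>"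
    by blast
  define w where "w = ?z \<ominus>\<^bsub>S\<^esub> c (of_real r)"
  have w: "w \<in> span" unfolding w_def using S.minus_closed[of ?z "c (of_real r)"] z by simp
  have "\<one>\<^bsub>S\<^esub> \<notin> PIdl\<^bsub>S\<^esub> w"
  proof
    assume "\<one>\<^bsub>S\<^esub> \<in> PIdl\<^bsub>S\<^esub> w"
    then obtain b where b: "b \<in> span" "b \<otimes> w = \<one>" by (auto simp: cgenideal_def)
    hence "w \<otimes> b \<ominus>\<^bsub>S\<^esub> \<one> = \<zero>"
      using S.r_right_minus_eq[of \<one> \<one>] w span_one by (simp add: m_comm[of w] span_closed)
    thus False using r[OF b(1)] by (simp add: w_def)
  qed
  then obtain M where M: "maximalideal M S" "PIdl\<^bsub>S\<^esub> w \<subseteq> M"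
    using S.exists_maximalideal[OF S.cgenideal_ideal[of w]] w by auto
  interpret M: maximalideal M S by (rule M(1))
  have PM: "primeideal M S" by (rule S.maximalideal_prime[OF M(1)])
  have wM: "w \<in> M" using M(2) S.cgenideal_self[of w] w by auto
  have ex: "\<exists>a. x \<ominus>\<^bsub>S\<^esub> c a \<in> M" if x: "x \<in> span" for x
  proof (rule ccontr)
    assume *: "\<not> ?thesis"
    have "\<exists>b\<in>carrier S. (x \<ominus>\<^bsub>S\<^esub> c a) \<otimes>\<^bsub>S\<^esub> b \<ominus>\<^bsub>S\<^esub> \<one>\<^bsub>S\<^esub> \<in> M" for a
      using S.maximalideal_inverse_mod[OF M(1), of "x \<ominus>\<^bsub>S\<^esub> c a"] * S.minus_closed[of x "c a"] x
      by auto
    moreover have "uncountable (UNIV :: complex set)"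
      using uncountable_UNIV_complex by blast
    ultimately show False
      using S.uncountably_many_inverses_mod[OF PM, of x UNIV] x * by auto
  qed
  have uniq: "a = b" if "x \<in> span" "x \<ominus>\<^bsub>S\<^esub> c a \<in> M" "x \<ominus>\<^bsub>S\<^esub> c b \<in> M" for a b x
  proof (rule ccontr)
    assume "a \<noteq> b"
    have "(x \<ominus>\<^bsub>S\<^esub> c b) \<ominus>\<^bsub>S\<^esub> (x \<ominus>\<^bsub>S\<^esub> c a) \<in> M" using that(2,3) by (rule M.a_minus_closed[rotated])
    also have "(x \<ominus>\<^bsub>S\<^esub> c b) \<ominus>\<^bsub>S\<^esub> (x \<ominus>\<^bsub>S\<^esub> c a) = c a \<oplus>\<^bsub>S\<^esub> (\<ominus>\<^bsub>S\<^esub> c b)"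
      using that(1) S.c_closed[of a] S.c_closed[of b] unfolding S_sel(1)[symmetric] by algebra
    also have "\<dots> = c (a - b)" unfolding S.c_minus[symmetric] by (simp flip: c_add)
    finally have "c (a - b) \<otimes>\<^bsub>S\<^esub> c (inverse (a - b)) \<in> M" by (intro M.I_r_closed) auto
    hence "\<one>\<^bsub>S\<^esub> \<in> M" using \<open>a \<noteq> b\<close> by (simp add: c_one flip: c_mult)
    thus False using M.one_imp_carrier M.I_notcarr by blast
  qed
  define \<phi> where "\<phi> = (\<lambda>x. THE a. x \<ominus>\<^bsub>S\<^esub> c a \<in> M)"
  have \<phi>I: "\<phi> x = a" if "x \<in> span" "x \<ominus>\<^bsub>S\<^esub> c a \<in> M" for x a
    unfolding \<phi>_def by (rule the_equality) (use uniq that in blast)+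
  have \<phi>: "x \<ominus>\<^bsub>S\<^esub> c (\<phi> x) \<in> M" if "x \<in> span" for x
    using ex[OF that] \<phi>I[OF that] by auto
  show thesis
  proof (rule that[of \<phi> r])
    fix x y assume x: "x \<in> span" and y: "y \<in> span"
    note cl = x[folded S_sel(1)] y[folded S_sel(1)] S.c_closed[of "\<phi> x"] S.c_closed[of "\<phi> y"]
    show "\<phi> (x \<oplus> y) = \<phi> x + \<phi> y"
    proof (rule \<phi>I)
      have "(x \<oplus>\<^bsub>S\<^esub> y) \<ominus>\<^bsub>S\<^esub> (c (\<phi> x) \<oplus>\<^bsub>S\<^esub> c (\<phi> y)) = (x \<ominus>\<^bsub>S\<^esub> c (\<phi> x)) \<oplus>\<^bsub>S\<^esub> (y \<ominus>\<^bsub>S\<^esub> c (\<phi> y))"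
        using cl by algebra
      thus "(x \<oplus> y) \<ominus>\<^bsub>S\<^esub> c (\<phi> x + \<phi> y) \<in> M"
        using M.a_closed[OF \<phi>[OF x] \<phi>[OF y]] by (simp add: c_add)
    qed (use x y in \<open>simp add: span_add\<close>)
    show "\<phi> (x \<otimes> y) = \<phi> x * \<phi> y"
    proof (rule \<phi>I)
      have "(x \<otimes>\<^bsub>S\<^esub> y) \<ominus>\<^bsub>S\<^esub> (c (\<phi> x) \<otimes>\<^bsub>S\<^esub> c (\<phi> y))
          = (x \<ominus>\<^bsub>S\<^esub> c (\<phi> x)) \<otimes>\<^bsub>S\<^esub> y \<oplus>\<^bsub>S\<^esub> c (\<phi> x) \<otimes>\<^bsub>S\<^esub> (y \<ominus>\<^bsub>S\<^esub> c (\<phi> y))"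
        using cl by algebra
      moreover have "\<dots> \<in> M"
        by (intro M.a_closed M.I_r_closed M.I_l_closed \<phi> x y cl)
      ultimately show "(x \<otimes> y) \<ominus>\<^bsub>S\<^esub> c (\<phi> x * \<phi> y) \<in> M"
        by (simp add: c_mult)
    qed (use x y in \<open>simp add: span_mult\<close>)
  next
    show "\<phi> (c a) = a" for a
      using S.r_right_minus_eq[of "c a" "c a"] M.zero_closed by (intro \<phi>I) auto
    show "\<phi> ?z = of_real r"
      using wM z by (intro \<phi>I) (simp_all add: w_def)
  qed
qed

end

context diff_field_over_complex
begin

lemma deriv_pow_span: "x \<in> span \<Longrightarrow> (deriv R ^^ k) x \<in> span"
  by (induction k) (simp_all add: span_deriv)

context
  fixes \<phi> :: "'a \<Rightarrow> complex" and r :: real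
  assumes \<phi>_add: "\<And>x y. x \<in> span \<Longrightarrow> y \<in> span \<Longrightarrow> \<phi> (x \<oplus> y) = \<phi> x + \<phi> y"
    and \<phi>_mult: "\<And>x y. x \<in> span \<Longrightarrow> y \<in> span \<Longrightarrow> \<phi> (x \<otimes> y) = \<phi> x * \<phi> y"
    and \<phi>_c: "\<And>a. \<phi> (c a) = a"
    and \<phi>_G_0: "\<phi> (G 0) = of_real r"
begin

text \<open>
  The Taylor expansion at the point \<open>\<phi>\<close>. By the Leibniz rule it is a homomorphism into power series
  that takes the derivation to the formal derivative.
\<close>

definition taylor :: "'a \<Rightarrow> complex fps" where
  "taylor x = Abs_fps (\<lambda>k. \<phi> ((deriv R ^^ k) x) / fact k)"

lemma taylor_nth_0: "fps_nth (taylor x) 0 = \<phi> x"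
  by (simp add: taylor_def)

lemma taylor_deriv: "taylor (deriv R x) = fps_deriv (taylor x)"
  by (rule fps_ext) (simp add: taylor_def funpow_swap1 field_simps del: of_nat_Suc)

lemma deriv_pow_add: "x \<in> span \<Longrightarrow> y \<in> span \<Longrightarrow>
    (deriv R ^^ k) (x \<oplus> y) = (deriv R ^^ k) x \<oplus> (deriv R ^^ k) y"
  by (induction k) (simp_all add: deriv_add deriv_pow_span span_closed)

lemma taylor_add: "x \<in> span \<Longrightarrow> y \<in> span \<Longrightarrow> taylor (x \<oplus> y) = taylor x + taylor y"
  by (rule fps_ext) (simp add: taylor_def deriv_pow_add \<phi>_add deriv_pow_span add_divide_distrib)

lemma taylor_mult:
  assumes "x \<in> span" "y \<in> span"
  shows "taylor (x \<otimes> y) = taylor x * taylor y"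
proof -
  have "\<forall>x\<in>span. \<forall>y\<in>span. fps_nth (taylor (x \<otimes> y)) k = fps_nth (taylor x * taylor y) k" for k
  proof (induction k)
    case 0
    show ?case by (simp add: taylor_nth_0 \<phi>_mult)
  next
    case (Suc k)
    show ?case
    proof (intro ballI)
      fix x y assume x: "x \<in> span" and y: "y \<in> span"
      have "of_nat (Suc k) * fps_nth (taylor (x \<otimes> y)) (Suc k) = fps_nth (taylor (deriv R (x \<otimes> y))) k"
        by (simp add: taylor_deriv)
      also have "deriv R (x \<otimes> y) = deriv R x \<otimes> y \<oplus> x \<otimes> deriv R y"
        using x y by (simp add: deriv_mult span_closed)
      also have "taylor \<dots> = taylor (deriv R x \<otimes> y) + taylor (x \<otimes> deriv R y)"
        using x y by (intro taylor_add span_mult span_deriv)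
      also have "fps_nth \<dots> k = fps_nth (fps_deriv (taylor x) * taylor y + taylor x * fps_deriv (taylor y)) k"
        using Suc.IH x y by (simp add: span_deriv taylor_deriv)
      also have "\<dots> = fps_nth (fps_deriv (taylor x * taylor y)) k"
        by (simp only: fps_deriv_mult add.commute)
      also have "\<dots> = of_nat (Suc k) * fps_nth (taylor x * taylor y) (Suc k)"
        by (simp only: fps_deriv_nth Suc_eq_plus1)
      finally show "fps_nth (taylor (x \<otimes> y)) (Suc k) = fps_nth (taylor x * taylor y) (Suc k)"
        by (simp only: mult_cancel_left of_nat_eq_0_iff) simp
    qed
  qed
  thus ?thesis using assms by (intro fps_ext) blast
qed

lemma taylor_c: "taylor (c a) = fps_const a"
proof -
  have 0: "\<phi> \<zero> = 0" using \<phi>_c[of 0] by (simp add: c_zero)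
  have "(deriv R ^^ Suc k) (c a) = \<zero>" for k
    by (induction k) (simp_all add: deriv_c)
  hence "fps_nth (taylor (c a)) (Suc k) = 0" for k by (simp add: taylor_def 0)
  thus ?thesis
    by (intro fps_ext) (metis \<phi>_c fps_nth_fps_const not0_implies_Suc taylor_nth_0)
qed

lemma taylor_G_0: "taylor (G 0) = fps_const (of_real r) + fps_X"
proof -
  have "fps_deriv (taylor (G 0)) = fps_deriv (fps_const (of_real r) + fps_X)"
    using taylor_c[of 1] by (simp add: deriv_G_0 c_one flip: taylor_deriv)
  from this[unfolded fps_deriv_eq_iff] show ?thesis by (simp add: taylor_nth_0 \<phi>_G_0)
qed

text \<open>
  Induction on the number \<open>n\<close> of terms of \<open>x = c a \<otimes> f \<oplus> x'\<close>. Dividing by \<open>f\<close> makes the first term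
  constant, so that differentiating removes it; by induction \<open>x / f\<close> has derivative \<open>0\<close>, hence is a
  complex constant, and constants are their own Taylor series. Division by \<open>f\<close> is possible because
  \<open>gens\<close> is a field, so that \<open>span\<close> contains the inverse of \<open>f\<close>.
\<close>

lemma taylor_eq_0_imp:
  assumes "combination n x" "taylor x = 0"
  shows "x = \<zero>"
  using assms
proof (induction n arbitrary: x)
  case 0
  thus ?case by (auto elim: combination.cases)
next
  case (Suc n)
  from Suc.prems(1) obtain x' f a where x: "x = c a \<otimes> f \<oplus> x'" "combination n x'" "f \<in> gens"
    by (auto elim: combination.cases)
  note cl = combination_closed[OF x(2)] gens_closed[OF x(3)]
  show ?case
  proof (cases "f = \<zero>")
    case True
    hence "x = x'" using x cl by simp
    thus ?thesis using Suc x by simp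
  next
    case False
    define g where "g = inv f"
    have g: "g \<in> gens" "f \<otimes> g = \<one>" "g \<in> carrier R"
      using False x(3) cl by (auto simp: g_def field_Units intro: gens_intros gens_closed)
    have x_span: "x \<in> span" using Suc.prems(1) by (auto simp: span_def)
    note g_span = gens_in_span[OF g(1)]
    have gx': "combination n (g \<otimes> x')"
      using combination_scale[OF x(2) g(1), of 1] g cl by (simp add: c_one)
    have gx: "g \<otimes> x = c a \<oplus> g \<otimes> x'"
    proof -
      have "g \<otimes> x = c a \<otimes> (f \<otimes> g) \<oplus> g \<otimes> x'"
        unfolding x(1) using g(3) cl c_closed[of a] by algebra
      thus ?thesis by (simp add: g)
    qed
    have "taylor (g \<otimes> x) = 0" using taylor_mult[OF g_span x_span] Suc.prems(2) by simp
    moreover have "deriv R (g \<otimes> x) = deriv R (g \<otimes> x')"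
      unfolding gx using g cl by (simp add: deriv_add deriv_c deriv_closed)
    ultimately have "taylor (deriv R (g \<otimes> x')) = 0"
      using taylor_deriv[of "g \<otimes> x"] by simp
    hence "deriv R (g \<otimes> x) = \<zero>"
      using Suc.IH[OF combination_deriv[OF gx']] \<open>deriv R (g \<otimes> x) = _\<close> by simp
    moreover have "g \<otimes> x \<in> carrier R" using g x_span by (simp add: span_closed)
    ultimately obtain b where b: "g \<otimes> x = c b" using constant_imp by blast
    have "b = 0" using \<open>taylor (g \<otimes> x) = 0\<close> taylor_c[of b] by (simp add: b)
    hence "g \<otimes> x = \<zero>" by (simp add: b c_zero)
    hence "f \<otimes> g \<otimes> x = \<zero>" using g(3) cl x_span by (simp add: m_assoc span_closed)
    thus ?thesis using g x_span by (simp add: span_closed)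
  qed
qed

lemma taylor_eq_0_iff: "x \<in> span \<Longrightarrow> taylor x = 0 \<longleftrightarrow> x = \<zero>"
  using taylor_eq_0_imp taylor_c[of 0] by (auto simp: span_def c_zero)

lemma taylor_zero: "taylor \<zero> = 0"
  using taylor_c[of 0] by (simp add: c_zero)

text \<open>
  The expansion of a quotient is the quotient of the expansions. The denominator \<open>v\<close> in the definition
  is arbitrary; \<open>laurent_mult_taylor\<close> shows that its choice does not matter.
\<close>

context
  assumes fractions: "\<And>x. x \<in> carrier R \<Longrightarrow> \<exists>v\<in>span. v \<noteq> \<zero> \<and> x \<otimes> v \<in> span"
begin

definition laurent :: "'a \<Rightarrow> complex fls" where
  "laurent x = (SOME w. \<exists>v\<in>span. v \<noteq> \<zero> \<and> x \<otimes> v \<in> span \<and>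
     w * fps_to_fls (taylor v) = fps_to_fls (taylor (x \<otimes> v)))"

lemma laurent_mult_taylor:
  assumes x: "x \<in> carrier R" and v: "v \<in> span" "x \<otimes> v \<in> span"
  shows "laurent x * fps_to_fls (taylor v) = fps_to_fls (taylor (x \<otimes> v))"
proof -
  obtain u where u: "u \<in> span" "u \<noteq> \<zero>" "x \<otimes> u \<in> span" using fractions[OF x] by blast
  have nz: "fps_to_fls (taylor u) \<noteq> 0" using u by (simp add: taylor_eq_0_iff)
  have "\<exists>w. \<exists>v\<in>span. v \<noteq> \<zero> \<and> x \<otimes> v \<in> span \<and>
     w * fps_to_fls (taylor v) = fps_to_fls (taylor (x \<otimes> v))"
    using u nz by (intro exI[of _ "fps_to_fls (taylor (x \<otimes> u)) / fps_to_fls (taylor u)"] bexI[of _ u]) auto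
  from someI_ex[OF this] obtain v' where v': "v' \<in> span" "v' \<noteq> \<zero>" "x \<otimes> v' \<in> span"
    "laurent x * fps_to_fls (taylor v') = fps_to_fls (taylor (x \<otimes> v'))"
    unfolding laurent_def by blast
  have "(x \<otimes> v') \<otimes> v = (x \<otimes> v) \<otimes> v'"
    using x v' v by (simp add: span_closed m_ac)
  hence "taylor (x \<otimes> v') * taylor v = taylor (x \<otimes> v) * taylor v'"
    using v v' by (metis taylor_mult)
  hence "fps_to_fls (taylor (x \<otimes> v')) * fps_to_fls (taylor v)
       = fps_to_fls (taylor (x \<otimes> v)) * fps_to_fls (taylor v')"
    by (metis fls_times_fps_to_fls)
  hence "laurent x * fps_to_fls (taylor v) * fps_to_fls (taylor v')
       = fps_to_fls (taylor (x \<otimes> v)) * fps_to_fls (taylor v')"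
    by (simp add: mult_ac flip: v'(4))
  moreover have "fps_to_fls (taylor v') \<noteq> 0" using v' by (simp add: taylor_eq_0_iff)
  ultimately show ?thesis by simp
qed

lemma laurent_eqI:
  assumes "x \<in> carrier R" "v \<in> span" "v \<noteq> \<zero>" "x \<otimes> v \<in> span"
    and "w * fps_to_fls (taylor v) = fps_to_fls (taylor (x \<otimes> v))"
  shows "laurent x = w"
proof -
  have "fps_to_fls (taylor v) \<noteq> 0" using assms(2,3) by (simp add: taylor_eq_0_iff)
  moreover have "laurent x * fps_to_fls (taylor v) = w * fps_to_fls (taylor v)"
    using laurent_mult_taylor[OF assms(1,2,4)] assms(5) by (simp only:)
  ultimately show ?thesis by simp
qed

lemma laurent_span: "x \<in> span \<Longrightarrow> laurent x = fps_to_fls (taylor x)"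
  using taylor_c[of 1]
  by (intro laurent_eqI[of x \<one>]) (simp_all add: span_one span_closed c_one one_not_zero)

lemma laurent_add_mult:
  assumes x: "x \<in> carrier R" and y: "y \<in> carrier R"
  shows "laurent (x \<oplus> y) = laurent x + laurent y" "laurent (x \<otimes> y) = laurent x * laurent y"
proof -
  obtain u where u: "u \<in> span" "u \<noteq> \<zero>" "x \<otimes> u \<in> span" using fractions[OF x] by blast
  obtain v where v: "v \<in> span" "v \<noteq> \<zero>" "y \<otimes> v \<in> span" using fractions[OF y] by blast
  note cl = x y u(1)[THEN span_closed] v(1)[THEN span_closed]
  note Tx = laurent_mult_taylor[OF x u(1,3), symmetric]
  note Ty = laurent_mult_taylor[OF y v(1,3), symmetric]
  have uv: "u \<otimes> v \<in> span" "u \<otimes> v \<noteq> \<zero>" using u v cl by (auto simp: span_mult integral_iff)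
  have eq: "(x \<oplus> y) \<otimes> (u \<otimes> v) = (x \<otimes> u) \<otimes> v \<oplus> (y \<otimes> v) \<otimes> u"
    "(x \<otimes> y) \<otimes> (u \<otimes> v) = (x \<otimes> u) \<otimes> (y \<otimes> v)"
    using cl by algebra+
  show "laurent (x \<oplus> y) = laurent x + laurent y"
  proof (rule laurent_eqI[OF _ uv])
    show "(x \<oplus> y) \<otimes> (u \<otimes> v) \<in> span" unfolding eq using u v by (simp add: span_add span_mult)
    show "(laurent x + laurent y) * fps_to_fls (taylor (u \<otimes> v))
        = fps_to_fls (taylor ((x \<oplus> y) \<otimes> (u \<otimes> v)))"
      unfolding eq using u v
      by (simp add: taylor_mult taylor_add span_mult fls_times_fps_to_fls Tx Ty algebra_simps)
  qed (use cl in simp)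
  show "laurent (x \<otimes> y) = laurent x * laurent y"
  proof (rule laurent_eqI[OF _ uv])
    show "(x \<otimes> y) \<otimes> (u \<otimes> v) \<in> span" unfolding eq using u v by (simp add: span_mult)
    show "(laurent x * laurent y) * fps_to_fls (taylor (u \<otimes> v))
        = fps_to_fls (taylor ((x \<otimes> y) \<otimes> (u \<otimes> v)))"
      unfolding eq using u v
      by (simp add: taylor_mult span_mult fls_times_fps_to_fls Tx Ty algebra_simps)
  qed (use cl in simp)
qed

lemma laurent_deriv:
  assumes x: "x \<in> carrier R"
  shows "laurent (deriv R x) = fls_deriv (laurent x)"
proof -
  obtain u where u: "u \<in> span" "u \<noteq> \<zero>" "x \<otimes> u \<in> span" using fractions[OF x] by blast
  note cl = x u(1)[THEN span_closed] u(3)[THEN span_closed]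
  have uu: "u \<otimes> u \<in> span" "u \<otimes> u \<noteq> \<zero>" using u cl by (auto simp: span_mult integral_iff)
  have T: "laurent x * fps_to_fls (taylor u) = fps_to_fls (taylor (x \<otimes> u))"
    by (rule laurent_mult_taylor[OF x u(1,3)])
  have T': "fls_deriv (laurent x) * fps_to_fls (taylor u) + laurent x * fps_to_fls (taylor (deriv R u))
      = fps_to_fls (taylor (deriv R (x \<otimes> u)))"
    using arg_cong[OF T, of fls_deriv] by (simp add: fls_deriv_fps_to_fls taylor_deriv algebra_simps)
  have eq: "deriv R x \<otimes> (u \<otimes> u) = deriv R (x \<otimes> u) \<otimes> u \<oplus> (\<ominus> ((x \<otimes> u) \<otimes> deriv R u))"
    unfolding deriv_mult[OF cl(1,2)] using cl deriv_closed[OF cl(1)] deriv_closed[OF cl(2)] by algebra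
  have minus: "taylor (\<ominus> y) = - taylor y" if "y \<in> span" for y
  proof -
    have "taylor (\<ominus> y) + taylor y = taylor (\<ominus> y \<oplus> y)"
      using that by (simp add: taylor_add span_minus)
    also have "\<dots> = 0" using that by (simp add: l_neg span_closed taylor_zero)
    finally show ?thesis by (simp add: eq_neg_iff_add_eq_0)
  qed
  show ?thesis
  proof (rule laurent_eqI[OF _ uu])
    show "deriv R x \<in> carrier R" using x by (rule deriv_closed)
    show "deriv R x \<otimes> (u \<otimes> u) \<in> span"
      unfolding eq using u by (simp add: span_add span_mult span_minus span_deriv)
    show "fls_deriv (laurent x) * fps_to_fls (taylor (u \<otimes> u))
        = fps_to_fls (taylor (deriv R x \<otimes> (u \<otimes> u)))"
      unfolding eq using u
      by (simp add: taylor_mult taylor_add span_mult span_minus span_deriv minus fls_times_fps_to_fls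
            algebra_simps flip: T T')
  qed
qed

end
end

text \<open>
  The point of expansion \<open>r\<close> is real, which makes conjugation of coefficients compatible with complex
  conjugation of rational functions.
\<close>

theorem exists_laurent_embedding:
  assumes "\<And>x. x \<in> carrier R \<Longrightarrow> \<exists>v\<in>span. v \<noteq> \<zero> \<and> x \<otimes> v \<in> span"
  obtains r :: real and j :: "'a \<Rightarrow> complex fls" where
    "\<And>x y. x \<in> carrier R \<Longrightarrow> y \<in> carrier R \<Longrightarrow> j (x \<oplus> y) = j x + j y"
    "\<And>x y. x \<in> carrier R \<Longrightarrow> y \<in> carrier R \<Longrightarrow> j (x \<otimes> y) = j x * j y"
    "\<And>x. x \<in> carrier R \<Longrightarrow> j (deriv R x) = fls_deriv (j x)"
    "\<And>a. j (c a) = fls_const a"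
    "j (G 0) = fls_const (of_real r) + fls_X"
proof (rule complex_point)
  fix r \<phi>
  assume h: "\<And>x y. x \<in> span \<Longrightarrow> y \<in> span \<Longrightarrow> \<phi> (x \<oplus> y) = \<phi> x + \<phi> y"
    "\<And>x y. x \<in> span \<Longrightarrow> y \<in> span \<Longrightarrow> \<phi> (x \<otimes> y) = \<phi> x * \<phi> y"
    "\<And>a. \<phi> (c a) = a" "\<phi> (G 0) = complex_of_real r"
  show thesis
  proof (rule that[of "laurent \<phi>" r])
    show "laurent \<phi> (c a) = fls_const a" for a
      using laurent_span[OF h assms c_in_span, of a] taylor_c[OF h, of a] by simp
    show "laurent \<phi> (G 0) = fls_const (of_real r) + fls_X"
      using laurent_span[OF h assms gens_in_span[OF gens_intros(1)]] taylor_G_0[OF h] by simp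
  qed (use laurent_add_mult[OF h assms] laurent_deriv[OF h assms] in blast)+
qed

end

text \<open>The fractions with numerator and denominator in \<open>span\<close> form a subfield.\<close>

lemma (in diff_field_over_complex) generated_imp_fraction:
  assumes H: "\<And>x. x \<in> H \<Longrightarrow> x \<in> carrier R \<and> (\<exists>v\<in>span. v \<noteq> \<zero> \<and> x \<otimes> v \<in> span)"
    and "x \<in> generate_field R H"
  shows "x \<in> carrier R \<and> (\<exists>v\<in>span. v \<noteq> \<zero> \<and> x \<otimes> v \<in> span)"
  using assms(2)
proof (induction rule: generate_field.induct)
  case one
  show ?case using span_one one_not_zero by (auto intro!: bexI[of _ \<one>])
next
  case (incl x)
  thus ?case using H by blast
next
  case (a_inv x)
  then obtain v where "x \<in> carrier R" "v \<in> span" "v \<noteq> \<zero>" "x \<otimes> v \<in> span" by blast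
  thus ?case by (auto simp: l_minus span_closed span_minus intro!: bexI[of _ v])
next
  case (m_inv x)
  then obtain v where v: "x \<in> carrier R" "v \<in> span" "v \<noteq> \<zero>" "x \<otimes> v \<in> span" by blast
  have U: "inv x \<in> carrier R" "inv x \<otimes> x = \<one>" using v(1) m_inv.hyps(2) by (auto simp: field_Units)
  have "inv x \<otimes> (x \<otimes> v) = v"
    using v U span_closed[OF v(2)] by (simp flip: m_assoc)
  moreover have "x \<otimes> v \<noteq> \<zero>" using v m_inv.hyps(2) span_closed[OF v(2)] by (simp add: integral_iff)
  ultimately show ?case using v U by (auto intro!: bexI[of _ "x \<otimes> v"])
next
  case (eng_add x y)
  then obtain u v where u: "x \<in> carrier R" "u \<in> span" "u \<noteq> \<zero>" "x \<otimes> u \<in> span"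
    and v: "y \<in> carrier R" "v \<in> span" "v \<noteq> \<zero>" "y \<otimes> v \<in> span" by blast
  note cl = u(1) v(1) span_closed[OF u(2)] span_closed[OF v(2)]
  have "(x \<oplus> y) \<otimes> (u \<otimes> v) = (x \<otimes> u) \<otimes> v \<oplus> (y \<otimes> v) \<otimes> u" using cl by algebra
  hence "(x \<oplus> y) \<otimes> (u \<otimes> v) \<in> span" using u v by (simp add: span_add span_mult)
  thus ?case using u v cl by (intro conjI bexI[of _ "u \<otimes> v"]) (auto simp: integral_iff span_mult)
next
  case (eng_mult x y)
  then obtain u v where u: "x \<in> carrier R" "u \<in> span" "u \<noteq> \<zero>" "x \<otimes> u \<in> span"
    and v: "y \<in> carrier R" "v \<in> span" "v \<noteq> \<zero>" "y \<otimes> v \<in> span" by blast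
  note cl = u(1) v(1) span_closed[OF u(2)] span_closed[OF v(2)]
  have "(x \<otimes> y) \<otimes> (u \<otimes> v) = (x \<otimes> u) \<otimes> (y \<otimes> v)" using cl by algebra
  hence "(x \<otimes> y) \<otimes> (u \<otimes> v) \<in> span" using u v by (simp add: span_mult)
  thus ?case using u v cl by (intro conjI bexI[of _ "u \<otimes> v"]) (auto simp: integral_iff span_mult)
qed

section \<open>Fields and matrices seen through an embedding\<close>

text \<open>
  Identities between elements of a field with a carrier are checked after applying an embedding into a
  field that is a type, where ordinary arithmetic and matrices with ordinary multiplication are available.
\<close>

locale field_embedding = field R for R (structure) +
  fixes j :: "'a \<Rightarrow> 'k::field"
  assumes j_add: "x \<in> carrier R \<Longrightarrow> y \<in> carrier R \<Longrightarrow> j (x \<oplus> y) = j x + j y"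
    and j_mult: "x \<in> carrier R \<Longrightarrow> y \<in> carrier R \<Longrightarrow> j (x \<otimes> y) = j x * j y"
    and j_one: "j \<one> = 1"
begin

lemma j_zero: "j \<zero> = 0"
proof -
  have "j \<zero> + j \<zero> = j \<zero>" using j_add[of \<zero> \<zero>] by simp
  thus ?thesis using add_left_imp_eq[of "j \<zero>" "j \<zero>" 0] by simp
qed

lemma j_minus: "x \<in> carrier R \<Longrightarrow> j (\<ominus> x) = - j x"
proof -
  assume x: "x \<in> carrier R"
  hence "j (\<ominus> x) + j x = 0" by (simp add: j_zero l_neg flip: j_add)
  thus ?thesis by (simp add: eq_neg_iff_add_eq_0)
qed

lemma j_inverse: "x \<in> carrier R \<Longrightarrow> x \<noteq> \<zero> \<Longrightarrow> j (inv x) = inverse (j x)"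
proof -
  assume x: "x \<in> carrier R" "x \<noteq> \<zero>"
  hence "inv x \<in> carrier R" "inv x \<otimes> x = \<one>" by (auto simp: field_Units)
  hence "j (inv x) * j x = 1" using x by (simp add: j_one flip: j_mult)
  thus ?thesis by (metis inverse_unique mult.commute)
qed

lemma j_eq_0_iff: "x \<in> carrier R \<Longrightarrow> j x = 0 \<longleftrightarrow> x = \<zero>"
proof -
  assume x: "x \<in> carrier R"
  have "j x \<noteq> 0" if "x \<noteq> \<zero>"
  proof
    assume "j x = 0"
    moreover have "inv x \<in> carrier R" "inv x \<otimes> x = \<one>" using x that by (auto simp: field_Units)
    ultimately show False using j_mult[of "inv x" x] x by (simp add: j_one)
  qed
  thus ?thesis by (auto simp: j_zero)
qed

lemma j_inj: "x \<in> carrier R \<Longrightarrow> y \<in> carrier R \<Longrightarrow> j x = j y \<longleftrightarrow> x = y"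
proof
  assume x: "x \<in> carrier R" and y: "y \<in> carrier R" and "j x = j y"
  hence "j (x \<ominus> y) = 0" by (simp add: a_minus_def j_add j_minus)
  thus "x = y" using x y by (simp add: j_eq_0_iff r_right_minus_eq)
qed auto

lemma j_finsum: "finite A \<Longrightarrow> g \<in> A \<rightarrow> carrier R \<Longrightarrow> j (finsum R g A) = (\<Sum>x\<in>A. j (g x))"
  by (induction A rule: finite_induct) (simp_all add: j_zero j_add)

lemma image_closed:
  "x \<in> j ` carrier R \<Longrightarrow> y \<in> j ` carrier R \<Longrightarrow> x + y \<in> j ` carrier R"
  "x \<in> j ` carrier R \<Longrightarrow> y \<in> j ` carrier R \<Longrightarrow> x * y \<in> j ` carrier R"
  "x \<in> j ` carrier R \<Longrightarrow> - x \<in> j ` carrier R"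
  "x \<in> j ` carrier R \<Longrightarrow> inverse x \<in> j ` carrier R"
  "0 \<in> j ` carrier R" "1 \<in> j ` carrier R"
proof -
  show "x \<in> j ` carrier R \<Longrightarrow> y \<in> j ` carrier R \<Longrightarrow> x + y \<in> j ` carrier R"
    by (metis (no_types, lifting) a_closed image_iff j_add)
  show "x \<in> j ` carrier R \<Longrightarrow> y \<in> j ` carrier R \<Longrightarrow> x * y \<in> j ` carrier R"
    by (metis (no_types, lifting) m_closed image_iff j_mult)
  show "x \<in> j ` carrier R \<Longrightarrow> - x \<in> j ` carrier R"
    by (metis (no_types, lifting) a_inv_closed image_iff j_minus)
  show 0: "0 \<in> j ` carrier R" by (metis image_eqI j_zero zero_closed)
  show "1 \<in> j ` carrier R" by (metis image_eqI j_one one_closed)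
  show "x \<in> j ` carrier R \<Longrightarrow> inverse x \<in> j ` carrier R"
  proof (elim imageE)
    fix y assume y: "x = j y" "y \<in> carrier R"
    show "inverse x \<in> j ` carrier R"
    proof (cases "y = \<zero>")
      case True
      thus ?thesis using 0 y by (simp add: j_zero)
    next
      case False
      hence "inverse x = j (inv y)" "inv y \<in> carrier R"
        using y by (auto simp: j_inverse field_Units)
      thus ?thesis by blast
    qed
  qed
qed

lemma image_generate_field_closed:
  assumes H: "H \<subseteq> carrier R"
  shows "x \<in> j ` generate_field R H \<Longrightarrow> y \<in> j ` generate_field R H \<Longrightarrow> x + y \<in> j ` generate_field R H"
    "x \<in> j ` generate_field R H \<Longrightarrow> y \<in> j ` generate_field R H \<Longrightarrow> x * y \<in> j ` generate_field R H"
    "x \<in> j ` generate_field R H \<Longrightarrow> - x \<in> j ` generate_field R H"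
    "x \<in> j ` generate_field R H \<Longrightarrow> inverse x \<in> j ` generate_field R H"
    "0 \<in> j ` generate_field R H" "1 \<in> j ` generate_field R H"
proof -
  note cl = generate_field_in_carrier[OF H]
  have I: "x \<in> j ` generate_field R H" if "x = j a" "a \<in> generate_field R H" for x a
    using that by blast
  show "x + y \<in> j ` generate_field R H" if xy: "x \<in> j ` generate_field R H" "y \<in> j ` generate_field R H"
  proof -
    obtain a b where ab: "x = j a" "y = j b" "a \<in> generate_field R H" "b \<in> generate_field R H"
      using xy by blast
    show ?thesis by (rule I[of _ "a \<oplus> b"]) (simp_all add: ab cl j_add generate_field.eng_add)
  qed
  show "x * y \<in> j ` generate_field R H" if xy: "x \<in> j ` generate_field R H" "y \<in> j ` generate_field R H"
  proof -
    obtain a b where ab: "x = j a" "y = j b" "a \<in> generate_field R H" "b \<in> generate_field R H"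
      using xy by blast
    show ?thesis by (rule I[of _ "a \<otimes> b"]) (simp_all add: ab cl j_mult generate_field.eng_mult)
  qed
  show "- x \<in> j ` generate_field R H" if x: "x \<in> j ` generate_field R H"
  proof -
    obtain a where a: "x = j a" "a \<in> generate_field R H" using x by blast
    show ?thesis by (rule I[of _ "\<ominus> a"]) (simp_all add: a cl j_minus generate_field.a_inv)
  qed
  show 0: "0 \<in> j ` generate_field R H"
    by (rule I[of _ \<zero>]) (simp_all add: j_zero zero_in_generate)
  show "1 \<in> j ` generate_field R H"
    by (rule I[of _ \<one>]) (simp_all add: j_one generate_field.one)
  show "inverse x \<in> j ` generate_field R H" if x: "x \<in> j ` generate_field R H"
  proof -
    obtain a where a: "x = j a" "a \<in> generate_field R H" using x by blast
    show ?thesis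
    proof (cases "a = \<zero>")
      case True
      thus ?thesis using 0 a by (simp add: j_zero)
    next
      case False
      thus ?thesis by (intro I[of _ "inv a"]) (simp_all add: a cl j_inverse generate_field.m_inv)
    qed
  qed
qed

lemma mats_over_elem: "M \<in> mats_over R m \<Longrightarrow> i < m \<Longrightarrow> k < m \<Longrightarrow> M $$ (i, k) \<in> carrier R"
  unfolding mats_over_def by blast

lemma mats_overI: "M \<in> carrier_mat m m \<Longrightarrow> (\<And>i k. i < m \<Longrightarrow> k < m \<Longrightarrow> M $$ (i, k) \<in> carrier R) \<Longrightarrow>
    M \<in> mats_over R m"
  unfolding mats_over_def by (auto dest!: elements_matD)

lemma map_mat_mat_prod:
  assumes "M \<in> mats_over R m" "N \<in> mats_over R m"
  shows "map_mat j (mat_prod R m M N) = map_mat j M * map_mat j N"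
proof (rule eq_matI)
  have dim: "M \<in> carrier_mat m m" "N \<in> carrier_mat m m" using assms by (auto simp: mats_over_def)
  fix i k assume "i < dim_row (map_mat j M * map_mat j N)" "k < dim_col (map_mat j M * map_mat j N)"
  hence ik: "i < m" "k < m" using dim by auto
  have "map_mat j (mat_prod R m M N) $$ (i, k) = j (\<Oplus>l\<in>{..<m}. M $$ (i, l) \<otimes> N $$ (l, k))"
    using ik by (simp add: mat_prod_def)
  also have "\<dots> = (\<Sum>l<m. j (M $$ (i, l) \<otimes> N $$ (l, k)))"
    using assms ik by (intro j_finsum) (auto simp: mats_over_elem)
  also have "\<dots> = (\<Sum>l<m. j (M $$ (i, l)) * j (N $$ (l, k)))"
    using assms ik by (intro sum.cong refl j_mult) (auto simp: mats_over_elem)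
  also have "\<dots> = (map_mat j M * map_mat j N) $$ (i, k)"
    using ik dim by (simp add: scalar_prod_def atLeast0LessThan)
  finally show "map_mat j (mat_prod R m M N) $$ (i, k) = (map_mat j M * map_mat j N) $$ (i, k)" .
qed (use assms in \<open>auto simp: mat_prod_def mats_over_def\<close>)

lemma mat_prod_mats_over: "M \<in> mats_over R m \<Longrightarrow> N \<in> mats_over R m \<Longrightarrow> mat_prod R m M N \<in> mats_over R m"
  by (rule mats_overI) (auto simp: mat_prod_def mats_over_elem intro!: finsum_closed)

lemma mat_one_mats_over: "mat_one R m \<in> mats_over R m"
  by (rule mats_overI) (auto simp: mat_one_def)

lemma map_mat_mat_one: "map_mat j (mat_one R m) = 1\<^sub>m m"
  by (rule eq_matI) (auto simp: mat_one_def j_one j_zero)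

lemma map_mat_inj:
  assumes "M \<in> mats_over R m" "N \<in> mats_over R m" "map_mat j M = map_mat j N"
  shows "M = N"
proof (rule eq_matI)
  have dim: "M \<in> carrier_mat m m" "N \<in> carrier_mat m m" using assms by (auto simp: mats_over_def)
  fix i k assume "i < dim_row N" "k < dim_col N"
  hence ik: "i < m" "k < m" using dim by auto
  have "map_mat j M $$ (i, k) = map_mat j N $$ (i, k)" using assms(3) by simp
  thus "M $$ (i, k) = N $$ (i, k)" using ik dim assms(1,2) by (simp add: j_inj mats_over_elem)
qed (use assms in \<open>auto simp: mats_over_def\<close>)

lemma GL_over_iff:
  "M \<in> GL_over R m \<longleftrightarrow> M \<in> mats_over R m \<and> (\<exists>N\<in>mats_over R m.
     map_mat j M * map_mat j N = 1\<^sub>m m \<and> map_mat j N * map_mat j M = 1\<^sub>m m)"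
proof -
  have "mat_prod R m M N = mat_one R m \<longleftrightarrow> map_mat j M * map_mat j N = 1\<^sub>m m"
    if "M \<in> mats_over R m" "N \<in> mats_over R m" for M N
    using map_mat_inj[OF mat_prod_mats_over[OF that] mat_one_mats_over]
    by (auto simp: map_mat_mat_prod[OF that, symmetric] map_mat_mat_one)
  thus ?thesis unfolding GL_over_def by blast
qed

lemma mat_preimage:
  assumes "M \<in> carrier_mat m m" "\<And>i k. i < m \<Longrightarrow> k < m \<Longrightarrow> M $$ (i, k) \<in> j ` carrier R"
  obtains N where "N \<in> mats_over R m" "map_mat j N = M"
proof (rule that)
  let ?N = "map_mat (inv_into (carrier R) j) M"
  show "?N \<in> mats_over R m" using assms by (intro mats_overI) (auto simp: inv_into_into)
  show "map_mat j ?N = M" using assms by (intro eq_matI) (auto simp: f_inv_into_f)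
qed

end

lemma map_mat_fls_deriv_mult:
  fixes M N :: "'a::field fls mat"
  assumes "M \<in> carrier_mat a b" "N \<in> carrier_mat b d"
  shows "map_mat fls_deriv (M * N) = map_mat fls_deriv M * N + M * map_mat fls_deriv N"
  using assms
  by (intro eq_matI) (auto simp: scalar_prod_def fls_deriv_sum sum.distrib[symmetric] algebra_simps intro!: sum.cong)

section \<open>Real and imaginary parts of Laurent series\<close>

abbreviation fls_i :: "complex fls" where
  "fls_i \<equiv> fls_const \<i>"

lemma fls_i_mult: "fls_i * fls_i = -1" "fls_i * (fls_i * f) = - f"
proof -
  show *: "fls_i * fls_i = -1"
    using fls_const_uminus[of "1::complex"] by (simp only: fls_const_mult_const i_squared[unfolded power2_eq_square] fls_const_1)
  show "fls_i * (fls_i * f) = - f" by (simp add: * flip: mult.assoc)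
qed

definition re_fls :: "complex fls \<Rightarrow> complex fls" where
  "re_fls f = (f + cnj_fls f) / 2"

definition im_fls :: "complex fls \<Rightarrow> complex fls" where
  "im_fls f = fls_i * (cnj_fls f - f) / 2"

lemma re_im_decompose: "f = re_fls f + fls_i * im_fls f"
  by (simp add: re_fls_def im_fls_def fls_i_mult field_simps)

lemma cnj_fls_numeral [simp]: "cnj_fls 2 = 2"
  using cnj_fls_hom.hom_add[of 1 1] by simp

lemma cnj_fls_divide: "cnj_fls (f / g) = cnj_fls f / cnj_fls g"
  by (simp add: divide_inverse cnj_fls_hom.hom_mult cnj_fls_hom.hom_inverse)

lemma cnj_re_fls [simp]: "cnj_fls (re_fls f) = re_fls f"
  by (simp add: re_fls_def cnj_fls_divide cnj_fls_hom.hom_add add.commute)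

lemma cnj_im_fls [simp]: "cnj_fls (im_fls f) = im_fls f"
  by (simp add: im_fls_def cnj_fls_divide cnj_fls_hom.hom_mult cnj_fls_hom.hom_minus algebra_simps)

lemma re_im_unique:
  assumes "cnj_fls a = a" "cnj_fls b = b"
  shows "re_fls (a + fls_i * b) = a" "im_fls (a + fls_i * b) = b"
  using assms by (simp_all add: re_fls_def im_fls_def cnj_fls_hom.hom_add cnj_fls_hom.hom_mult
      algebra_simps fls_i_mult)

lemma re_fls_eq_iff: "re_fls f = f \<longleftrightarrow> cnj_fls f = f"
proof
  assume "re_fls f = f"
  thus "cnj_fls f = f" using cnj_re_fls[of f] by (simp only:)
next
  assume "cnj_fls f = f"
  thus "re_fls f = f" by (simp add: re_fls_def)
qed

lemma re_im_fls_simps: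
  "re_fls 0 = 0" "im_fls 0 = 0" "re_fls 1 = 1" "im_fls 1 = 0"
  "re_fls (- f) = - re_fls f" "im_fls (- f) = - im_fls f"
  "re_fls (f + g) = re_fls f + re_fls g" "im_fls (f + g) = im_fls f + im_fls g"
  "re_fls (f * g) = re_fls f * re_fls g - im_fls f * im_fls g"
  "im_fls (f * g) = re_fls f * im_fls g + im_fls f * re_fls g"
  "re_fls (fls_deriv f) = fls_deriv (re_fls f)" "im_fls (fls_deriv f) = fls_deriv (im_fls f)"
proof -
  show "re_fls 0 = 0" "im_fls 0 = 0" "re_fls 1 = 1" "im_fls 1 = 0"
    by (simp_all add: re_fls_def im_fls_def)
  show "re_fls (- f) = - re_fls f" "im_fls (- f) = - im_fls f"
    "re_fls (f + g) = re_fls f + re_fls g" "im_fls (f + g) = im_fls f + im_fls g"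
    by (simp_all add: re_fls_def im_fls_def cnj_fls_hom.hom_add cnj_fls_hom.hom_uminus field_simps)
  have "f * g = (re_fls f * re_fls g - im_fls f * im_fls g)
      + fls_i * (re_fls f * im_fls g + im_fls f * re_fls g)"
    by (subst (1) re_im_decompose[of f], subst (1) re_im_decompose[of g])
      (simp add: algebra_simps fls_i_mult)
  thus "re_fls (f * g) = re_fls f * re_fls g - im_fls f * im_fls g"
    "im_fls (f * g) = re_fls f * im_fls g + im_fls f * re_fls g"
    by (simp_all add: re_im_unique cnj_fls_hom.hom_add cnj_fls_hom.hom_minus cnj_fls_hom.hom_mult)
  have "fls_deriv f = fls_deriv (re_fls f) + fls_i * fls_deriv (im_fls f)"
    by (subst (1) re_im_decompose[of f]) simp
  thus "re_fls (fls_deriv f) = fls_deriv (re_fls f)" "im_fls (fls_deriv f) = fls_deriv (im_fls f)"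
    by (simp_all add: re_im_unique cnj_fls_deriv)
qed

text \<open>Expand the inverse of \<open>f\<close> by the conjugate of \<open>f\<close>; the denominator becomes real.\<close>

lemma re_im_inverse:
  "re_fls (inverse f) = re_fls f * inverse (re_fls f * re_fls f + im_fls f * im_fls f)"
  "im_fls (inverse f) = - im_fls f * inverse (re_fls f * re_fls f + im_fls f * im_fls f)"
proof -
  let ?N = "re_fls f * re_fls f + im_fls f * im_fls f"
  have N: "f * cnj_fls f = ?N"
    by (subst (1 2) re_im_decompose[of f])
      (simp add: cnj_fls_hom.hom_add cnj_fls_hom.hom_mult algebra_simps fls_i_mult)
  have cnj: "cnj_fls f = re_fls f + fls_i * (- im_fls f)"
    by (subst (1) re_im_decompose[of f]) (simp add: cnj_fls_hom.hom_add cnj_fls_hom.hom_mult)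
  have "inverse f = cnj_fls f * inverse ?N"
  proof (cases "f = 0")
    case False
    hence "cnj_fls f \<noteq> 0" by simp
    with False show ?thesis by (simp flip: N)
  qed simp
  hence inv: "inverse f = re_fls f * inverse ?N + fls_i * (- im_fls f * inverse ?N)"
    by (simp add: cnj algebra_simps)
  have real: "cnj_fls (re_fls f * inverse ?N) = re_fls f * inverse ?N"
    "cnj_fls (- im_fls f * inverse ?N) = - im_fls f * inverse ?N"
    by (simp_all add: cnj_fls_hom.hom_add cnj_fls_hom.hom_uminus cnj_fls_hom.hom_mult
        cnj_fls_hom.hom_inverse)
  show "re_fls (inverse f) = re_fls f * inverse ?N" "im_fls (inverse f) = - im_fls f * inverse ?N"
    by (simp_all only: inv re_im_unique[OF real])
qed

lemma re_im_sum:
  "re_fls (\<Sum>x\<in>A. f x) = (\<Sum>x\<in>A. re_fls (f x))" "im_fls (\<Sum>x\<in>A. f x) = (\<Sum>x\<in>A. im_fls (f x))"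
  by (induction A rule: infinite_finite_induct) (simp_all add: re_im_fls_simps)

text \<open>
  The real matrix of size \<open>2 n\<close> by which the complex matrix \<open>M\<close> acts on pairs of real and imaginary parts.
  It is multiplicative in \<open>M\<close> and commutes with the derivation.
\<close>

definition realify :: "complex fls mat \<Rightarrow> complex fls mat" where
  "realify M = four_block_mat (map_mat re_fls M) (- map_mat im_fls M)
     (map_mat im_fls M) (map_mat re_fls M)"

lemma realify_carrier [simp, intro]: "M \<in> carrier_mat n n \<Longrightarrow> realify M \<in> carrier_mat (n + n) (n + n)"
  unfolding realify_def by (rule four_block_carrier_mat) auto

lemma map_mat_re_im_mult:
  assumes "M \<in> carrier_mat n n" "N \<in> carrier_mat n n"
  shows "map_mat re_fls (M * N) = map_mat re_fls M * map_mat re_fls N - map_mat im_fls M * map_mat im_fls N"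
    "map_mat im_fls (M * N) = map_mat re_fls M * map_mat im_fls N + map_mat im_fls M * map_mat re_fls N"
proof -
  note [simp] = scalar_prod_def re_im_sum re_im_fls_simps
  show "map_mat re_fls (M * N) = map_mat re_fls M * map_mat re_fls N - map_mat im_fls M * map_mat im_fls N"
    using assms by (intro eq_matI) (auto simp: sum_subtractf)
  show "map_mat im_fls (M * N) = map_mat re_fls M * map_mat im_fls N + map_mat im_fls M * map_mat re_fls N"
    using assms by (intro eq_matI) (auto simp: sum.distrib)
qed

lemma realify_mult:
  assumes M: "M \<in> carrier_mat n n" and N: "N \<in> carrier_mat n n"
  shows "realify (M * N) = realify M * realify N"
proof -
  let ?a = "map_mat re_fls M" and ?b = "map_mat im_fls M"
  let ?c = "map_mat re_fls N" and ?d = "map_mat im_fls N"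
  have cl: "?a \<in> carrier_mat n n" "?b \<in> carrier_mat n n" "?c \<in> carrier_mat n n" "?d \<in> carrier_mat n n"
    using M N by auto
  have "realify M * realify N = four_block_mat (?a * ?c + (- ?b) * ?d) (?a * (- ?d) + (- ?b) * ?c)
      (?b * ?c + ?a * ?d) (?b * (- ?d) + ?a * ?c)"
    unfolding realify_def using cl by (intro mult_four_block_mat) auto
  also have "?a * ?c + (- ?b) * ?d = map_mat re_fls (M * N)"
    unfolding map_mat_re_im_mult[OF M N] using cl by (intro eq_matI) auto
  also have "?a * (- ?d) + (- ?b) * ?c = - map_mat im_fls (M * N)"
    unfolding map_mat_re_im_mult[OF M N] using cl by (intro eq_matI) auto
  also have "?b * ?c + ?a * ?d = map_mat im_fls (M * N)"
    unfolding map_mat_re_im_mult[OF M N] using cl by (intro eq_matI) auto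
  also have "?b * (- ?d) + ?a * ?c = map_mat re_fls (M * N)"
    unfolding map_mat_re_im_mult[OF M N] using cl by (intro eq_matI) auto
  finally show ?thesis by (simp add: realify_def)
qed

lemma realify_one: "realify (1\<^sub>m n) = 1\<^sub>m (n + n)"
  unfolding realify_def
  by (intro eq_matI) (auto simp: re_im_fls_simps)

lemma realify_deriv:
  "M \<in> carrier_mat n n \<Longrightarrow> realify (map_mat fls_deriv M) = map_mat fls_deriv (realify M)"
  unfolding realify_def by (intro eq_matI) (auto simp: re_im_fls_simps)

lemma realify_elem:
  assumes "M \<in> carrier_mat n n" "i < n + n" "k < n + n"
  shows "realify M $$ (i, k) =
    (if i < n then if k < n then re_fls (M $$ (i, k)) else - im_fls (M $$ (i, k - n))
     else if k < n then im_fls (M $$ (i - n, k)) else re_fls (M $$ (i - n, k - n)))"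
proof -
  have dim: "dim_row M = n" "dim_col M = n" using assms(1) by auto
  have "i - n < n" if "\<not> i < n" using that assms(2) by linarith
  moreover have "k - n < n" if "\<not> k < n" using that assms(3) by linarith
  ultimately show ?thesis using assms(2,3) by (simp add: realify_def dim)
qed

section \<open>Stability under complex conjugation\<close>

lemma rat_diff_field_sel [simp]:
  "carrier rat_diff_field = UNIV" "monoid.mult rat_diff_field = (*)" "monoid.one rat_diff_field = 1"
  "ring.zero rat_diff_field = 0" "ring.add rat_diff_field = (+)" "deriv rat_diff_field = rat_deriv"
  by (simp_all add: rat_diff_field_def)

text \<open>
  A differential field over \<open>\<complex>(z)\<close> with constants \<open>\<complex>\<close>, embedded into Laurent series. The condition
  \<open>j_var\<close> expresses that the expansion is at a real point.
\<close>

locale laurent_embedding = diff_field R + field_embedding R j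
  for R :: "'e diff_ring" (structure) and j :: "'e \<Rightarrow> complex fls" +
  fixes \<iota> :: "complex poly fract \<Rightarrow> 'e"
  assumes \<iota>_hom: "\<iota> \<in> diff_ring_hom rat_diff_field R"
    and j_deriv: "x \<in> carrier R \<Longrightarrow> j (deriv R x) = fls_deriv (j x)"
    and j_const: "j (\<iota> (rat_const a)) = fls_const a"
    and j_var: "cnj_fls (j (\<iota> rat_var)) = j (\<iota> rat_var)"
    and constants_R: "constants R = \<iota> ` constants rat_diff_field"
begin

lemma \<iota>_closed [simp, intro]: "\<iota> x \<in> carrier R"
  and \<iota>_add: "\<iota> (x + y) = \<iota> x \<oplus> \<iota> y"
  and \<iota>_mult: "\<iota> (x * y) = \<iota> x \<otimes> \<iota> y"
  and \<iota>_one: "\<iota> 1 = \<one>"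
  and \<iota>_deriv: "\<iota> (rat_deriv x) = deriv R (\<iota> x)"
  using \<iota>_hom ring_hom_closed[of \<iota> rat_diff_field R] ring_hom_add[of \<iota> rat_diff_field R]
    ring_hom_mult[of \<iota> rat_diff_field R] ring_hom_one[of \<iota> rat_diff_field R]
  by (auto simp: diff_ring_hom_def)

lemma \<iota>_zero: "\<iota> 0 = \<zero>"
  using \<iota>_add[of 0 0] \<iota>_closed[of 0] by (simp add: add.l_cancel_one')

sublocale j\<iota>: field_hom "\<lambda>x. j (\<iota> x)"
  by unfold_locales (simp_all add: \<iota>_add \<iota>_mult \<iota>_one \<iota>_zero j_add j_mult j_one j_zero)

lemma j_rat_cnj: "j (\<iota> (rat_cnj q)) = cnj_fls (j (\<iota> q))"
proof -
  have poly: "j (\<iota> (rat_cnj (to_fract p))) = cnj_fls (j (\<iota> (to_fract p)))" for p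
  proof (induction p)
    case (pCons a p)
    thus ?case
      by (simp only: to_fract_pCons rat_cnj_hom.hom_add rat_cnj_hom.hom_mult rat_cnj_rat_const
          rat_cnj_rat_var j\<iota>.hom_add j\<iota>.hom_mult cnj_fls_hom.hom_add cnj_fls_hom.hom_mult
          j_const cnj_fls_const j_var)
  qed (simp add: \<iota>_zero j_zero)
  show ?thesis
    by (cases q) (simp only: Fract_conv_to_fract divide_inverse rat_cnj_hom.hom_mult
        rat_cnj_hom.hom_inverse j\<iota>.hom_mult j\<iota>.hom_inverse cnj_fls_hom.hom_mult
        cnj_fls_hom.hom_inverse poly)
qed

lemma image_mat_mult:
  assumes M: "M \<in> carrier_mat n n" "\<And>i k. i < n \<Longrightarrow> k < n \<Longrightarrow> M $$ (i, k) \<in> j ` carrier R"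
    and N: "N \<in> carrier_mat n n" "\<And>i k. i < n \<Longrightarrow> k < n \<Longrightarrow> N $$ (i, k) \<in> j ` carrier R"
    and ik: "i < n" "k < n"
  shows "(M * N) $$ (i, k) \<in> j ` carrier R"
proof -
  have "(\<Sum>l\<in>S. M $$ (i, l) * N $$ (l, k)) \<in> j ` carrier R" if "finite S" "S \<subseteq> {..<n}" for S
    using that
  proof (induction S rule: finite_induct)
    case (insert l S)
    hence "M $$ (i, l) * N $$ (l, k) \<in> j ` carrier R" using M N ik by (intro image_closed(2)) auto
    thus ?case using insert by (simp add: image_closed(1))
  qed (use image_closed(5) in simp)
  from this[of "{0..<n}"] show ?thesis using M N ik by (simp add: scalar_prod_def subset_eq)
qed

text \<open>
  If \<open>W\<close> solves \<open>y' = A y\<close> and \<open>C\<close> is the equivalence, then the conjugate of \<open>W\<close> multiplied by \<open>C\<close> is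
  again a solution of \<open>y' = A y\<close>, hence it is \<open>W\<close> times a matrix of complex constants.
\<close>

theorem equivalent_imp_cnj_stable:
  assumes A: "A \<in> carrier_mat n n" and W: "W \<in> GL_over R n"
    and sol: "map_mat (deriv R) W = mat_prod R n (map_mat \<iota> A) W"
    and gen: "carrier R = generate_field R (\<iota> ` UNIV \<union> elements_mat W)"
    and equiv: "equivalent_equations n A (map_mat rat_cnj A)"
    and x: "x \<in> carrier R"
  shows "cnj_fls (j x) \<in> j ` carrier R"
proof -
  obtain C C' where C: "C \<in> carrier_mat n n" "C' \<in> carrier_mat n n"
    "C * C' = 1\<^sub>m n" "C' * C = 1\<^sub>m n" "C' * A * C - C' * map_mat rat_deriv C = map_mat rat_cnj A"
    using equiv unfolding equivalent_equations_def inverts_mat_def by auto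
  have WM: "W \<in> mats_over R n" using W by (simp add: GL_over_def)
  obtain Z where Z: "Z \<in> mats_over R n" "map_mat j W * map_mat j Z = 1\<^sub>m n"
    "map_mat j Z * map_mat j W = 1\<^sub>m n" using W by (auto simp: GL_over_iff)
  define w y where "w = map_mat j W" and "y = map_mat j Z"
  define cw where "cw = map_mat cnj_fls w"
  let ?L = "map_mat (\<lambda>x. j (\<iota> x))"
  have cl: "w \<in> carrier_mat n n" "y \<in> carrier_mat n n" "cw \<in> carrier_mat n n" "?L A \<in> carrier_mat n n"
    "?L C \<in> carrier_mat n n" "?L C' \<in> carrier_mat n n" "?L (map_mat rat_deriv C) \<in> carrier_mat n n"
    using A WM Z C by (auto simp: w_def y_def cw_def mats_over_def)
  have Wc: "W \<in> carrier_mat n n" using WM by (simp add: mats_over_def)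
  have wy: "w * y = 1\<^sub>m n" "y * w = 1\<^sub>m n" using Z by (simp_all add: w_def y_def)
  have \<iota>A: "map_mat \<iota> A \<in> mats_over R n" using A by (intro mats_overI) auto
  have Dw: "map_mat fls_deriv w = ?L A * w"
  proof -
    have "map_mat fls_deriv w = map_mat j (map_mat (deriv R) W)"
      using Wc mats_over_elem[OF WM] by (intro eq_matI) (auto simp: j_deriv w_def)
    also have "\<dots> = map_mat j (map_mat \<iota> A) * w"
      unfolding sol map_mat_mat_prod[OF \<iota>A WM] w_def ..
    also have "map_mat j (map_mat \<iota> A) = ?L A" by (rule eq_matI) auto
    finally show ?thesis .
  qed
  have Dcw: "map_mat fls_deriv cw = ?L (map_mat rat_cnj A) * cw"
  proof -
    have "map_mat fls_deriv cw = map_mat cnj_fls (map_mat fls_deriv w)"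
      by (rule eq_matI) (auto simp: cw_def cnj_fls_deriv)
    also have "\<dots> = map_mat cnj_fls (?L A) * cw"
      unfolding Dw cw_def by (rule cnj_fls_hom.mat_hom_mult[OF cl(4,1)])
    also have "map_mat cnj_fls (?L A) = ?L (map_mat rat_cnj A)"
      by (rule eq_matI) (auto simp: j_rat_cnj)
    finally show ?thesis .
  qed
  have gauge: "C * map_mat rat_cnj A = A * C - map_mat rat_deriv C"
  proof -
    have DC: "map_mat rat_deriv C \<in> carrier_mat n n" using C by simp
    have "C * map_mat rat_cnj A = C * (C' * A * C - C' * map_mat rat_deriv C)" by (simp only: C(5))
    also have "\<dots> = C * (C' * A * C) - C * (C' * map_mat rat_deriv C)"
      using A C DC by (intro mult_minus_distrib_mat) auto
    also have "C * (C' * A * C) = (C * C') * (A * C)"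
      using A C(1,2) by (simp add: assoc_mult_mat[of _ n n _ n _ n])
    also have "C * (C' * map_mat rat_deriv C) = (C * C') * map_mat rat_deriv C"
      using C(1,2) DC by (simp add: assoc_mult_mat[of _ n n _ n _ n])
    finally show ?thesis using A C DC by simp
  qed
  define V where "V = ?L C * cw"
  have Vc: "V \<in> carrier_mat n n" using cl by (simp add: V_def)
  have DV: "map_mat fls_deriv V = ?L A * V"
  proof -
    have tA: "map_mat rat_cnj A \<in> carrier_mat n n" using A by simp
    have "map_mat fls_deriv V = map_mat fls_deriv (?L C) * cw + ?L C * (?L (map_mat rat_cnj A) * cw)"
      unfolding V_def map_mat_fls_deriv_mult[OF cl(5,3)] Dcw ..
    also have "map_mat fls_deriv (?L C) = ?L (map_mat rat_deriv C)"
      by (rule eq_matI) (auto simp: \<iota>_deriv j_deriv)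
    also have "?L C * (?L (map_mat rat_cnj A) * cw) = ?L (C * map_mat rat_cnj A) * cw"
      using cl tA by (simp add: assoc_mult_mat[of _ n n _ n _ n] j\<iota>.mat_hom_mult[OF C(1) tA])
    also have "?L (C * map_mat rat_cnj A) = ?L A * ?L C - ?L (map_mat rat_deriv C)"
      unfolding gauge j\<iota>.mat_hom_mult[OF A C(1), symmetric]
      using A C by (intro eq_matI) (auto simp: j\<iota>.hom_minus)
    also have "(?L A * ?L C - ?L (map_mat rat_deriv C)) * cw = ?L A * ?L C * cw - ?L (map_mat rat_deriv C) * cw"
      using cl by (intro minus_mult_distrib_mat) auto
    also have "?L A * ?L C * cw = ?L A * V"
      using cl by (simp add: V_def assoc_mult_mat[of _ n n _ n _ n])
    also have "?L (map_mat rat_deriv C) * cw + (?L A * V - ?L (map_mat rat_deriv C) * cw) = ?L A * V"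
      using cl Vc by (intro eq_matI) auto
    finally show ?thesis .
  qed
  define U where "U = y * V"
  have Uc: "U \<in> carrier_mat n n" using cl Vc by (simp add: U_def)
  have V: "V = w * U"
    using cl Vc wy by (simp add: U_def assoc_mult_mat[of w n n y n V n, symmetric])
  have DU: "map_mat fls_deriv U = 0\<^sub>m n n"
  proof -
    have DUc: "map_mat fls_deriv U \<in> carrier_mat n n" using Uc by simp
    have "?L A * V = ?L A * w * U + w * map_mat fls_deriv U"
      using DV map_mat_fls_deriv_mult[OF cl(1) Uc] by (simp add: V Dw)
    also have "?L A * w * U = ?L A * V" using cl Uc by (simp add: V assoc_mult_mat[of _ n n _ n _ n])
    finally have eq: "?L A * V = ?L A * V + w * map_mat fls_deriv U" .
    have "w * map_mat fls_deriv U = 0\<^sub>m n n"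
    proof (rule eq_matI)
      fix i k assume "i < dim_row (0\<^sub>m n n :: complex fls mat)" "k < dim_col (0\<^sub>m n n :: complex fls mat)"
      hence ik: "i < n" "k < n" by auto
      have "(?L A * V) $$ (i, k) = (?L A * V + w * map_mat fls_deriv U) $$ (i, k)"
        using eq by (rule arg_cong)
      also have "\<dots> = (?L A * V) $$ (i, k) + (w * map_mat fls_deriv U) $$ (i, k)"
        using ik cl Uc by (intro index_add_mat(1)) auto
      finally show "(w * map_mat fls_deriv U) $$ (i, k) = (0\<^sub>m n n :: complex fls mat) $$ (i, k)"
        using ik by simp
    qed (use cl Uc in auto)
    hence "y * (w * map_mat fls_deriv U) = 0\<^sub>m n n" using cl by simp
    thus ?thesis using cl DUc wy by (simp add: assoc_mult_mat[of y n n w n _ n, symmetric])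
  qed
  \<comment> \<open>The series with derivative \<open>0\<close> are the constants, and these come from \<open>\<complex>(z)\<close>.\<close>
  have U_image: "U $$ (i, k) \<in> j ` carrier R" if ik: "i < n" "k < n" for i k
  proof -
    have "fls_deriv (U $$ (i, k)) = map_mat fls_deriv U $$ (i, k)" using ik Uc by simp
    also have "\<dots> = 0" using ik by (simp add: DU)
    finally have "U $$ (i, k) = j (\<iota> (rat_const (fls_nth (U $$ (i, k)) 0)))"
      unfolding j_const by (rule fls_deriv_eq_0_imp_const)
    thus ?thesis by blast
  qed
  have cw: "cw = ?L C' * (w * U)"
  proof -
    have "?L C' * (?L C * cw) = ?L (C' * C) * cw"
      using cl by (simp add: assoc_mult_mat[of _ n n _ n _ n] j\<iota>.mat_hom_mult[OF C(2,1)])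
    also have "\<dots> = cw" using cl by (simp add: C(4) j\<iota>.mat_hom_one)
    finally show ?thesis by (simp add: V[symmetric] V_def)
  qed
  have cw_image: "cw $$ (i, k) \<in> j ` carrier R" if ik: "i < n" "k < n" for i k
    unfolding cw
  proof (rule image_mat_mult[OF cl(6) _ _ _ ik])
    show "?L C' $$ (a, b) \<in> j ` carrier R" if "a < n" "b < n" for a b using that C by auto
    show "w * U \<in> carrier_mat n n" using cl Uc by simp
    show "(w * U) $$ (a, b) \<in> j ` carrier R" if "a < n" "b < n" for a b
      by (rule image_mat_mult[OF cl(1) _ Uc U_image that])
        (use mats_over_elem[OF WM] Wc in \<open>auto simp: w_def\<close>)
  qed
  have "x \<in> generate_field R (\<iota> ` UNIV \<union> elements_mat W)" using x gen by simp
  hence "x \<in> carrier R \<and> cnj_fls (j x) \<in> j ` carrier R"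
  proof (induction rule: generate_field.induct)
    case one
    show ?case using image_closed(6) by (simp add: j_one)
  next
    case (incl h)
    show ?case
    proof (cases "h \<in> elements_mat W")
      case True
      then obtain a b where ab: "a < n" "b < n" "h = W $$ (a, b)" using Wc by (auto dest!: elements_matD)
      hence "cnj_fls (j h) = cw $$ (a, b)" using Wc by (simp add: cw_def w_def)
      thus ?thesis using cw_image[OF ab(1,2)] mats_over_elem[OF WM ab(1,2)] ab by simp
    next
      case False
      then obtain q where "h = \<iota> q" using incl by blast
      thus ?thesis by (auto simp flip: j_rat_cnj)
    qed
  next
    case (a_inv h)
    thus ?case by (simp add: j_minus cnj_fls_hom.hom_uminus image_closed)
  next
    case (m_inv h)
    thus ?case by (auto simp: j_inverse cnj_fls_hom.hom_inverse image_closed field_Units)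
  next
    case (eng_add h1 h2)
    thus ?case by (simp add: j_add cnj_fls_hom.hom_add image_closed)
  next
    case (eng_mult h1 h2)
    thus ?case by (simp add: j_mult cnj_fls_hom.hom_mult image_closed)
  qed
  thus ?thesis ..
qed

end

section \<open>The real form of the differential field\<close>

text \<open>
  Conjugation of coefficients now restricts to an involution of \<open>R\<close> that extends complex conjugation of
  rational functions and commutes with the derivation. The real form \<open>E\<close> is its fixed field.
\<close>

locale real_structure = laurent_embedding R j \<iota>
  for R :: "'e diff_ring" (structure) and j :: "'e \<Rightarrow> complex fls" and \<iota> +
  assumes cnj_stable: "x \<in> carrier R \<Longrightarrow> cnj_fls (j x) \<in> j ` carrier R"
begin

definition \<kappa> :: "real poly fract \<Rightarrow> 'e" where
  "\<kappa> x = \<iota> (rat_of_real x)"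

definition E :: "'e diff_ring" where
  "E = R\<lparr>carrier := {x \<in> carrier R. cnj_fls (j x) = j x}\<rparr>"

lemma E_sel [simp]: "carrier E = {x \<in> carrier R. cnj_fls (j x) = j x}"
  "monoid.mult E = monoid.mult R" "monoid.one E = \<one>"
  "ring.add E = ring.add R" "ring.zero E = \<zero>" "deriv E = deriv R"
  by (simp_all add: E_def)

lemma \<kappa>_closed [simp, intro]: "\<kappa> x \<in> carrier E"
  by (simp add: \<kappa>_def flip: j_rat_cnj)

lemma subfield_E: "subfield (carrier E) R"
proof (rule subfieldI')
  show "subring (carrier E) R"
    by (rule subringI) (auto simp: j_one j_minus j_mult j_add cnj_fls_hom.hom_uminus
        cnj_fls_hom.hom_mult cnj_fls_hom.hom_add)
  show "inv x \<in> carrier E" if "x \<in> carrier E - {\<zero>}" for x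
    using that by (auto simp: j_inverse field_Units cnj_fls_hom.hom_inverse)
qed

lemma field_E: "field E"
  using subfield_iff(2)[OF subfield_E] by (simp add: E_def)

lemma diff_field_E: "diff_field E"
proof -
  interpret E: field E by (rule field_E)
  show ?thesis
    by unfold_locales
      (auto simp: deriv_closed deriv_add deriv_mult j_deriv cnj_fls_deriv)
qed

sublocale E: diff_field E by (rule diff_field_E)

sublocale E: field_embedding E j
  by unfold_locales (auto simp: j_add j_mult j_one)

lemma \<kappa>_hom: "\<kappa> \<in> diff_ring_hom rat_diff_field E"
  unfolding diff_ring_hom_def
  by (auto intro!: ring_hom_memI simp: \<kappa>_def \<iota>_add \<iota>_mult \<iota>_one \<iota>_deriv rat_deriv_of_real
      rat_of_real_hom.hom_add rat_of_real_hom.hom_mult simp flip: j_rat_cnj)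

lemma re_im_in_image:
  assumes "x \<in> carrier R"
  shows "re_fls (j x) \<in> j ` carrier E" "im_fls (j x) \<in> j ` carrier E"
proof -
  have two: "2 \<in> j ` carrier R"
    using image_closed(1)[OF image_closed(6) image_closed(6)] by simp
  have i: "fls_i \<in> j ` carrier R" using j_const[of \<i>] by (metis \<iota>_closed image_eqI)
  have x: "j x \<in> j ` carrier R" using assms by blast
  note cl = image_closed cnj_stable[OF assms] two i x
  have "re_fls (j x) \<in> j ` carrier R"
    unfolding re_fls_def divide_inverse by (intro cl)
  then obtain y where "y \<in> carrier R" "re_fls (j x) = j y" by blast
  moreover from this have "y \<in> carrier E" by (simp flip: \<open>re_fls (j x) = j y\<close>)
  ultimately show "re_fls (j x) \<in> j ` carrier E" by blast
  have "im_fls (j x) \<in> j ` carrier R"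
    unfolding im_fls_def divide_inverse diff_conv_add_uminus by (intro cl)
  then obtain y where "y \<in> carrier R" "im_fls (j x) = j y" by blast
  moreover from this have "y \<in> carrier E" by (simp flip: \<open>im_fls (j x) = j y\<close>)
  ultimately show "im_fls (j x) \<in> j ` carrier E" by blast
qed

definition ii :: 'e where "ii = \<iota> (rat_const \<i>)"

lemma ii_closed [simp, intro]: "ii \<in> carrier R" and j_ii: "j ii = fls_i"
  by (simp_all add: ii_def j_const)

lemma decompose:
  assumes "x \<in> carrier R"
  obtains u v where "u \<in> carrier E" "v \<in> carrier E" "x = u \<oplus> ii \<otimes> v"
proof -
  from re_im_in_image[OF assms] obtain u v where
    uv: "u \<in> carrier E" "v \<in> carrier E" "j u = re_fls (j x)" "j v = im_fls (j x)" by fastforce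
  have "j x = j (u \<oplus> ii \<otimes> v)"
    using uv re_im_decompose[of "j x"] by (simp add: j_add j_mult j_ii)
  hence "x = u \<oplus> ii \<otimes> v" using uv assms by (simp add: j_inj)
  thus thesis using that uv by blast
qed

lemma decompose_eq_0:
  assumes "u \<in> carrier E" "v \<in> carrier E" "u \<oplus> ii \<otimes> v = \<zero>"
  shows "u = \<zero>" "v = \<zero>"
proof -
  have "j u + fls_i * j v = j (u \<oplus> ii \<otimes> v)" using assms(1,2) by (simp add: j_add j_mult j_ii)
  hence 0: "j u + fls_i * j v = 0" by (simp add: assms(3) j_zero)
  have "j u = 0" "j v = 0"
    using re_im_unique[of "j u" "j v"] assms(1,2) unfolding 0 by (simp_all add: re_im_fls_simps)
  thus "u = \<zero>" "v = \<zero>" using assms(1,2) by (simp_all add: j_eq_0_iff)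
qed

text \<open>
  A constant of \<open>E\<close> comes from some \<open>x \<in> \<complex>(z)\<close>. Being fixed by conjugation, it comes from the real part of
  \<open>x\<close>, which has derivative \<open>0\<close> because \<open>\<kappa>\<close> is injective.
\<close>

lemma constants_E: "constants E = \<kappa> ` constants rat_diff_field"
proof (intro equalityI subsetI)
  fix y assume "y \<in> \<kappa> ` constants rat_diff_field"
  then obtain x where x: "y = \<kappa> x" "rat_deriv x = 0" by (auto simp: constants_def)
  have "deriv R (\<kappa> x) = \<iota> (rat_of_real (rat_deriv x))"
    by (simp add: \<kappa>_def \<iota>_deriv rat_deriv_of_real)
  also have "\<dots> = \<zero>" using x(2) by (simp add: \<iota>_zero)
  finally show "y \<in> constants E" using x(1) \<kappa>_closed[of x] by (simp add: constants_def)
next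
  fix y assume y: "y \<in> constants E"
  hence "y \<in> constants R" by (simp add: constants_def)
  then obtain x where x: "y = \<iota> x" unfolding constants_R by blast
  obtain u v where uv: "x = rat_of_real u + rat_const \<i> * rat_of_real v"
    by (rule rat_real_imaginary_parts)
  have "j y = j (\<kappa> u) + fls_i * j (\<kappa> v)"
    by (simp add: x uv \<iota>_add \<iota>_mult j_add j_mult j_const \<kappa>_def)
  moreover have "re_fls (j y) = j y" using y by (simp add: constants_def re_fls_eq_iff)
  ultimately have "j y = j (\<kappa> u)"
    using re_im_unique(1)[of "j (\<kappa> u)" "j (\<kappa> v)"] \<kappa>_closed[of u] \<kappa>_closed[of v] by simp
  hence yu: "y = \<kappa> u" using y \<kappa>_closed[of u] by (simp add: j_inj constants_def)
  have "j (\<iota> (rat_of_real (rat_deriv u))) = j (deriv R y)"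
    by (simp add: yu \<kappa>_def \<iota>_deriv rat_deriv_of_real)
  also have "\<dots> = 0" using y by (simp add: constants_def j_zero)
  finally have "rat_deriv u = 0"
    using j\<iota>.hom_0_iff[of "rat_of_real (rat_deriv u)"] rat_of_real_hom.hom_0_iff by simp
  thus "y \<in> \<kappa> ` constants rat_diff_field" using yu by (auto simp: constants_def)
qed

text \<open>
  Restriction of scalars: a system of size \<open>n\<close> over \<open>\<complex>(z)\<close> becomes a system of size \<open>2 n\<close> over \<open>\<real>(z)\<close>
  for the real and imaginary parts of its solutions. These parts generate \<open>E\<close>, because the elements of \<open>R\<close>
  whose real and imaginary parts lie in a given subfield of \<open>E\<close> form a subfield of \<open>R\<close>.
\<close>

theorem picard_vessiot_E:
  assumes A: "A \<in> carrier_mat n n" and W: "W \<in> GL_over R n"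
    and sol: "map_mat (deriv R) W = mat_prod R n (map_mat \<iota> A) W"
    and gen: "carrier R = generate_field R (\<iota> ` UNIV \<union> elements_mat W)"
  shows "picard_vessiot rat_diff_field E \<kappa>"
proof -
  obtain re im where re_im: "\<And>x. x = rat_of_real (re x) + rat_const \<i> * rat_of_real (im x)"
    by (metis rat_real_imaginary_parts)
  have j_\<iota>: "j (\<iota> x) = j (\<kappa> (re x)) + fls_i * j (\<kappa> (im x))" for x
    by (subst re_im[of x]) (simp add: \<iota>_add \<iota>_mult j_add j_mult j_const \<kappa>_def)
  have re_j_\<iota>: "re_fls (j (\<iota> x)) = j (\<kappa> (re x))" "im_fls (j (\<iota> x)) = j (\<kappa> (im x))" for x
    using re_im_unique[of "j (\<kappa> (re x))" "j (\<kappa> (im x))"] \<kappa>_closed[of "re x"] \<kappa>_closed[of "im x"]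
    by (simp_all add: j_\<iota>)
  define B where "B = four_block_mat (map_mat re A) (- map_mat im A) (map_mat im A) (map_mat re A)"
  have B: "B \<in> carrier_mat (n + n) (n + n)"
    unfolding B_def using A by (intro four_block_carrier_mat) auto
  have \<kappa>_minus: "j (\<kappa> (- x)) = - j (\<kappa> x)" for x
    by (simp add: \<kappa>_def rat_of_real_hom.hom_uminus j\<iota>.hom_uminus)
  have rB: "realify (map_mat (\<lambda>x. j (\<iota> x)) A) = map_mat j (map_mat \<kappa> B)"
    unfolding realify_def B_def using A
    by (intro eq_matI) (auto simp: re_j_\<iota> \<kappa>_minus)
  have WM: "W \<in> mats_over R n" using W by (simp add: GL_over_def)
  have Wc: "W \<in> carrier_mat n n" using WM by (simp add: mats_over_def)
  obtain Z where Z: "Z \<in> mats_over R n" "map_mat j W * map_mat j Z = 1\<^sub>m n"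
    "map_mat j Z * map_mat j W = 1\<^sub>m n" using W by (auto simp: GL_over_iff)
  have Zc: "Z \<in> carrier_mat n n" using Z by (simp add: mats_over_def)
  have realify_image: "realify (map_mat j M) $$ (i, k) \<in> j ` carrier E"
    if M: "M \<in> mats_over R n" and ik: "i < n + n" "k < n + n" for M i k
  proof -
    have Mc: "map_mat j M \<in> carrier_mat n n" and Md: "dim_row M = n" "dim_col M = n"
      using M by (auto simp: mats_over_def)
    have "re_fls (map_mat j M $$ (a, b)) \<in> j ` carrier E" "im_fls (map_mat j M $$ (a, b)) \<in> j ` carrier E"
      if "a < n" "b < n" for a b
      using re_im_in_image[OF mats_over_elem[OF M that]] that by (simp_all add: Md)
    thus ?thesis
      using ik by (simp only: realify_elem[OF Mc ik]) (auto intro!: E.image_closed(3) simp del: E_sel)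
  qed
  have rc: "realify (map_mat j M) \<in> carrier_mat (n + n) (n + n)" if "M \<in> mats_over R n" for M
    using that by (intro realify_carrier) (simp add: mats_over_def)
  obtain W' where W': "W' \<in> mats_over E (n + n)" "map_mat j W' = realify (map_mat j W)"
    by (rule E.mat_preimage[OF rc[OF WM] realify_image[OF WM]])
  obtain Z' where Z': "Z' \<in> mats_over E (n + n)" "map_mat j Z' = realify (map_mat j Z)"
    by (rule E.mat_preimage[OF rc[OF Z(1)] realify_image[OF Z(1)]])
  have W'c: "W' \<in> carrier_mat (n + n) (n + n)" using W' by (simp add: mats_over_def)
  have GL: "W' \<in> GL_over E (n + n)"
    unfolding E.GL_over_iff using W' Z' Wc Zc Z(2,3)
      realify_mult[of "map_mat j W" n "map_mat j Z"] realify_mult[of "map_mat j Z" n "map_mat j W"]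
    by (auto simp: realify_one intro!: bexI[of _ Z'])
  have BM: "map_mat \<kappa> B \<in> mats_over E (n + n)"
    by (rule E.mats_overI) (use B \<kappa>_closed in \<open>auto simp del: E_sel(1)\<close>)
  have DW: "map_mat (deriv E) W' \<in> mats_over E (n + n)"
    by (rule E.mats_overI)
       (use W'c E.mats_over_elem[OF W'(1)] E.deriv_closed in \<open>auto simp del: E_sel\<close>)
  have \<iota>A: "map_mat \<iota> A \<in> mats_over R n" using A by (intro mats_overI) auto
  have sol': "map_mat (deriv E) W' = mat_prod E (n + n) (map_mat \<kappa> B) W'"
  proof (rule E.map_mat_inj[OF DW E.mat_prod_mats_over[OF BM W'(1)]])
    have "map_mat j (map_mat (deriv E) W') = map_mat fls_deriv (map_mat j W')"
      using W'c E.mats_over_elem[OF W'(1)] by (intro eq_matI) (auto simp: j_deriv)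
    also have "\<dots> = realify (map_mat fls_deriv (map_mat j W))"
      using Wc by (simp add: W'(2) realify_deriv[of _ n])
    also have "map_mat fls_deriv (map_mat j W) = map_mat j (map_mat (deriv R) W)"
      using Wc mats_over_elem[OF WM] by (intro eq_matI) (auto simp: j_deriv)
    also have "\<dots> = map_mat (\<lambda>x. j (\<iota> x)) A * map_mat j W"
      unfolding sol map_mat_mat_prod[OF \<iota>A WM]
      by (rule arg_cong[where f = "\<lambda>M. M * map_mat j W"]) (rule eq_matI; simp)
    also have "realify \<dots> = map_mat j (map_mat \<kappa> B) * map_mat j W'"
      using A Wc by (simp add: realify_mult[of _ n] rB W'(2))
    also have "\<dots> = map_mat j (mat_prod E (n + n) (map_mat \<kappa> B) W')"
      by (rule E.map_mat_mat_prod[OF BM W'(1), symmetric])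
    finally show "map_mat j (map_mat (deriv E) W') = map_mat j (mat_prod E (n + n) (map_mat \<kappa> B) W')" .
  qed
  \<comment> \<open>It remains to show that \<open>E\<close> is generated over \<open>\<real>(z)\<close> by the entries of \<open>W'\<close>.\<close>
  define H where "H = \<kappa> ` carrier rat_diff_field \<union> elements_mat W'"
  have H: "H \<subseteq> carrier E"
    using W'(1) \<kappa>_closed unfolding H_def mats_over_def by (auto simp del: E_sel)
  define K where "K = j ` generate_field E H"
  have GE: "generate_field E H \<subseteq> carrier E" by (rule E.generate_field_incl[OF H])
  note Kcl = E.image_generate_field_closed[OF H, folded K_def]
  have \<kappa>_K: "j (\<kappa> x) \<in> K" for x unfolding K_def H_def by (intro imageI generate_field.incl) auto
  have W_K: "re_fls (j w) \<in> K \<and> im_fls (j w) \<in> K" if w: "w \<in> elements_mat W" for w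
  proof -
    obtain a b where ab: "a < n" "b < n" "w = W $$ (a, b)" using w Wc by (auto dest!: elements_matD)
    have "realify (map_mat j W) $$ (a, b) = re_fls (j w)"
      using ab Wc realify_elem[of "map_mat j W" n a b] by simp
    moreover have "realify (map_mat j W) $$ (a + n, b) = im_fls (j w)"
      using ab Wc realify_elem[of "map_mat j W" n "a + n" b] by simp
    moreover have "realify (map_mat j W) $$ (i, k) \<in> K" if "i < n + n" "k < n + n" for i k
    proof -
      have "realify (map_mat j W) $$ (i, k) = j (W' $$ (i, k))"
        using that W'c by (simp flip: W'(2))
      moreover have "W' $$ (i, k) \<in> H" using that W'c by (auto simp: H_def)
      ultimately show ?thesis by (auto simp: K_def intro: generate_field.incl)
    qed
    ultimately show ?thesis using ab by (metis trans_less_add1 add_strict_right_mono)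
  qed
  have re_im_K: "x \<in> carrier R \<and> re_fls (j x) \<in> K \<and> im_fls (j x) \<in> K"
    if "x \<in> generate_field R (\<iota> ` UNIV \<union> elements_mat W)" for x
    using that
  proof (induction rule: generate_field.induct)
    case one
    show ?case using Kcl by (simp add: j_one re_im_fls_simps)
  next
    case (incl h)
    thus ?case using W_K \<kappa>_K WM by (auto simp: re_j_\<iota> mats_over_def)
  next
    case (a_inv h)
    thus ?case using Kcl by (simp add: j_minus re_im_fls_simps)
  next
    case (m_inv h)
    hence "inv h \<in> carrier R" "j (inv h) = inverse (j h)" by (auto simp: field_Units j_inverse)
    thus ?case using m_inv Kcl by (simp add: re_im_inverse)
  next
    case (eng_add h1 h2)
    thus ?case using Kcl by (simp add: j_add re_im_fls_simps)
  next
    case (eng_mult h1 h2)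
    hence h: "re_fls (j h1) \<in> K" "im_fls (j h1) \<in> K" "re_fls (j h2) \<in> K" "im_fls (j h2) \<in> K" by auto
    have "re_fls (j h1) * re_fls (j h2) + - (im_fls (j h1) * im_fls (j h2)) \<in> K"
      "re_fls (j h1) * im_fls (j h2) + im_fls (j h1) * re_fls (j h2) \<in> K"
      by (intro Kcl h)+
    thus ?case using eng_mult by (simp add: j_mult re_im_fls_simps)
  qed
  have "carrier E \<subseteq> generate_field E H"
  proof
    fix x assume x: "x \<in> carrier E"
    hence "x \<in> generate_field R (\<iota> ` UNIV \<union> elements_mat W)" by (simp flip: gen)
    hence "re_fls (j x) \<in> K" using re_im_K by blast
    hence "j x \<in> K" using x re_fls_eq_iff[of "j x"] by simp
    then obtain y where y: "y \<in> generate_field E H" "j x = j y" by (auto simp: K_def)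
    thus "x \<in> generate_field E H" using E.j_inj[OF x subsetD[OF GE y(1)]] by simp
  qed
  hence "carrier E = generate_field E H" using GE by blast
  moreover have "B \<in> mats_over rat_diff_field (n + n)" using B by (simp add: mats_over_def)
  ultimately have "picard_vessiot_for rat_diff_field E \<kappa> (n + n) B"
    unfolding picard_vessiot_for_def
    using diff_field_char_0_rat diff_field_E \<kappa>_hom GL sol' constants_E H_def by blast
  thus ?thesis unfolding picard_vessiot_def by blast
qed

end

section \<open>The tensor product with \<open>\<complex>(z)\<close>\<close>

context real_structure
begin

text \<open>
  The pieces of the construction of \<open>E \<otimes> \<complex>(z)\<close>: the ring on pairs, the relations, the ideal that they
  generate, and the quotient.
\<close>

abbreviation (input) "Pr \<equiv> free_ring_on_pairs E (rat_diff_field :: complex poly fract diff_ring)"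
abbreviation (input) "TR \<equiv> tensor_relations rat_diff_field E \<kappa> rat_diff_field rat_of_real"
abbreviation (input) "TI \<equiv> tensor_ideal rat_diff_field E \<kappa> rat_diff_field rat_of_real"
abbreviation (input) "Te \<equiv> diff_tensor rat_diff_field E \<kappa> rat_diff_field rat_of_real"

lemma diff_cring_E: "diff_cring E"
  by (rule E.diff_cring_axioms)

lemma diff_cring_rat: "diff_cring (rat_diff_field :: 'k::field_char_0 poly fract diff_ring)"
  using diff_field_char_0_rat[where 'a = 'k]
  by (simp add: diff_field_char_0_def diff_field_def)

lemma rat_of_real_diff_hom: "rat_of_real \<in> diff_ring_hom rat_diff_field rat_diff_field"
  unfolding diff_ring_hom_def
  by (auto intro!: ring_hom_memI simp: rat_of_real_hom.hom_add rat_of_real_hom.hom_mult rat_deriv_of_real)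

lemmas tensor_setup = diff_cring_E diff_cring_rat[where 'k = complex] diff_cring_rat[where 'k = real]
  \<kappa>_hom rat_of_real_diff_hom

sublocale Pr: cring Pr
  by (rule cring_free_ring_on_pairs[OF tensor_setup(1,2)])

sublocale TI: ideal TI Pr
  by (rule ideal_tensor_ideal[OF tensor_setup])

lemma Pr_sel: "carrier Pr = {x. Poly_Mapping.keys x \<subseteq> carrier E \<times> UNIV}"
  "monoid.one Pr = frag_of (\<one>, 1)" "ring.zero Pr = 0" "ring.add Pr = (+)"
  by (auto simp: free_ring_on_pairs_def)

lemma Pr_mult_of: "frag_of (a, b) \<otimes>\<^bsub>Pr\<^esub> frag_of (a', b') = frag_of (a \<otimes> a', b * b')"
  by (simp add: free_ring_on_pairs_def)

lemma Pr_mult_diff_left: "(x - y) \<otimes>\<^bsub>Pr\<^esub> w = x \<otimes>\<^bsub>Pr\<^esub> w - y \<otimes>\<^bsub>Pr\<^esub> w" "0 \<otimes>\<^bsub>Pr\<^esub> w = 0"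
  by (simp_all add: free_ring_on_pairs_def frag_extend_diff)

lemma Pr_of_closed: "a \<in> carrier E \<Longrightarrow> frag_of (a, b) \<in> carrier Pr"
  by (auto simp: Pr_sel)

lemma Pr_minus_closed: "x \<in> carrier Pr \<Longrightarrow> y \<in> carrier Pr \<Longrightarrow> x - y \<in> carrier Pr"
  using keys_diff[of x y] unfolding Pr_sel by blast

lemma Pr_add_closed: "x \<in> carrier Pr \<Longrightarrow> y \<in> carrier Pr \<Longrightarrow> x + y \<in> carrier Pr"
  using keys_add[of x y] unfolding Pr_sel by blast

lemma Pr_minus: "x \<in> carrier Pr \<Longrightarrow> \<ominus>\<^bsub>Pr\<^esub> x = - x"
  by (rule Pr.minus_equality) (auto simp: Pr_sel)

lemma Pr_a_minus: "x \<in> carrier Pr \<Longrightarrow> y \<in> carrier Pr \<Longrightarrow> x \<ominus>\<^bsub>Pr\<^esub> y = x - y"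
  by (simp add: a_minus_def Pr_minus Pr_sel(4))

lemma Pr_mult_diff_right:
  assumes "x \<in> carrier Pr" "y \<in> carrier Pr" "w \<in> carrier Pr"
  shows "w \<otimes>\<^bsub>Pr\<^esub> (x - y) = w \<otimes>\<^bsub>Pr\<^esub> x - w \<otimes>\<^bsub>Pr\<^esub> y" "w \<otimes>\<^bsub>Pr\<^esub> 0 = 0"
  using assms Pr.m_comm[of w] Pr_mult_diff_left Pr_minus_closed Pr.zero_closed
  by (simp_all add: Pr_sel(3))

lemma Pr_induct [consumes 1, case_names zero of_ diff]:
  assumes "x \<in> carrier Pr" "Q 0"
    "\<And>a b. a \<in> carrier E \<Longrightarrow> Q (frag_of (a, b))"
    "\<And>x y. x \<in> carrier Pr \<Longrightarrow> y \<in> carrier Pr \<Longrightarrow> Q x \<Longrightarrow> Q y \<Longrightarrow> Q (x - y)"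
  shows "Q x"
proof -
  have "Poly_Mapping.keys x \<subseteq> carrier E \<times> UNIV" using assms(1) by (simp add: Pr_sel)
  hence "x \<in> carrier Pr \<and> Q x"
  proof (induction x rule: frag_induction)
    case (one p)
    thus ?case using assms(3) Pr_of_closed by (cases p) (auto simp: Pr_sel)
  qed (use assms(2,4) Pr_minus_closed Pr.zero_closed in \<open>auto simp: Pr_sel(3)\<close>)
  thus ?thesis ..
qed

text \<open>
  The multiplication map \<open>a \<otimes> b \<mapsto> a b\<close> before passing to the quotient. Its values are taken in Laurent
  series, where integer multiples and sums over a finite support have their ordinary meaning.
\<close>

definition mult_map :: "('e \<times> complex poly fract \<Rightarrow>\<^sub>0 int) \<Rightarrow> complex fls" where
  "mult_map x = (\<Sum>p\<in>Poly_Mapping.keys x. of_int (Poly_Mapping.lookup x p) * (j (fst p) * j (\<iota> (snd p))))"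

lemma mult_map_superset:
  assumes "finite S" "Poly_Mapping.keys x \<subseteq> S"
  shows "mult_map x = (\<Sum>p\<in>S. of_int (Poly_Mapping.lookup x p) * (j (fst p) * j (\<iota> (snd p))))"
  unfolding mult_map_def using assms
  by (intro sum.mono_neutral_left) (auto simp: in_keys_iff)

lemma mult_map_diff: "mult_map (x - y) = mult_map x - mult_map y"
proof -
  let ?S = "Poly_Mapping.keys x \<union> Poly_Mapping.keys y"
  have "Poly_Mapping.keys (x - y) \<subseteq> ?S" by (rule keys_diff)
  thus ?thesis
    by (simp add: mult_map_superset[of ?S] lookup_minus left_diff_distrib sum_subtractf)
qed

lemma mult_map_0 [simp]: "mult_map 0 = 0"
  by (simp add: mult_map_def)

lemma mult_map_minus: "mult_map (- x) = - mult_map x"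
  using mult_map_diff[of 0 x] by simp

lemma mult_map_add: "mult_map (x + y) = mult_map x + mult_map y"
  using mult_map_diff[of x "- y"] by (simp add: mult_map_minus)

lemma mult_map_of [simp]: "mult_map (frag_of (a, b)) = j a * j (\<iota> b)"
  by (simp add: mult_map_def)

lemmas mult_map_simps = mult_map_diff mult_map_add mult_map_minus

lemma mult_map_mult:
  assumes "x \<in> carrier Pr" "y \<in> carrier Pr"
  shows "mult_map (x \<otimes>\<^bsub>Pr\<^esub> y) = mult_map x * mult_map y"
  using assms(1)
proof (induction x rule: Pr_induct)
  case (of_ a b)
  note ab = of_
  show ?case using assms(2)
  proof (induction y rule: Pr_induct)
    case zero
    show ?case using Pr_mult_diff_right(2)[OF assms(2,2) Pr_of_closed[OF ab]] by simp
  next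
    case (of_ a' b')
    thus ?case using ab by (simp add: Pr_mult_of j_mult \<iota>_mult)
  next
    case (diff u v)
    thus ?case using Pr_of_closed[OF ab]
      by (simp only: Pr_mult_diff_right mult_map_diff right_diff_distrib)
  qed
qed (simp_all add: Pr_mult_diff_left mult_map_diff left_diff_distrib)

lemma mult_map_leibniz:
  assumes "x \<in> carrier Pr"
  shows "mult_map (leibniz E rat_diff_field x) = fls_deriv (mult_map x)"
  using assms
  by (induction x rule: Pr_induct)
    (auto simp: leibniz_def frag_extend_diff mult_map_simps j_deriv \<iota>_deriv algebra_simps)

lemma mult_map_in_image: "x \<in> carrier Pr \<Longrightarrow> mult_map x \<in> j ` carrier R"
proof (induction x rule: Pr_induct)
  case (diff x y)
  hence "mult_map x + - mult_map y \<in> j ` carrier R" by (intro image_closed)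
  thus ?case by (simp add: mult_map_diff)
qed (auto intro!: image_closed)

lemma TI_closed: "x \<in> TI \<Longrightarrow> y \<in> TI \<Longrightarrow> x + y \<in> TI" "x \<in> TI \<Longrightarrow> y \<in> TI \<Longrightarrow> x - y \<in> TI"
  using TI.a_closed[of x y] TI.a_minus_closed[of x y] TI.Icarr Pr_a_minus[of x y]
  by (auto simp: Pr_sel(4))

lemma TI_zero: "0 \<in> TI" and TI_uminus: "x \<in> TI \<Longrightarrow> - x \<in> TI"
  using TI.zero_closed TI.a_inv_closed[of x] TI.Icarr[of x] by (auto simp: Pr_sel(3) Pr_minus)

lemma TR_closed: "TR \<subseteq> carrier Pr"
proof -
  have "\<kappa> q \<otimes> a \<in> carrier E" if "a \<in> carrier E" for q a
    using E.m_closed[OF \<kappa>_closed that] by simp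
  moreover have "a \<oplus> a' \<in> carrier E" if "a \<in> carrier E" "a' \<in> carrier E" for a a'
    using E.a_closed[OF that] by simp
  ultimately show ?thesis
    unfolding tensor_relations_def
    by (auto intro!: Pr_minus_closed Pr_of_closed simp del: E_sel(1))
qed

lemma TR_in_TI: "x \<in> TR \<Longrightarrow> x \<in> TI"
  unfolding tensor_ideal_def using Pr.genideal_self[OF TR_closed] by blast

lemma TI_relations:
  "a \<in> carrier E \<Longrightarrow> a' \<in> carrier E \<Longrightarrow> frag_of (a \<oplus> a', b) - frag_of (a, b) - frag_of (a', b) \<in> TI"
  "a \<in> carrier E \<Longrightarrow> frag_of (a, b + b') - frag_of (a, b) - frag_of (a, b') \<in> TI"
  "a \<in> carrier E \<Longrightarrow> frag_of (\<kappa> q \<otimes> a, b) - frag_of (a, rat_of_real q * b) \<in> TI"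
  by (rule TR_in_TI, unfold tensor_relations_def, force)+

lemma mult_map_TI: assumes "x \<in> TI" shows "mult_map x = 0"
proof -
  let ?K = "{x \<in> carrier Pr. mult_map x = 0}"
  have "ideal ?K Pr"
  proof (rule idealI[OF Pr.ring_axioms])
    show "subgroup ?K (add_monoid Pr)"
      by (rule Pr.add.subgroupI)
        (use Pr.zero_closed Pr.a_closed Pr.a_inv_closed in \<open>auto simp: Pr_sel(3,4) Pr_minus mult_map_simps\<close>)
  qed (auto simp: mult_map_mult)
  moreover have "TR \<subseteq> ?K"
  proof
    fix x assume x: "x \<in> TR"
    have "mult_map x = 0"
      using x unfolding tensor_relations_def
    proof (elim UnE CollectE exE conjE)
      fix a a' b assume x: "x = frag_of (a \<oplus>\<^bsub>E\<^esub> a', b) - frag_of (a, b) - frag_of (a', b)"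
        "a \<in> carrier E" "a' \<in> carrier E"
      thus ?thesis unfolding x by (simp add: mult_map_simps j_add distrib_right)
    next
      fix a b b' assume x: "x = frag_of (a, b \<oplus>\<^bsub>rat_diff_field\<^esub> b') - frag_of (a, b) - frag_of (a, b')"
      show ?thesis unfolding x by (simp add: mult_map_simps \<iota>_add j_add distrib_left)
    next
      fix a b q
      assume "x = frag_of (\<kappa> q \<otimes>\<^bsub>E\<^esub> a, b) - frag_of (a, rat_of_real q \<otimes>\<^bsub>rat_diff_field\<^esub> b)"
        "a \<in> carrier E"
      thus ?thesis by (simp add: mult_map_simps \<kappa>_def \<iota>_mult j_mult)
    qed
    thus "x \<in> ?K" using x TR_closed by blast
  qed
  ultimately have "TI \<subseteq> ?K" unfolding tensor_ideal_def by (rule Pr.genideal_minimal)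
  thus ?thesis using assms by blast
qed

lemma of_zero_TI: "frag_of (\<zero>, b) \<in> TI"
proof -
  have z: "\<zero> \<in> carrier E" using E.zero_closed by simp
  have "- frag_of (\<zero>, b) \<in> TI" using TI_relations(1)[OF z z, of b] by simp
  thus ?thesis using TI_uminus[of "- frag_of (\<zero>, b)"] by simp
qed

text \<open>
  As \<open>1\<close> and \<open>\<i>\<close> span \<open>\<complex>(z)\<close> over \<open>\<real>(z)\<close>, every tensor has the normal form \<open>u \<otimes> 1 + v \<otimes> \<i>\<close>. Its product
  \<open>u + \<i> v\<close> vanishes only if \<open>u\<close> and \<open>v\<close> do, which identifies the kernel of the multiplication map.
\<close>

lemma tensor_normal_form:
  assumes "x \<in> carrier Pr"
  shows "\<exists>u\<in>carrier E. \<exists>v\<in>carrier E. x - (frag_of (u, 1) + frag_of (v, rat_const \<i>)) \<in> TI"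
  using assms
proof (induction x rule: Pr_induct)
  case zero
  have "frag_of (\<zero>, 1) + frag_of (\<zero>, rat_const \<i>) \<in> TI" by (intro TI_closed of_zero_TI)
  hence "0 - (frag_of (\<zero>, 1) + frag_of (\<zero>, rat_const \<i>)) \<in> TI"
    by (intro TI_closed(2) TI_zero)
  thus ?case using E.zero_closed by auto
next
  case (of_ a b)
  obtain p q where b: "b = rat_of_real p + rat_const \<i> * rat_of_real q"
    by (rule rat_real_imaginary_parts)
  have 1: "frag_of (a, rat_of_real p + rat_of_real q * rat_const \<i>)
      - frag_of (a, rat_of_real p) - frag_of (a, rat_of_real q * rat_const \<i>) \<in> TI"
    using of_ by (rule TI_relations)
  have 2: "frag_of (\<kappa> p \<otimes> a, 1) - frag_of (a, rat_of_real p) \<in> TI"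
    using TI_relations(3)[OF of_, of p 1] by simp
  have 3: "frag_of (\<kappa> q \<otimes> a, rat_const \<i>) - frag_of (a, rat_of_real q * rat_const \<i>) \<in> TI"
    by (rule TI_relations(3)[OF of_])
  have "(frag_of (a, rat_of_real p + rat_of_real q * rat_const \<i>)
      - frag_of (a, rat_of_real p) - frag_of (a, rat_of_real q * rat_const \<i>))
      - (frag_of (\<kappa> p \<otimes> a, 1) - frag_of (a, rat_of_real p))
      - (frag_of (\<kappa> q \<otimes> a, rat_const \<i>) - frag_of (a, rat_of_real q * rat_const \<i>)) \<in> TI"
    by (rule TI_closed(2)[OF TI_closed(2)[OF 1 2] 3])
  hence "frag_of (a, b) - (frag_of (\<kappa> p \<otimes> a, 1) + frag_of (\<kappa> q \<otimes> a, rat_const \<i>)) \<in> TI"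
    by (simp add: b mult.commute algebra_simps)
  moreover have "\<kappa> s \<otimes> a \<in> carrier E" for s using E.m_closed[OF \<kappa>_closed of_] by simp
  ultimately show ?case by blast
next
  case (diff x y)
  then obtain u v u' v' where uv: "u \<in> carrier E" "v \<in> carrier E" "u' \<in> carrier E" "v' \<in> carrier E"
    "x - (frag_of (u, 1) + frag_of (v, rat_const \<i>)) \<in> TI"
    "y - (frag_of (u', 1) + frag_of (v', rat_const \<i>)) \<in> TI" by blast
  have m: "frag_of (a \<ominus>\<^bsub>E\<^esub> a', b) - frag_of (a, b) + frag_of (a', b) \<in> TI"
    if a: "a \<in> carrier E" "a' \<in> carrier E" for a a' b
  proof -
    have "a = (a \<ominus>\<^bsub>E\<^esub> a') \<oplus>\<^bsub>E\<^esub> a'" using a unfolding E_sel(1)[symmetric]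
      by (simp add: E.minus_eq E.a_assoc E.l_neg del: E_sel)
    hence "frag_of (a, b) - frag_of (a \<ominus>\<^bsub>E\<^esub> a', b) - frag_of (a', b) \<in> TI"
      using TI_relations(1)[OF E.minus_closed[OF a] a(2), of b] by simp
    from TI_uminus[OF this]
    show ?thesis by (simp add: algebra_simps)
  qed
  have "(x - (frag_of (u, 1) + frag_of (v, rat_const \<i>))) - (y - (frag_of (u', 1) + frag_of (v', rat_const \<i>)))
     - (frag_of (u \<ominus>\<^bsub>E\<^esub> u', 1) - frag_of (u, 1) + frag_of (u', 1))
     - (frag_of (v \<ominus>\<^bsub>E\<^esub> v', rat_const \<i>) - frag_of (v, rat_const \<i>) + frag_of (v', rat_const \<i>)) \<in> TI"
    by (intro TI_closed(2)[OF TI_closed(2)[OF TI_closed(2)]] m uv)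
  hence "(x - y) - (frag_of (u \<ominus>\<^bsub>E\<^esub> u', 1) + frag_of (v \<ominus>\<^bsub>E\<^esub> v', rat_const \<i>)) \<in> TI"
    by (simp add: algebra_simps)
  thus ?case using E.minus_closed uv by blast
qed

lemma mult_map_eq_0_iff: "x \<in> carrier Pr \<Longrightarrow> mult_map x = 0 \<longleftrightarrow> x \<in> TI"
proof
  assume x: "x \<in> carrier Pr" and 0: "mult_map x = 0"
  obtain u v where uv: "u \<in> carrier E" "v \<in> carrier E"
    "x - (frag_of (u, 1) + frag_of (v, rat_const \<i>)) \<in> TI" using tensor_normal_form[OF x] by blast
  from mult_map_TI[OF uv(3)] have "j u + fls_i * j v = 0"
    by (simp add: 0 mult_map_simps \<iota>_one j_one j_const mult.commute neg_eq_iff_add_eq_0)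
  hence "j (u \<oplus> ii \<otimes> v) = 0" using uv by (simp add: j_add j_mult j_ii)
  hence "u = \<zero>" "v = \<zero>" using decompose_eq_0[OF uv(1,2)] uv by (simp_all add: j_eq_0_iff)
  hence "(x - (frag_of (u, 1) + frag_of (v, rat_const \<i>))) + (frag_of (u, 1) + frag_of (v, rat_const \<i>)) \<in> TI"
    using uv(3) of_zero_TI by (intro TI_closed(1)) auto
  thus "x \<in> TI" by (simp only: diff_add_cancel)
qed (rule mult_map_TI)

text \<open>The value of \<open>mult_map\<close> is the same on all representatives of a tensor.\<close>

definition tensor_map :: "('e \<times> complex poly fract \<Rightarrow>\<^sub>0 int) set \<Rightarrow> 'e" where
  "tensor_map C = inv_into (carrier R) j (the_elem (mult_map ` C))"

lemma tensor_map_coset: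
  assumes x: "x \<in> carrier Pr"
  shows "tensor_map (TI +>\<^bsub>Pr\<^esub> x) \<in> carrier R" "j (tensor_map (TI +>\<^bsub>Pr\<^esub> x)) = mult_map x"
proof -
  have "mult_map y = mult_map x" if "y \<in> TI +>\<^bsub>Pr\<^esub> x" for y
    using that by (auto simp: a_r_coset_def' Pr_sel(4) mult_map_simps mult_map_TI)
  moreover have "x \<in> TI +>\<^bsub>Pr\<^esub> x" by (rule TI.a_rcos_self[OF x])
  ultimately have "mult_map ` (TI +>\<^bsub>Pr\<^esub> x) = {mult_map x}" by blast
  hence "tensor_map (TI +>\<^bsub>Pr\<^esub> x) = inv_into (carrier R) j (mult_map x)"
    by (simp add: tensor_map_def)
  thus "tensor_map (TI +>\<^bsub>Pr\<^esub> x) \<in> carrier R" "j (tensor_map (TI +>\<^bsub>Pr\<^esub> x)) = mult_map x"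
    using mult_map_in_image[OF x] by (simp_all add: inv_into_into f_inv_into_f)
qed

lemma coset_eq_iff:
  assumes x: "x \<in> carrier Pr" and y: "y \<in> carrier Pr"
  shows "TI +>\<^bsub>Pr\<^esub> x = TI +>\<^bsub>Pr\<^esub> y \<longleftrightarrow> mult_map x = mult_map y"
proof
  assume "TI +>\<^bsub>Pr\<^esub> x = TI +>\<^bsub>Pr\<^esub> y"
  thus "mult_map x = mult_map y" by (metis tensor_map_coset(2)[OF x] tensor_map_coset(2)[OF y])
next
  assume "mult_map x = mult_map y"
  hence "x - y \<in> TI"
    using mult_map_eq_0_iff[OF Pr_minus_closed[OF x y]] by (simp add: mult_map_diff)
  hence "(x - y) + y \<in> TI +>\<^bsub>Pr\<^esub> y" unfolding a_r_coset_def' Pr_sel(4) by blast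
  from TI.a_repr_independence'[OF this y] show "TI +>\<^bsub>Pr\<^esub> x = TI +>\<^bsub>Pr\<^esub> y" by simp
qed

lemma tensor_map_eqI:
  assumes "x \<in> carrier Pr" "r \<in> carrier R" "mult_map x = j r"
  shows "tensor_map (TI +>\<^bsub>Pr\<^esub> x) = r"
  using tensor_map_coset[OF assms(1)] assms(2,3) by (simp add: j_inj)

theorem tensor_E_iso:
  "diff_isomorphic_over rat_diff_field Te
     (pure_tensor rat_diff_field E \<kappa> rat_diff_field rat_of_real \<one>\<^bsub>E\<^esub>) R \<iota>"
proof -
  have sel: "carrier Te = {TI +>\<^bsub>Pr\<^esub> x | x. x \<in> carrier Pr}" "monoid.one Te = TI +>\<^bsub>Pr\<^esub> frag_of (\<one>, 1)"
    by (auto simp: diff_tensor_def Let_def FactRing_def A_RCOSETS_def' Pr_sel(2))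
  have add: "(TI +>\<^bsub>Pr\<^esub> x) \<oplus>\<^bsub>Te\<^esub> (TI +>\<^bsub>Pr\<^esub> y) = TI +>\<^bsub>Pr\<^esub> (x + y)"
    if "x \<in> carrier Pr" "y \<in> carrier Pr" for x y
    using TI.a_rcos_sum[OF that] by (simp add: diff_tensor_def Let_def FactRing_def Pr_sel(4))
  have mult: "(TI +>\<^bsub>Pr\<^esub> x) \<otimes>\<^bsub>Te\<^esub> (TI +>\<^bsub>Pr\<^esub> y) = TI +>\<^bsub>Pr\<^esub> (x \<otimes>\<^bsub>Pr\<^esub> y)"
    if "x \<in> carrier Pr" "y \<in> carrier Pr" for x y
    using TI.rcoset_mult_add[OF that] by (simp add: diff_tensor_def Let_def FactRing_def)
  have der: "deriv Te (TI +>\<^bsub>Pr\<^esub> x) = TI +>\<^bsub>Pr\<^esub> leibniz E rat_diff_field x" if "x \<in> carrier Pr" for x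
    by (rule deriv_diff_tensor[OF tensor_setup that])
  have leibniz_closed: "leibniz E rat_diff_field x \<in> carrier Pr" if "x \<in> carrier Pr" for x
    using that
  proof (induction x rule: Pr_induct)
    case zero
    show ?case using Pr.zero_closed by (simp add: leibniz_def Pr_sel(3))
  next
    case (of_ a b)
    have "deriv E a \<in> carrier E" using of_ by (rule E.deriv_closed)
    thus ?case using of_ by (auto simp: leibniz_def intro!: Pr_add_closed Pr_of_closed simp del: E_sel(1))
  next
    case (diff x y)
    thus ?case by (simp add: leibniz_def frag_extend_diff Pr_minus_closed)
  qed
  have one: "\<one> \<in> carrier E" using E.one_closed by simp
  have hom: "tensor_map \<in> Ring.ring_hom Te R"
  proof (rule ring_hom_memI)
    show "tensor_map C \<in> carrier R" if "C \<in> carrier Te" for C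
      using that tensor_map_coset by (auto simp: sel)
    show "tensor_map (C \<otimes>\<^bsub>Te\<^esub> C') = tensor_map C \<otimes> tensor_map C'"
      if "C \<in> carrier Te" "C' \<in> carrier Te" for C C'
    proof -
      obtain x y where xy: "C = TI +>\<^bsub>Pr\<^esub> x" "C' = TI +>\<^bsub>Pr\<^esub> y" "x \<in> carrier Pr" "y \<in> carrier Pr"
        using \<open>C \<in> carrier Te\<close> \<open>C' \<in> carrier Te\<close> unfolding sel by blast
      show ?thesis unfolding xy(1,2) mult[OF xy(3,4)]
        using tensor_map_coset xy(3,4) by (intro tensor_map_eqI) (simp_all add: mult_map_mult j_mult)
    qed
    show "tensor_map (C \<oplus>\<^bsub>Te\<^esub> C') = tensor_map C \<oplus> tensor_map C'"
      if "C \<in> carrier Te" "C' \<in> carrier Te" for C C'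
    proof -
      obtain x y where xy: "C = TI +>\<^bsub>Pr\<^esub> x" "C' = TI +>\<^bsub>Pr\<^esub> y" "x \<in> carrier Pr" "y \<in> carrier Pr"
        using \<open>C \<in> carrier Te\<close> \<open>C' \<in> carrier Te\<close> unfolding sel by blast
      show ?thesis unfolding xy(1,2) add[OF xy(3,4)]
        using tensor_map_coset xy(3,4)
        by (intro tensor_map_eqI) (simp_all add: mult_map_simps j_add Pr_add_closed)
    qed
    show "tensor_map \<one>\<^bsub>Te\<^esub> = \<one>"
      unfolding sel(2) by (intro tensor_map_eqI Pr_of_closed one) (simp_all add: \<iota>_one j_one)
  qed
  have "bij_betw tensor_map (carrier Te) (carrier R)"
  proof (rule bij_betw_imageI)
    show "inj_on tensor_map (carrier Te)"
    proof (rule inj_onI)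
      fix C C' assume C: "C \<in> carrier Te" "C' \<in> carrier Te" "tensor_map C = tensor_map C'"
      obtain x y where xy: "C = TI +>\<^bsub>Pr\<^esub> x" "C' = TI +>\<^bsub>Pr\<^esub> y" "x \<in> carrier Pr" "y \<in> carrier Pr"
        using C(1,2) unfolding sel by blast
      have "mult_map x = mult_map y"
        using C(3) tensor_map_coset(2)[OF xy(3)] tensor_map_coset(2)[OF xy(4)] by (simp add: xy)
      thus "C = C'" unfolding xy(1,2) coset_eq_iff[OF xy(3,4)] .
    qed
    show "tensor_map ` carrier Te = carrier R"
    proof (intro equalityI subsetI)
      fix r assume "r \<in> tensor_map ` carrier Te"
      thus "r \<in> carrier R" using tensor_map_coset by (auto simp: sel)
    next
      fix r assume r: "r \<in> carrier R"
      obtain u v where uv: "u \<in> carrier E" "v \<in> carrier E" "r = u \<oplus> ii \<otimes> v" by (rule decompose[OF r])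
      let ?x = "frag_of (u, 1) + frag_of (v, rat_const \<i>)"
      have x: "?x \<in> carrier Pr" using uv by (intro Pr_add_closed Pr_of_closed)
      have "tensor_map (TI +>\<^bsub>Pr\<^esub> ?x) = r"
        using uv r by (intro tensor_map_eqI x)
          (simp_all add: mult_map_simps j_add j_mult j_ii \<iota>_one j_one j_const mult.commute)
      thus "r \<in> tensor_map ` carrier Te" using x unfolding sel by blast
    qed
  qed
  with hom have "tensor_map \<in> ring_iso Te R" by (simp add: ring_iso_def)
  moreover have "tensor_map \<in> diff_ring_hom Te R"
  proof -
    have "tensor_map (deriv Te C) = deriv R (tensor_map C)" if C: "C \<in> carrier Te" for C
    proof -
      obtain x where x: "C = TI +>\<^bsub>Pr\<^esub> x" "x \<in> carrier Pr" using C unfolding sel by blast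
      show ?thesis unfolding x(1) der[OF x(2)]
        using tensor_map_coset[OF x(2)] x(2)
        by (intro tensor_map_eqI leibniz_closed deriv_closed) (simp_all add: mult_map_leibniz j_deriv)
    qed
    thus ?thesis using hom by (simp add: diff_ring_hom_def)
  qed
  moreover have "tensor_map (pure_tensor rat_diff_field E \<kappa> rat_diff_field rat_of_real \<one>\<^bsub>E\<^esub> x) = \<iota> x" for x
    unfolding pure_tensor_def using one by (intro tensor_map_eqI) (simp_all add: Pr_of_closed j_one)
  ultimately show ?thesis unfolding diff_isomorphic_over_def by blast
qed

end

section \<open>Descent of Picard-Vessiot extensions\<close>

theorem proposition1p5:
  fixes n :: nat
    and A :: "complex poly fract mat"
    and Et :: "'e diff_ring"
    and \<iota> :: "complex poly fract \<Rightarrow> 'e"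
  assumes "A \<in> carrier_mat n n"
    and "picard_vessiot_for rat_diff_field Et \<iota> n A"
    and "equivalent_equations n A (map_mat rat_cnj A)"
  shows "\<exists>(E :: 'e diff_ring) (\<kappa> :: real poly fract \<Rightarrow> 'e).
           picard_vessiot rat_diff_field E \<kappa> \<and>
           diff_isomorphic_over (rat_diff_field :: complex poly fract diff_ring)
             (diff_tensor rat_diff_field E \<kappa> rat_diff_field rat_of_real)
             (pure_tensor rat_diff_field E \<kappa> rat_diff_field rat_of_real \<one>\<^bsub>E\<^esub>)
             Et \<iota>"
proof -
  have df: "diff_field Et" and \<iota>_hom: "\<iota> \<in> diff_ring_hom rat_diff_field Et"
    and constants_Et: "constants Et = \<iota> ` constants rat_diff_field"
    using assms(2) unfolding picard_vessiot_for_def by auto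
  obtain W where W: "W \<in> GL_over Et n" "map_mat (deriv Et) W = mat_prod Et n (map_mat \<iota> A) W"
    "carrier Et = generate_field Et (\<iota> ` UNIV \<union> elements_mat W)"
    using assms(2) unfolding picard_vessiot_for_def by auto
  have WM: "W \<in> carrier_mat n n" "elements_mat W \<subseteq> carrier Et"
    using W(1) by (auto simp: GL_over_def mats_over_def)
  interpret Et: diff_field Et by (rule df)
  have \<iota>: "\<iota> x \<in> carrier Et" "\<iota> (x + y) = \<iota> x \<oplus>\<^bsub>Et\<^esub> \<iota> y" "\<iota> (x * y) = \<iota> x \<otimes>\<^bsub>Et\<^esub> \<iota> y"
    "\<iota> 1 = \<one>\<^bsub>Et\<^esub>" "\<iota> (rat_deriv x) = deriv Et (\<iota> x)" for x y
    using \<iota>_hom ring_hom_closed[of \<iota> rat_diff_field Et] ring_hom_add[of \<iota> rat_diff_field Et]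
      ring_hom_mult[of \<iota> rat_diff_field Et] ring_hom_one[of \<iota> rat_diff_field Et]
    by (auto simp: diff_ring_hom_def)
  have \<iota>0: "\<iota> 0 = \<zero>\<^bsub>Et\<^esub>"
    using \<iota>(2)[of 0 0] \<iota>(1)[of 0] by (simp add: Et.add.l_cancel_one')
  have \<iota>_nz: "\<iota> x \<noteq> \<zero>\<^bsub>Et\<^esub>" if "x \<noteq> 0" for x
  proof
    assume "\<iota> x = \<zero>\<^bsub>Et\<^esub>"
    hence "\<iota> (x * inverse x) = \<zero>\<^bsub>Et\<^esub>" using \<iota>(1)[of "inverse x"] by (simp add: \<iota>(3))
    thus False using that by (simp add: \<iota>(4) Et.one_not_zero)
  qed
  define c where "c = (\<lambda>a. \<iota> (rat_const a))"
  \<comment> \<open>The sequence starts with \<open>z\<close>, continues with the entries of \<open>W\<close> row by row, and is padded by \<open>0\<close>.\<close>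
  define G where "G = (\<lambda>k. if k = 0 then \<iota> rat_var
     else if k - 1 < n * n then W $$ ((k - 1) div n, (k - 1) mod n) else \<zero>\<^bsub>Et\<^esub>)"
  interpret C: diff_field_over_complex Et c G
  proof unfold_locales
    show "c a \<in> carrier Et" "c (a + b) = c a \<oplus>\<^bsub>Et\<^esub> c b" "c (a * b) = c a \<otimes>\<^bsub>Et\<^esub> c b"
      "c 1 = \<one>\<^bsub>Et\<^esub>" "deriv Et (c a) = \<zero>\<^bsub>Et\<^esub>" for a b
      by (simp_all add: c_def \<iota>(1-4) \<iota>0 rat_const_hom.hom_add rat_const_hom.hom_mult flip: \<iota>(5))
    show "x \<in> range c" if "x \<in> carrier Et" "deriv Et x = \<zero>\<^bsub>Et\<^esub>" for x
    proof -
      have "x \<in> constants Et" using that by (simp add: constants_def)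
      hence "x \<in> \<iota> ` constants rat_diff_field" by (simp only: constants_Et)
      thus ?thesis using rat_deriv_eq_0_imp_const by (fastforce simp: constants_def c_def)
    qed
    show "G i \<in> carrier Et" for i
    proof -
      have "W $$ (k div n, k mod n) \<in> carrier Et" if "k < n * n" for k
      proof -
        have "0 < n" using that by (cases n) auto
        hence "k div n < n" "k mod n < n" using that by (simp_all add: less_mult_imp_div_less)
        thus ?thesis using WM by blast
      qed
      thus ?thesis by (auto simp: G_def \<iota>(1))
    qed
    show "deriv Et (G 0) = \<one>\<^bsub>Et\<^esub>" by (simp add: G_def \<iota>(4) flip: \<iota>(5))
  qed
  have poly_span: "\<iota> (to_fract p) \<in> C.span" for p
  proof (induction p)
    case 0
    show ?case using C.span_zero by (simp add: \<iota>0)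
  next
    case (pCons a p)
    have "\<iota> rat_var \<in> C.span" using C.gens_in_span[OF C.gens_intros(1)[of 0]] by (simp add: G_def)
    moreover have "\<iota> (rat_const a) \<in> C.span" using C.c_in_span[of a] by (simp add: c_def)
    ultimately show ?case unfolding to_fract_pCons \<iota>(2,3) using pCons by (intro C.span_add C.span_mult)
  qed
  have fractions: "\<exists>v\<in>C.span. v \<noteq> \<zero>\<^bsub>Et\<^esub> \<and> x \<otimes>\<^bsub>Et\<^esub> v \<in> C.span" if "x \<in> carrier Et" for x
  proof -
    have "x \<in> carrier Et \<and> (\<exists>v\<in>C.span. v \<noteq> \<zero>\<^bsub>Et\<^esub> \<and> x \<otimes>\<^bsub>Et\<^esub> v \<in> C.span)"
    proof (rule C.generated_imp_fraction)
      show "x \<in> generate_field Et (\<iota> ` UNIV \<union> elements_mat W)" using that by (simp only: flip: W(3))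
      fix h assume "h \<in> \<iota> ` UNIV \<union> elements_mat W"
      thus "h \<in> carrier Et \<and> (\<exists>v\<in>C.span. v \<noteq> \<zero>\<^bsub>Et\<^esub> \<and> h \<otimes>\<^bsub>Et\<^esub> v \<in> C.span)"
      proof
        assume "h \<in> \<iota> ` UNIV"
        then obtain q where q: "h = \<iota> q" by blast
        obtain a b where ab: "q = Fract a b" "b \<noteq> 0" by (cases q)
        have "h \<otimes>\<^bsub>Et\<^esub> \<iota> (to_fract b) = \<iota> (to_fract a)"
          using ab(2) by (simp add: q ab(1) Fract_conv_to_fract flip: \<iota>(3))
        thus ?thesis using poly_span \<iota>(1) \<iota>_nz[of "to_fract b"] ab(2) q
          by (auto intro!: bexI[of _ "\<iota> (to_fract b)"])
      next
        assume "h \<in> elements_mat W"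
        then obtain a b where ab: "a < n" "b < n" "h = W $$ (a, b)"
          using WM(1) by (auto dest!: elements_matD)
        have "a * n + b < n * n"
        proof -
          have "a * n + b < a * n + n" using ab by simp
          also have "\<dots> = Suc a * n" by simp
          also have "\<dots> \<le> n * n" using ab by (intro mult_right_mono) auto
          finally show ?thesis .
        qed
        hence "G (Suc (a * n + b)) = h" using ab by (simp add: G_def)
        hence "h \<in> C.gens" using C.gens_intros(1)[of "Suc (a * n + b)"] by simp
        thus ?thesis using C.gens_in_span C.gens_closed C.span_one Et.one_not_zero
          by (auto intro!: bexI[of _ "\<one>\<^bsub>Et\<^esub>"])
      qed
    qed
    thus ?thesis ..
  qed
  obtain r j where j: "\<And>x y. x \<in> carrier Et \<Longrightarrow> y \<in> carrier Et \<Longrightarrow> j (x \<oplus>\<^bsub>Et\<^esub> y) = j x + j y"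
    "\<And>x y. x \<in> carrier Et \<Longrightarrow> y \<in> carrier Et \<Longrightarrow> j (x \<otimes>\<^bsub>Et\<^esub> y) = j x * j y"
    "\<And>x. x \<in> carrier Et \<Longrightarrow> j (deriv Et x) = fls_deriv (j x)"
    "\<And>a. j (c a) = fls_const a" "j (G 0) = fls_const (complex_of_real r) + fls_X"
    using C.exists_laurent_embedding[OF fractions] by metis
  interpret laurent_embedding Et j \<iota>
  proof unfold_locales
    show "j \<one>\<^bsub>Et\<^esub> = 1" using j(4)[of 1] by (simp add: c_def \<iota>(4))
    show "cnj_fls (j (\<iota> rat_var)) = j (\<iota> rat_var)"
      using j(5) by (simp add: G_def cnj_fls_hom.hom_add)
  qed (use j \<iota>_hom constants_Et in \<open>simp_all add: c_def\<close>)
  interpret real_structure Et j \<iota>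
    by unfold_locales (rule equivalent_imp_cnj_stable[OF assms(1) W assms(3)])
  show ?thesis
    using picard_vessiot_E[OF assms(1) W] tensor_E_iso by blast
qed

end
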